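(* Let $n\ge 1$ and let $\mathcal{C}$ be an irreducible curve in $(\mathbb{C}^{n+1},0)$ with value semigroup $\Gamma=\langle v_0,v_1,\ldots,v_g\rangle$ (minimal generating set, $v_0<v_1<\cdots<v_g$). Any primitive non-degenerate parametrization of $\mathcal{C}$ is $\mathcal{A}$-equivalent to a parametrization of the form $$\left( t^{v_0},\ t^{w_1}+\sum_{\substack{j>w_1\\ j\notin \Gamma\cup(\Gamma+v_1-v_0)}} a_{1j}t^j,\ t^{w_2}+\sum_{\substack{j>w_2\\ j\notin\Gamma}} a_{2j}t^j,\ \ldots,\ t^{w_n}+\sum_{\substack{j>w_n\\ j\notin\Gamma}} a_{nj}t^j\right),\qquad a_{ij}\in\mathbb{C},$$ where $v_0<w_1<w_2<\cdots<w_n$, $w_1=v_1=\min(\Gamma\setminus\langle v_0\rangle)$, and $w_i=\min(\Gamma\setminus\Gamma_i)$ for $i\in\{2,\ldots,n\}$, the semigroups $\Gamma_i$ being those of the displayed parametrization.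
   Context: A parametrization is an analytic map-germ $\phi=(p_0,\ldots,p_n):(\mathbb{C},0)\to(\mathbb{C}^{n+1},0)$. It is primitive if it cannot be written as $\psi(\tau(t))$ with $\psi$ an analytic map-germ and $\tau\in\mathbb{C}\{t\}$ of order at least $2$; equivalently, $t$ is a quotient of two elements of $\mathcal{O}=\mathbb{C}\{p_0(t),\ldots,p_n(t)\}\subset\mathbb{C}\{t\}$. Two map-germs $\phi_1,\phi_2:(\mathbb{C},0)\to(\mathbb{C}^{n+1},0)$ are $\mathcal{A}$-equivalent if $\phi_2=\sigma\circ\phi_1\circ\rho^{-1}$ for some $(\rho,\sigma)\in\mathcal{A}=\mathrm{Diff}(\mathbb{C},0)\times\mathrm{Diff}(\mathbb{C}^{n+1},0)$ (germs of analytic diffeomorphisms fixing the origin). $\phi$ is degenerate if it is $\mathcal{A}$-equivalent to a map-germ having an identically zero component, and non-degenerate otherwise. The value semigroup of $\phi$ is $\Gamma=\Gamma(\phi)=\{\mathrm{ord}_t(g(\phi(t))) : g\in\mathbb{C}\{X,Y_1,\ldots,Y_n\},\ g(\phi(t))\neq 0\}$; for primitive $\phi$ it is a numerical semigroup, and it is invariant under $\mathcal{A}$-equivalence. For $1\le i\le n$, $\Gamma_i=\{\mathrm{ord}_t(h(p_0(t),\ldots,p_{i-1}(t))) : h\in\mathbb{C}\{X,Y_1,\ldots,Y_{i-1}\},\ h(p_0(t),\ldots,p_{i-1}(t))\ne 0\}$. $\langle v_0,\ldots,v_g\rangle$ denotes the set of all $\mathbb{N}$-linear combinations of $v_0,\ldots,v_g$,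 and $\Gamma+v_1-v_0=\{\gamma+v_1-v_0:\gamma\in\Gamma\}$. *)

theory Defs
  imports "HOL-Complex_Analysis.Complex_Analysis" "HOL-Library.Extended_Nat"
begin

text \<open>
  Germs at the origin are represented by functions, and germs are equal when the functions agree
  near the origin. A point of complex \<open>m\<close>-space is a function \<open>nat \<Rightarrow> complex\<close> of
  which only the coordinates \<open>i < m\<close> are relevant.
\<close>

definition polydisc :: "nat \<Rightarrow> real \<Rightarrow> (nat \<Rightarrow> complex) set" where
  "polydisc m r = {x. \<forall>i<m. norm (x i) < r}"

text \<open>
  The ring of convergent power series in \<open>m\<close> variables; \<open>\<alpha>\<close> ranges over the multi-indices.
  A function in it depends, near the origin, on the coordinates \<open>i < m\<close> only.
\<close>

definition analytic_germ :: "nat \<Rightarrow> ((nat \<Rightarrow> complex) \<Rightarrow> complex) \<Rightarrow> bool" where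
  "analytic_germ m f \<longleftrightarrow>
     (\<exists>(c :: (nat \<Rightarrow> nat) \<Rightarrow> complex) r. r > 0 \<and>
        (\<forall>x\<in>polydisc m r.
           ((\<lambda>\<alpha>. c \<alpha> * (\<Prod>i<m. x i ^ \<alpha> i)) has_sum f x) {\<alpha>. \<forall>i\<ge>m. \<alpha> i = 0}))"

definition parametrization :: "nat \<Rightarrow> (complex \<Rightarrow> nat \<Rightarrow> complex) \<Rightarrow> bool" where
  "parametrization m \<phi> \<longleftrightarrow> (\<forall>i<m. (\<lambda>t. \<phi> t i) analytic_on {0} \<and> \<phi> 0 i = 0)"

text \<open>The order in \<open>t\<close>; the zero germ has order \<open>\<infinity>\<close>, whereas \<open>subdegree 0 = 0\<close>.\<close>

definition germ_ord :: "(complex \<Rightarrow> complex) \<Rightarrow> enat" where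
  "germ_ord f = (if \<forall>\<^sub>F t in nhds 0. f t = 0 then \<infinity> else enat (subdegree (fps_expansion f 0)))"

definition primitive :: "nat \<Rightarrow> (complex \<Rightarrow> nat \<Rightarrow> complex) \<Rightarrow> bool" where
  "primitive m \<phi> \<longleftrightarrow>
     \<not> (\<exists>\<psi> \<tau>. parametrization m \<psi> \<and> \<tau> analytic_on {0} \<and> germ_ord \<tau> \<ge> 2 \<and>
            (\<forall>\<^sub>F t in nhds 0. \<forall>i<m. \<phi> t i = \<psi> (\<tau> t) i))"

text \<open>\<open>\<rho>\<close> is a germ of analytic diffeomorphism of the line fixing the origin, with inverse \<open>\<rho>'\<close>.\<close>

definition line_diff :: "(complex \<Rightarrow> complex) \<Rightarrow> (complex \<Rightarrow> complex) \<Rightarrow> bool" where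
  "line_diff \<rho> \<rho>' \<longleftrightarrow>
     \<rho> analytic_on {0} \<and> \<rho>' analytic_on {0} \<and> \<rho> 0 = 0 \<and> \<rho>' 0 = 0 \<and>
     (\<forall>\<^sub>F t in nhds 0. \<rho> (\<rho>' t) = t \<and> \<rho>' (\<rho> t) = t)"

text \<open>Likewise in \<open>m\<close>-space.\<close>

definition space_diff ::
  "nat \<Rightarrow> ((nat \<Rightarrow> complex) \<Rightarrow> nat \<Rightarrow> complex) \<Rightarrow> ((nat \<Rightarrow> complex) \<Rightarrow> nat \<Rightarrow> complex) \<Rightarrow> bool" where
  "space_diff m \<sigma> \<sigma>' \<longleftrightarrow>
     (\<forall>i<m. analytic_germ m (\<lambda>x. \<sigma> x i) \<and> analytic_germ m (\<lambda>x. \<sigma>' x i) \<and>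
            \<sigma> (\<lambda>_. 0) i = 0 \<and> \<sigma>' (\<lambda>_. 0) i = 0) \<and>
     (\<exists>r>0. \<forall>x\<in>polydisc m r. \<forall>i<m. \<sigma> (\<sigma>' x) i = x i \<and> \<sigma>' (\<sigma> x) i = x i)"

definition A_equivalent ::
  "nat \<Rightarrow> (complex \<Rightarrow> nat \<Rightarrow> complex) \<Rightarrow> (complex \<Rightarrow> nat \<Rightarrow> complex) \<Rightarrow> bool" where
  "A_equivalent m \<phi>\<^sub>1 \<phi>\<^sub>2 \<longleftrightarrow>
     (\<exists>\<rho> \<rho>' \<sigma> \<sigma>'. line_diff \<rho> \<rho>' \<and> space_diff m \<sigma> \<sigma>' \<and>
        (\<forall>\<^sub>F t in nhds 0. \<forall>i<m. \<phi>\<^sub>2 t i = \<sigma> (\<phi>\<^sub>1 (\<rho>' t)) i))"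

definition degenerate :: "nat \<Rightarrow> (complex \<Rightarrow> nat \<Rightarrow> complex) \<Rightarrow> bool" where
  "degenerate m \<phi> \<longleftrightarrow>
     (\<exists>\<psi>. parametrization m \<psi> \<and> A_equivalent m \<phi> \<psi> \<and> (\<exists>i<m. \<forall>\<^sub>F t in nhds 0. \<psi> t i = 0))"

text \<open>
  Orders of the nonzero germs \<open>g (\<phi> t)\<close>, with \<open>g\<close> a convergent power series in the first \<open>m\<close>
  coordinates. For \<open>\<phi>\<close> in \<open>(n + 1)\<close>-space, \<open>m = n + 1\<close> gives \<open>\<Gamma>\<close> and \<open>m = i\<close> gives \<open>\<Gamma>\<^sub>i\<close>.
\<close>

definition value_set :: "nat \<Rightarrow> (complex \<Rightarrow> nat \<Rightarrow> complex) \<Rightarrow> nat set" where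
  "value_set m \<phi> = {k. \<exists>g. analytic_germ m g \<and> germ_ord (\<lambda>t. g (\<phi> t)) = enat k}"

text \<open>All \<open>\<nat>\<close>-linear combinations of the elements of a finite set.\<close>

definition semigroup_span :: "nat set \<Rightarrow> nat set" where
  "semigroup_span V = {k. \<exists>c. k = (\<Sum>v\<in>V. c v * v)}"

definition minimal_generators :: "nat set \<Rightarrow> nat set \<Rightarrow> bool" where
  "minimal_generators V \<Gamma> \<longleftrightarrow>
     finite V \<and> semigroup_span V = \<Gamma> \<and> (\<forall>U. U \<subset> V \<longrightarrow> semigroup_span U \<noteq> \<Gamma>)"

definition is_minimum :: "nat \<Rightarrow> nat set \<Rightarrow> bool" where
  "is_minimum k S \<longleftrightarrow> k \<in> S \<and> (\<forall>l\<in>S. k \<le> l)"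

end

theory Submission
  imports Defs
begin

text \<open>
  Let \<open>R\<close> be the ring of the power series \<open>g (\<phi> t)\<close>. Since \<open>\<phi>\<close> is primitive, a trace over roots of
  unity shows that \<open>R\<close> contains every convergent series of sufficiently large order. Any element of \<open>R\<close>
  can therefore be made a polynomial without monomials of exponent in \<open>\<Gamma>\<close> above its order, by
  subtracting elements of \<open>R\<close>. Start with \<open>t ^ v 0\<close> and a second element of order \<open>v 1\<close>, where changes of
  the parameter remove also the exponents \<open>\<gamma> + v 1 - v 0\<close>, and then keep adding an element whose order
  is the least value not yet attained; non-degeneracy guarantees that such a value exists \<open>n\<close> times.
  By minimality of these values the chosen elements are linearly independent modulo the square of the
  maximal ideal of \<open>R\<close>, so any germs \<open>\<sigma>\<close> that express them through \<open>\<phi>\<close> have an invertible linear part, and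
  the inverse function theorem makes \<open>\<sigma>\<close> a diffeomorphism.
\<close>

subsection \<open>Osgood's lemma\<close>

text \<open>All series must converge, and two devices reduce this to finite computations. Every
  elimination may stop at an exponent \<open>c\<close> from which on the ring contains all
  convergent series, so only finitely many parameter changes are composed. Germs in several
  variables are handled by a criterion stable under composition, boundedness together with
  holomorphy along every holomorphic curve, and Osgood's lemma leads back to power series.

  A missing value exists because of a second conductor. Fewer than \<open>n + 1\<close> elements
  attaining all of \<Gamma> would attain two consecutive numbers, hence form a primitive curve with
  a conductor of its own, hence generate the ring. The components of \<phi> would then be germs in
  fewer variables, with dependent linear parts, and \<phi> would be degenerate.

  Independence modulo the square of the maximal ideal is a matter of orders. A product of two
  factors vanishing at 0 is known up to and including exponent \<open>w i\<close> once the factors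
  are known below it, and below \<open>w i\<close> the earlier coordinates approximate the whole
  ring. An element of the square of order \<open>w i\<close> would therefore make \<open>w i\<close>
  a value of the earlier coordinates.\<close>

lemma bounded_holomorphic_diff_le:
  fixes g :: "complex \<Rightarrow> complex"
  assumes hol: "g holomorphic_on ball a r" and bd: "\<And>z. z \<in> ball a r \<Longrightarrow> norm (g z) \<le> M"
    and z: "z \<in> ball a r"
  shows "norm (g z - g a) \<le> 2 * M / r * norm (z - a)"
proof -
  have r: "r > 0" using z by (metis ball_eq_empty empty_iff not_le)
  have M0: "M \<ge> 0" using bd[OF z] norm_ge_zero order_trans by blast
  \<comment> \<open>Schwarz's lemma asks for values strictly inside the unit disc, whereas only
    \<open>norm (g z) \<le> M\<close> is known. A larger \<open>M'\<close> provides the strictness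
    and is afterwards moved down to \<open>M\<close>.\<close>
  have *: "norm (g z - g a) \<le> 2 * M' / r * norm (z - a)" if M': "M' > M" for M'
  proof -
    have M'0: "M' > 0" using M0 M' by simp
    define G where "G = (\<lambda>w. (g (a + of_real r * w) - g a) / of_real (2 * M'))"
    have in_ball: "a + of_real r * w \<in> ball a r" if "norm w < 1" for w
      using that r by (simp add: dist_norm norm_mult)
    have "G holomorphic_on ball 0 1"
      unfolding G_def
      by (intro holomorphic_intros holomorphic_on_compose_gen[OF _ hol, unfolded o_def])
         (use in_ball M'0 in auto)
    moreover have "G 0 = 0" by (simp add: G_def)
    moreover have "norm (G w) < 1" if w: "norm w < 1" for w
    proof -
      have "norm (g (a + of_real r * w) - g a) \<le> M + M"
        by (rule norm_triangle_le_diff) (use bd[OF in_ball[OF w]] bd[of a] r in auto)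
      also have "\<dots> < 2 * M'" using M' by simp
      finally show ?thesis using M'0 by (simp add: G_def norm_divide)
    qed
    moreover have w1: "norm ((z - a) / of_real r) < 1"
      using z r by (simp add: norm_divide dist_norm norm_minus_commute)
    ultimately have "norm (G ((z - a) / of_real r)) \<le> norm ((z - a) / of_real r)"
      by (rule Schwarz_Lemma(1))
    hence "norm (g z - g a) / (2 * M') \<le> norm (z - a) / r"
      using r M'0 by (simp add: G_def norm_divide)
    thus ?thesis using M'0 by (simp add: field_simps)
  qed
  have "norm (g z - g a) \<le> 2 * M / r * norm (z - a) + e" if e: "e > 0" for e
  proof -
    define d where "d = e * r / (2 * (norm (z - a) + 1))"
    have n: "norm (z - a) + 1 > 0" by (simp add: add_nonneg_pos)
    have d: "d > 0" using e r n by (simp add: d_def)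
    have "norm (g z - g a) \<le> 2 * (M + d) / r * norm (z - a)" using *[of "M + d"] d by simp
    also have "\<dots> = 2 * M / r * norm (z - a) + 2 * d / r * norm (z - a)"
      by (simp add: add_divide_distrib distrib_left distrib_right)
    also have "2 * d / r * norm (z - a) = e * (norm (z - a) / (norm (z - a) + 1))"
      using r n unfolding d_def by (simp add: divide_simps)
    also have "\<dots> \<le> e * 1"
      using n e by (intro mult_left_mono) auto
    finally show ?thesis by simp
  qed
  thus ?thesis by (rule field_le_epsilon)
qed

text \<open>The hypotheses of Osgood's lemma for a bounded function, with the bound kept as a
  parameter because the iteration below tracks it. The last clause is there because points are
  functions on all of \<open>nat\<close>.\<close>

definition sep_hol :: "nat \<Rightarrow> real \<Rightarrow> real \<Rightarrow> ((nat \<Rightarrow> complex) \<Rightarrow> complex) \<Rightarrow> bool" where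
  "sep_hol m r M f \<longleftrightarrow>
     (\<forall>x\<in>polydisc m r. norm (f x) \<le> M) \<and>
     (\<forall>x\<in>polydisc m r. \<forall>i<m. (\<lambda>z. f (x(i := z))) holomorphic_on ball 0 r) \<and>
     (\<forall>x\<in>polydisc m r. \<forall>y. (\<forall>i<m. x i = y i) \<longrightarrow> f x = f y)"

lemma sep_holD:
  assumes "sep_hol m r M f" "x \<in> polydisc m r"
  shows "norm (f x) \<le> M" "i < m \<Longrightarrow> (\<lambda>z. f (x(i := z))) holomorphic_on ball 0 r"
    "(\<And>i. i < m \<Longrightarrow> x i = y i) \<Longrightarrow> f x = f y"
  using assms unfolding sep_hol_def by blast+

lemma polydisc_upd: "x \<in> polydisc m r \<Longrightarrow> norm z < r \<Longrightarrow> x(i := z) \<in> polydisc m r"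
  by (auto simp: polydisc_def)

lemma polydisc_mono: "s \<le> r \<Longrightarrow> polydisc m s \<subseteq> polydisc m r"
  by (force simp: polydisc_def)

lemma zero_in_polydisc: "r > 0 \<Longrightarrow> (\<lambda>_. 0) \<in> polydisc m r"
  by (auto simp: polydisc_def)

text \<open>The difference quotient in the variable \<open>i\<close> with its removable singularity
  filled in. Iterating it produces the Taylor coefficients in that variable.\<close>

definition had_quot :: "nat \<Rightarrow> ((nat \<Rightarrow> complex) \<Rightarrow> complex) \<Rightarrow> (nat \<Rightarrow> complex) \<Rightarrow> complex" where
  "had_quot i f x = (if x i = 0 then deriv (\<lambda>z. f (x(i := z))) 0
                     else (f x - f (x(i := 0))) / x i)"

lemma had_quot_eq: "f x = f (x(i := 0)) + x i * had_quot i f x"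
  by (auto simp: had_quot_def fun_upd_idem)

lemma had_quot_upd:
  "had_quot i f (x(i := z)) =
    (if z = 0 then deriv (\<lambda>z. f (x(i := z))) 0
     else (f (x(i := z)) - f (x(i := 0))) / (z - 0))"
  by (auto simp: had_quot_def)

lemma had_quot_holomorphic_same:
  assumes "sep_hol m r M f" "x \<in> polydisc m r" "i < m"
  shows "(\<lambda>z. had_quot i f (x(i := z))) holomorphic_on ball 0 r"
proof (cases "r > 0")
  case True
  show ?thesis
    unfolding had_quot_upd
    by (rule pole_lemma[OF sep_holD(2)[OF assms]]) (use True in auto)
qed (simp add: ball_empty holomorphic_on_def)

lemma deriv_bound_quot:
  fixes g :: "complex \<Rightarrow> complex"
  assumes hol: "g holomorphic_on ball 0 r" and r: "r > 0"
    and bd: "\<And>z. z \<in> ball 0 r \<Longrightarrow> norm (g z) \<le> M"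
  shows "norm (deriv g 0) \<le> 2 * M / r"
proof -
  have "(g has_field_derivative deriv g 0) (at 0)"
    using hol r by (intro holomorphic_derivI[of _ "ball 0 r"]) auto
  hence "((\<lambda>z. (g z - g 0) / (z - 0)) \<longlongrightarrow> deriv g 0) (at 0)"
    by (simp add: has_field_derivative_iff)
  hence lim: "((\<lambda>z. norm ((g z - g 0) / (z - 0))) \<longlongrightarrow> norm (deriv g 0)) (at 0)"
    by (rule tendsto_norm)
  show ?thesis
  proof (rule tendsto_upperbound[OF lim])
    have "eventually (\<lambda>z. z \<in> ball 0 r - {0}) (at (0::complex))"
      using r by (intro eventually_at_in_open) auto
    thus "eventually (\<lambda>z. norm ((g z - g 0) / (z - 0)) \<le> 2 * M / r) (at 0)"
    proof eventually_elim
      case (elim z)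
      hence "norm (g z - g 0) \<le> 2 * M / r * norm (z - 0)"
        by (intro bounded_holomorphic_diff_le[OF hol bd]) auto
      thus ?case using elim by (simp add: norm_divide field_simps)
    qed
  qed simp
qed

text \<open>The Schwarz estimate bounds the quotient on the polydisc of the same radius. Hence the
  division can be iterated without shrinking \<open>r\<close>, each step costing a factor
  \<open>2 / r\<close>.\<close>

lemma had_quot_bound:
  assumes f: "sep_hol m r M f" and x: "x \<in> polydisc m r" and i: "i < m"
  shows "norm (had_quot i f x) \<le> 2 * M / r"
proof -
  let ?g = "\<lambda>z. f (x(i := z))"
  have hol: "?g holomorphic_on ball 0 r" by (rule sep_holD(2)[OF f x i])
  have r: "r > 0" and xi: "norm (x i) < r"
    using x i by (auto simp: polydisc_def intro: le_less_trans[OF norm_ge_zero])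
  have bd: "norm (?g z) \<le> M" if "z \<in> ball 0 r" for z
    using that by (intro sep_holD(1)[OF f] polydisc_upd x) auto
  show ?thesis
  proof (cases "x i = 0")
    case True
    thus ?thesis using deriv_bound_quot[OF hol r bd] by (simp add: had_quot_def)
  next
    case False
    have "norm (?g (x i) - ?g 0) \<le> 2 * M / r * norm (x i - 0)"
      by (rule bounded_holomorphic_diff_le[OF hol bd]) (use xi in auto)
    thus ?thesis using False by (simp add: had_quot_def norm_divide field_simps)
  qed
qed

lemma had_quot_cont:
  assumes f: "sep_hol m r M f" and x: "x \<in> polydisc m r" and i: "i < m" and z: "norm z < r"
  shows "norm (had_quot i f (x(i := z)) - had_quot i f (x(i := 0))) \<le> 2 * (2 * M / r) / r * norm (z - 0)"
  by (rule bounded_holomorphic_diff_le[OF had_quot_holomorphic_same[OF f x i]])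
     (use z in \<open>auto intro!: had_quot_bound[OF f _ i] polydisc_upd x\<close>)

text \<open>Where \<open>x i\<close> is nonzero this is a quotient by a constant. At
  \<open>x i = 0\<close> the value is a derivative in another variable, and its holomorphy in
  \<open>x j\<close> is obtained from a uniform limit of the quotients at \<open>e k\<close>, which
  tends to 0. Uniformity holds because the constant in \<open>had_quot_cont\<close> does not depend
  on \<open>x j\<close>.\<close>

lemma had_quot_holomorphic_other:
  assumes f: "sep_hol m r M f" and x: "x \<in> polydisc m r" and i: "i < m" and j: "j < m" "j \<noteq> i"
  shows "(\<lambda>z. had_quot i f (x(j := z))) holomorphic_on ball 0 r"
proof -
  have r: "r > 0" using x i by (auto simp: polydisc_def intro: le_less_trans[OF norm_ge_zero])
  have quot: "(\<lambda>z. had_quot i f (y(j := z))) holomorphic_on ball 0 r"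
    if y: "y \<in> polydisc m r" "y i \<noteq> 0" for y
  proof -
    have "(\<lambda>z. (f (y(j := z)) - f ((y(i := 0))(j := z))) / y i) holomorphic_on ball 0 r"
      using y r by (intro holomorphic_intros sep_holD(2)[OF f] polydisc_upd j) auto
    thus ?thesis
      using y j by (simp add: had_quot_def fun_upd_twist)
  qed
  show ?thesis
  proof (cases "x i = 0")
    case False
    thus ?thesis by (rule quot[OF x])
  next
    case True
    define e where "e = (\<lambda>k::nat. of_real (r / (real k + 2)) :: complex)"
    have e: "norm (e k) < r" "e k \<noteq> 0" for k
    proof -
      have "r * 1 < r * (real k + 2)" using r by (intro mult_strict_left_mono) auto
      hence "r / (real k + 2) < r" by (simp add: divide_less_eq)
      moreover have "r / (real k + 2) > 0" using r by simp
      ultimately show "norm (e k) < r" "e k \<noteq> 0"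
        unfolding e_def norm_of_real of_real_eq_0_iff by linarith+
    qed
    have elim: "e \<longlonglongrightarrow> 0"
    proof -
      have "(\<lambda>k. r / (real k + 2)) \<longlonglongrightarrow> 0" by real_asymp
      hence "(\<lambda>k. of_real (r / (real k + 2)) :: complex) \<longlonglongrightarrow> of_real 0" by (rule tendsto_of_real)
      thus ?thesis by (simp add: e_def)
    qed
    show ?thesis
    proof (rule holomorphic_uniform_sequence[OF open_ball])
      show "(\<lambda>z. had_quot i f ((x(i := e k))(j := z))) holomorphic_on ball 0 r" for k
        by (rule quot) (use e x in \<open>auto intro: polydisc_upd\<close>)
    next
      fix z :: complex assume z: "z \<in> ball 0 r"
      then obtain d where d: "d > 0" "cball z d \<subseteq> ball 0 r"
        using open_contains_cball[of "ball (0::complex) r"] by blast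
      have "uniform_limit (cball z d) (\<lambda>k w. had_quot i f ((x(i := e k))(j := w)))
              (\<lambda>w. had_quot i f (x(j := w))) sequentially"
      proof (rule uniform_limitI)
        fix \<epsilon> :: real assume "\<epsilon> > 0"
        have "(\<lambda>k. 2 * (2 * M / r) / r * norm (e k - 0)) \<longlonglongrightarrow> 2 * (2 * M / r) / r * norm (0 - 0 :: complex)"
          by (intro tendsto_intros elim)
        hence "eventually (\<lambda>k. 2 * (2 * M / r) / r * norm (e k - 0) < \<epsilon>) sequentially"
          using \<open>\<epsilon> > 0\<close> by (intro order_tendstoD) auto
        thus "\<forall>\<^sub>F k in sequentially. \<forall>w\<in>cball z d.
            dist (had_quot i f ((x(i := e k))(j := w))) (had_quot i f (x(j := w))) < \<epsilon>"
        proof eventually_elim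
          case (elim k)
          show ?case
          proof
            fix w assume "w \<in> cball z d"
            hence w: "norm w < r" using d by auto
            have "norm (had_quot i f ((x(j := w))(i := e k)) - had_quot i f ((x(j := w))(i := 0)))
                \<le> 2 * (2 * M / r) / r * norm (e k - 0)"
              by (rule had_quot_cont[OF f _ i]) (use e w x in \<open>auto intro: polydisc_upd\<close>)
            also have "(x(j := w))(i := 0) = x(j := w)" using True j by auto
            also have "(x(j := w))(i := e k) = x(i := e k, j := w)" using j by (simp add: fun_upd_twist)
            finally show "dist (had_quot i f ((x(i := e k))(j := w))) (had_quot i f (x(j := w))) < \<epsilon>"
              using elim unfolding dist_norm by (rule le_less_trans)
          qed
        qed
      qed
      thus "\<exists>d>0. cball z d \<subseteq> ball 0 r \<and>
          uniform_limit (cball z d) (\<lambda>k w. had_quot i f ((x(i := e k))(j := w)))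
            (\<lambda>w. had_quot i f (x(j := w))) sequentially"
        using d by blast
    qed
  qed
qed

lemma sep_hol_had_quot:
  assumes f: "sep_hol m r M f" and i: "i < m"
  shows "sep_hol m r (2 * M / r) (had_quot i f)"
  unfolding sep_hol_def
proof (intro conjI ballI allI impI)
  fix x assume x: "x \<in> polydisc m r"
  show "norm (had_quot i f x) \<le> 2 * M / r" by (rule had_quot_bound[OF f x i])
  show "(\<lambda>z. had_quot i f (x(j := z))) holomorphic_on ball 0 r" if "j < m" for j
    using had_quot_holomorphic_same[OF f x i] had_quot_holomorphic_other[OF f x i that]
    by (cases "j = i") auto
  fix y assume xy: "\<forall>i<m. x i = y i"
  have r: "r > 0" using x i by (auto simp: polydisc_def intro: le_less_trans[OF norm_ge_zero])
  have upd: "f (x(i := z)) = f (y(i := z))" if "norm z < r" for z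
    by (rule sep_holD(3)[OF f]) (use that xy x in \<open>auto intro: polydisc_upd\<close>)
  have "eventually (\<lambda>z. f (x(i := z)) = f (y(i := z))) (nhds 0)"
    using upd r by (intro eventually_nhds_in_open[of "ball 0 r", THEN eventually_mono]) auto
  hence "deriv (\<lambda>z. f (x(i := z))) 0 = deriv (\<lambda>z. f (y(i := z))) 0"
    by (rule deriv_cong_ev) simp
  moreover have "f x = f y" by (rule sep_holD(3)[OF f x]) (use xy in auto)
  moreover have "f (x(i := 0)) = f (y(i := 0))" using upd r by simp
  ultimately show "had_quot i f x = had_quot i f y"
    using xy i by (simp add: had_quot_def)
qed

fun iter_quot :: "nat \<Rightarrow> nat \<Rightarrow> ((nat \<Rightarrow> complex) \<Rightarrow> complex) \<Rightarrow> (nat \<Rightarrow> complex) \<Rightarrow> complex" where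
  "iter_quot i 0 f = f"
| "iter_quot i (Suc k) f = had_quot i (iter_quot i k f)"

lemma sep_hol_iter_quot:
  assumes f: "sep_hol m r M f" and i: "i < m"
  shows "sep_hol m r (M * (2 / r) ^ k) (iter_quot i k f)"
proof (induction k)
  case (Suc k)
  show ?case using sep_hol_had_quot[OF Suc.IH i] by (simp add: algebra_simps)
qed (use f in simp)

lemma iter_quot_expansion:
  "f x = (\<Sum>k<K. iter_quot i k f (x(i := 0)) * x i ^ k) + x i ^ K * iter_quot i K f x"
proof (induction K)
  case (Suc K)
  let ?a = "iter_quot i K f (x(i := 0))" and ?b = "had_quot i (iter_quot i K f) x"
  have "iter_quot i K f x = ?a + x i * ?b" by (rule had_quot_eq)
  hence "x i ^ K * iter_quot i K f x = ?a * x i ^ K + x i ^ Suc K * ?b"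
    by (simp only: distrib_left power_Suc2 mult_ac)
  with Suc show ?case
    by (simp only: sum.lessThan_Suc iter_quot.simps add.assoc)
qed simp

text \<open>The remainder after \<open>K\<close> steps is at most
  \<open>M * (2 / r) ^ K * norm (x i) ^ K\<close>, which decreases geometrically when
  \<open>norm (x i) < r / 2\<close>. This is the origin of the halved radius.\<close>

lemma iter_quot_sums:
  assumes f: "sep_hol m r M f" and i: "i < m" and x: "x \<in> polydisc m (r / 2)"
  shows "(\<lambda>k. iter_quot i k f (x(i := 0)) * x i ^ k) sums f x"
proof -
  have xi: "norm (x i) < r / 2" using x i by (auto simp: polydisc_def)
  hence r: "r > 0" by (smt (verit) norm_ge_zero field_sum_of_halves)
  have xr: "x \<in> polydisc m r" using x polydisc_mono[of "r/2" r m] r by auto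
  define q where "q = 2 * norm (x i) / r"
  have q: "0 \<le> q" "q < 1" using xi r by (auto simp: q_def field_simps)
  have "(\<lambda>K. f x - x i ^ K * iter_quot i K f x) \<longlonglongrightarrow> f x - 0"
  proof (intro tendsto_diff tendsto_const, rule Lim_null_comparison)
    show "\<forall>\<^sub>F K in sequentially. norm (x i ^ K * iter_quot i K f x) \<le> M * q ^ K"
    proof (intro always_eventually allI)
      fix K
      have "norm (x i ^ K * iter_quot i K f x) \<le> norm (x i) ^ K * (M * (2 / r) ^ K)"
        unfolding norm_mult norm_power
        by (intro mult_left_mono sep_holD(1)[OF sep_hol_iter_quot[OF f i] xr]) auto
      also have "\<dots> = M * q ^ K" by (simp add: q_def power_mult_distrib power_divide)
      finally show "norm (x i ^ K * iter_quot i K f x) \<le> M * q ^ K" .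
    qed
    have "(\<lambda>K. M * q ^ K) \<longlonglongrightarrow> M * 0"
      by (intro tendsto_intros LIMSEQ_power_zero) (use q in auto)
    thus "(\<lambda>K. M * q ^ K) \<longlonglongrightarrow> 0" by simp
  qed
  moreover have "(\<Sum>k<K. iter_quot i k f (x(i := 0)) * x i ^ k) = f x - x i ^ K * iter_quot i K f x" for K
    using iter_quot_expansion[of f x i K] by simp
  ultimately show ?thesis by (simp add: sums_def)
qed

section \<open>Power series in several variables\<close>

definition multi_idx :: "nat \<Rightarrow> (nat \<Rightarrow> nat) set" where
  "multi_idx m = {\<alpha>. \<forall>i\<ge>m. \<alpha> i = 0}"

lemma multi_idx_0: "multi_idx 0 = {\<lambda>_. 0}"
  by (auto simp: multi_idx_def)

lemma bij_betw_multi_idx_Suc: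
  "bij_betw (\<lambda>(k, \<alpha>). \<alpha>(m := k)) (UNIV \<times> multi_idx m) (multi_idx (Suc m))"
  by (rule bij_betw_byWitness[where f' = "\<lambda>\<alpha>. (\<alpha> m, \<alpha>(m := 0))"])
     (auto simp: multi_idx_def fun_eq_iff)

lemma summable_on_multi_geometric:
  fixes q :: "nat \<Rightarrow> real"
  assumes "\<And>i. i < m \<Longrightarrow> 0 \<le> q i \<and> q i < 1"
  shows "(\<lambda>\<alpha>. \<Prod>i<m. q i ^ \<alpha> i) summable_on multi_idx m"
  using assms
proof (induction m)
  case 0
  thus ?case by (simp add: multi_idx_0)
next
  case (Suc m)
  have q: "0 \<le> q m" "q m < 1" using Suc.prems by auto
  have IH: "(\<lambda>\<alpha>. \<Prod>i<m. q i ^ \<alpha> i) summable_on multi_idx m"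
    using Suc.prems by (intro Suc.IH) auto
  have pos: "(\<Prod>i<m. q i ^ \<alpha> i) \<ge> 0" for \<alpha> :: "nat \<Rightarrow> nat"
    by (intro prod_nonneg) (use Suc.prems in auto)
  have geo: "(\<lambda>k. q m ^ k) summable_on UNIV"
    by (rule summable_nonneg_imp_summable_on) (use q in \<open>auto intro: summable_geometric\<close>)
  have "(\<lambda>p. norm (case p of (k, \<alpha>) \<Rightarrow> q m ^ k * (\<Prod>i<m. q i ^ \<alpha> i))) summable_on UNIV \<times> multi_idx m"
    unfolding Infinite_Sum.abs_summable_on_Sigma_iff
  proof (intro conjI ballI)
    show "(\<lambda>\<alpha>. norm (case (k, \<alpha>) of (k, \<alpha>) \<Rightarrow> q m ^ k * (\<Prod>i<m. q i ^ \<alpha> i))) summable_on multi_idx m" for k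
      using q pos IH by (simp add: abs_mult summable_on_cmult_right)
    have "(\<lambda>k. \<Sum>\<^sub>\<infinity>\<alpha>\<in>multi_idx m. norm (q m ^ k * (\<Prod>i<m. q i ^ \<alpha> i)))
        = (\<lambda>k. q m ^ k * (\<Sum>\<^sub>\<infinity>\<alpha>\<in>multi_idx m. \<Prod>i<m. q i ^ \<alpha> i))"
      using q pos IH by (simp add: abs_mult infsum_cmult_right)
    moreover have "(\<Sum>\<^sub>\<infinity>\<alpha>\<in>multi_idx m. \<Prod>i<m. q i ^ \<alpha> i) \<ge> 0"
      by (intro infsum_nonneg pos)
    moreover have "(\<lambda>k. q m ^ k * (\<Sum>\<^sub>\<infinity>\<alpha>\<in>multi_idx m. \<Prod>i<m. q i ^ \<alpha> i)) summable_on UNIV"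
      by (rule summable_on_cmult_left[OF geo])
    ultimately show "(\<lambda>k. norm (\<Sum>\<^sub>\<infinity>\<alpha>\<in>multi_idx m. norm (case (k, \<alpha>) of (k, \<alpha>) \<Rightarrow> q m ^ k * (\<Prod>i<m. q i ^ \<alpha> i))))
        summable_on UNIV"
      using q by (simp only: prod.case fun_eq_iff real_norm_def abs_mult) (simp add: abs_mult)
  qed
  hence "(\<lambda>(k, \<alpha>). q m ^ k * (\<Prod>i<m. q i ^ \<alpha> i)) summable_on UNIV \<times> multi_idx m"
    by (rule abs_summable_summable)
  also have "(\<lambda>(k, \<alpha>). q m ^ k * (\<Prod>i<m. q i ^ \<alpha> i)) =
      (\<lambda>p. \<Prod>i<Suc m. q i ^ ((case p of (k, \<alpha>) \<Rightarrow> \<alpha>(m := k)) i))"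
    by (auto simp: fun_eq_iff)
  finally show ?case
    using summable_on_reindex_bij_betw[OF bij_betw_multi_idx_Suc[of m],
        of "\<lambda>\<alpha>. \<Prod>i<Suc m. q i ^ \<alpha> i"] by simp
qed

text \<open>Induction on the number of variables: the coefficients of the expansion in the last
  variable satisfy the same hypotheses in the others, with bound \<open>M * (2 / r) ^ k\<close>. The
  estimate of the coefficients belongs to the conclusion because it makes the multiple series
  absolutely summable.\<close>

lemma sep_hol_power_series:
  assumes "sep_hol m r M f" "r > 0"
  shows "\<exists>c. (\<forall>\<alpha>. norm (c \<alpha>) \<le> M * (2 / r) ^ (\<Sum>i<m. \<alpha> i)) \<and>
     (\<forall>x\<in>polydisc m (r / 2). ((\<lambda>\<alpha>. c \<alpha> * (\<Prod>i<m. x i ^ \<alpha> i)) has_sum f x) (multi_idx m))"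
  using assms
proof (induction m arbitrary: M f)
  case 0
  show ?case
  proof (intro exI[of _ "\<lambda>_. f (\<lambda>_. 0)"] conjI allI ballI)
    show "norm (f (\<lambda>_. 0)) \<le> M * (2 / r) ^ sum \<alpha> {..<0}" for \<alpha> :: "nat \<Rightarrow> nat"
      using sep_holD(1)[OF 0(1), of "\<lambda>_. 0"] by (simp add: polydisc_def)
    fix x
    have "f x = f (\<lambda>_. 0)" using sep_holD(3)[OF 0(1), of x "\<lambda>_. 0"] by (simp add: polydisc_def)
    thus "((\<lambda>\<alpha>. f (\<lambda>_. 0) * (\<Prod>i<0. x i ^ \<alpha> i)) has_sum f x) (multi_idx 0)"
      by (simp add: multi_idx_0 has_sum_finiteI)
  qed
next
  case (Suc m)
  note r = \<open>r > 0\<close>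
  define C where "C = (\<lambda>k x. iter_quot m k f (x(m := 0)))"
  have C: "sep_hol m r (M * (2 / r) ^ k) (C k)" for k
    unfolding sep_hol_def
  proof (intro conjI ballI allI impI)
    fix x assume x: "x \<in> polydisc m r"
    have x': "x(m := 0) \<in> polydisc (Suc m) r" using x r by (auto simp: polydisc_def)
    note I = sep_hol_iter_quot[OF Suc.prems(1) lessI, of k]
    show "norm (C k x) \<le> M * (2 / r) ^ k" unfolding C_def by (rule sep_holD(1)[OF I x'])
    show "(\<lambda>z. C k (x(i := z))) holomorphic_on ball 0 r" if "i < m" for i
      using sep_holD(2)[OF I x', of i] that by (simp add: C_def fun_upd_twist)
    show "C k x = C k y" if "\<forall>i<m. x i = y i" for y
      unfolding C_def by (rule sep_holD(3)[OF I x']) (use that in auto)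
  qed
  have "\<forall>k. \<exists>c. (\<forall>\<alpha>. norm (c \<alpha>) \<le> M * (2 / r) ^ k * (2 / r) ^ (\<Sum>i<m. \<alpha> i)) \<and>
     (\<forall>x\<in>polydisc m (r / 2). ((\<lambda>\<alpha>. c \<alpha> * (\<Prod>i<m. x i ^ \<alpha> i)) has_sum C k x) (multi_idx m))"
    by (intro allI Suc.IH[OF C r])
  from choice[OF this] obtain c where c: "\<And>k \<alpha>. norm (c k \<alpha>) \<le> M * (2 / r) ^ k * (2 / r) ^ (\<Sum>i<m. \<alpha> i)"
    "\<And>k x. x \<in> polydisc m (r / 2) \<Longrightarrow> ((\<lambda>\<alpha>. c k \<alpha> * (\<Prod>i<m. x i ^ \<alpha> i)) has_sum C k x) (multi_idx m)"
    by blast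
  define c' where "c' = (\<lambda>\<alpha>. c (\<alpha> m) (\<alpha>(m := 0)))"
  have c': "norm (c' \<alpha>) \<le> M * (2 / r) ^ (\<Sum>i<Suc m. \<alpha> i)" for \<alpha>
    using c(1)[of "\<alpha> m" "\<alpha>(m := 0)"] by (simp add: c'_def power_add mult_ac)
  show ?case
  proof (intro exI[of _ c'] conjI allI ballI c')
    fix x assume x: "x \<in> polydisc (Suc m) (r / 2)"
    define q where "q = (\<lambda>i. 2 * norm (x i) / r)"
    have q: "0 \<le> q i" "q i < 1" if "i < Suc m" for i
      using x that r by (auto simp: q_def polydisc_def field_simps)
    let ?T = "\<lambda>\<alpha>. c' \<alpha> * (\<Prod>i<Suc m. x i ^ \<alpha> i)"
    have "(\<lambda>\<alpha>. M * (\<Prod>i<Suc m. q i ^ \<alpha> i)) summable_on multi_idx (Suc m)"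
      by (intro summable_on_cmult_right summable_on_multi_geometric) (use q in auto)
    moreover have "norm (?T \<alpha>) \<le> M * (\<Prod>i<Suc m. q i ^ \<alpha> i)" for \<alpha>
    proof -
      have "norm (?T \<alpha>) = norm (c' \<alpha>) * (\<Prod>i<Suc m. norm (x i) ^ \<alpha> i)"
        by (simp only: norm_mult prod_norm[symmetric] norm_power)
      also have "\<dots> \<le> M * (2 / r) ^ (\<Sum>i<Suc m. \<alpha> i) * (\<Prod>i<Suc m. norm (x i) ^ \<alpha> i)"
        by (intro mult_right_mono c' prod_nonneg) auto
      also have "\<dots> = M * (\<Prod>i<Suc m. (2 / r) ^ \<alpha> i * norm (x i) ^ \<alpha> i)"
        by (simp only: power_sum prod.distrib mult.assoc)
      also have "\<dots> = M * (\<Prod>i<Suc m. q i ^ \<alpha> i)"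
        by (simp only: q_def times_divide_eq_left[symmetric] power_mult_distrib)
      finally show ?thesis .
    qed
    ultimately have "(\<lambda>\<alpha>. norm (?T \<alpha>)) summable_on multi_idx (Suc m)"
      by (rule Infinite_Sum.abs_summable_on_comparison_test')
    hence "?T summable_on multi_idx (Suc m)" by (rule abs_summable_summable)
    hence T: "(?T has_sum infsum ?T (multi_idx (Suc m))) (multi_idx (Suc m))"
      by (rule has_sum_infsum)
    hence T': "((\<lambda>p. ?T (case p of (k, \<alpha>) \<Rightarrow> \<alpha>(m := k))) has_sum infsum ?T (multi_idx (Suc m)))
        (UNIV \<times> multi_idx m)"
      using has_sum_reindex_bij_betw[OF bij_betw_multi_idx_Suc[of m], of ?T] by simp
    \<comment> \<open>The unordered sum is already known to exist, so summing by the exponent of the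
      last variable only has to identify its value.\<close>
    have "((\<lambda>k. C k x * x m ^ k) has_sum infsum ?T (multi_idx (Suc m))) UNIV"
    proof (rule has_sum_SigmaD[OF T'])
      fix k
      have "((\<lambda>\<alpha>. c k \<alpha> * (\<Prod>i<m. x i ^ \<alpha> i) * x m ^ k) has_sum C k x * x m ^ k) (multi_idx m)"
        by (intro has_sum_cmult_left c(2)) (use x in \<open>auto simp: polydisc_def\<close>)
      also have "?this \<longleftrightarrow> ((\<lambda>\<alpha>. ?T (case (k, \<alpha>) of (k, \<alpha>) \<Rightarrow> \<alpha>(m := k))) has_sum C k x * x m ^ k) (multi_idx m)"
        by (intro has_sum_cong) (auto simp: c'_def multi_idx_def fun_upd_idem)
      finally show "((\<lambda>\<alpha>. ?T (case (k, \<alpha>) of (k, \<alpha>) \<Rightarrow> \<alpha>(m := k))) has_sum C k x * x m ^ k) (multi_idx m)" .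
    qed
    hence "(\<lambda>k. C k x * x m ^ k) sums infsum ?T (multi_idx (Suc m))"
      by (rule has_sum_imp_sums)
    moreover have "(\<lambda>k. C k x * x m ^ k) sums f x"
      unfolding C_def by (rule iter_quot_sums[OF Suc.prems(1) lessI x])
    ultimately have "infsum ?T (multi_idx (Suc m)) = f x" by (rule sums_unique2)
    thus "(?T has_sum f x) (multi_idx (Suc m))" using T by simp
  qed
qed

lemma sep_hol_imp_analytic_germ:
  assumes "sep_hol m r M f" "r > 0"
  shows "analytic_germ m f"
proof -
  obtain c where "\<forall>x\<in>polydisc m (r / 2). ((\<lambda>\<alpha>. c \<alpha> * (\<Prod>i<m. x i ^ \<alpha> i)) has_sum f x) (multi_idx m)"
    using sep_hol_power_series[OF assms] by blast
  thus ?thesis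
    using assms(2) unfolding analytic_germ_def multi_idx_def
    by (intro exI[of _ c] exI[of _ "r / 2"]) simp
qed

subsection \<open>Analytic germs\<close>

text \<open>Holomorphy is tested along arbitrary holomorphic curves \<open>u\<close> rather than
  along coordinate lines. This makes composition immediate and asks for no calculus in several
  variables. Up to a change of radius, the notion agrees with \<open>analytic_germ\<close>.\<close>

definition hol_on_polydisc :: "nat \<Rightarrow> real \<Rightarrow> real \<Rightarrow> ((nat \<Rightarrow> complex) \<Rightarrow> complex) \<Rightarrow> bool" where
  "hol_on_polydisc m s M F \<longleftrightarrow>
     (\<forall>x\<in>polydisc m s. norm (F x) \<le> M) \<and>
     (\<forall>x\<in>polydisc m s. \<forall>y. (\<forall>i<m. x i = y i) \<longrightarrow> F x = F y) \<and>
     (\<forall>u S. open S \<longrightarrow> (\<forall>i<m. (\<lambda>z. u z i) holomorphic_on S) \<longrightarrow>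
        (\<forall>z\<in>S. u z \<in> polydisc m s) \<longrightarrow> (\<lambda>z. F (u z)) holomorphic_on S)"

lemma hol_on_polydiscI:
  assumes "\<And>x. x \<in> polydisc m s \<Longrightarrow> norm (F x) \<le> M"
    and "\<And>x y. x \<in> polydisc m s \<Longrightarrow> (\<And>i. i < m \<Longrightarrow> x i = y i) \<Longrightarrow> F x = F y"
    and "\<And>u S. open S \<Longrightarrow> (\<And>i. i < m \<Longrightarrow> (\<lambda>z. u z i) holomorphic_on S) \<Longrightarrow>
        (\<And>z. z \<in> S \<Longrightarrow> u z \<in> polydisc m s) \<Longrightarrow> (\<lambda>z. F (u z)) holomorphic_on S"
  shows "hol_on_polydisc m s M F"
  using assms unfolding hol_on_polydisc_def by blast

lemma hol_on_polydiscD: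
  assumes "hol_on_polydisc m s M F"
  shows "x \<in> polydisc m s \<Longrightarrow> norm (F x) \<le> M"
    and "x \<in> polydisc m s \<Longrightarrow> (\<And>i. i < m \<Longrightarrow> x i = y i) \<Longrightarrow> F x = F y"
    and "open S \<Longrightarrow> (\<And>i. i < m \<Longrightarrow> (\<lambda>z. u z i) holomorphic_on S) \<Longrightarrow>
        (\<And>z. z \<in> S \<Longrightarrow> u z \<in> polydisc m s) \<Longrightarrow> (\<lambda>z. F (u z)) holomorphic_on S"
  using assms unfolding hol_on_polydisc_def by blast+

lemma hol_on_polydisc_mono:
  assumes F: "hol_on_polydisc m s M F" and "r \<le> s" "M \<le> N"
  shows "hol_on_polydisc m r N F"
proof (rule hol_on_polydiscI)
  have *: "x \<in> polydisc m s" if "x \<in> polydisc m r" for x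
    using that polydisc_mono[OF assms(2)] by blast
  show "norm (F x) \<le> N" if "x \<in> polydisc m r" for x
    using hol_on_polydiscD(1)[OF F *[OF that]] assms(3) by linarith
  show "F x = F y" if "x \<in> polydisc m r" "\<And>i. i < m \<Longrightarrow> x i = y i" for x y
    by (rule hol_on_polydiscD(2)[OF F *[OF that(1)] that(2)])
  show "(\<lambda>z. F (u z)) holomorphic_on S" if "open S" "\<And>i. i < m \<Longrightarrow> (\<lambda>z. u z i) holomorphic_on S"
        "\<And>z. z \<in> S \<Longrightarrow> u z \<in> polydisc m r" for u S
    by (rule hol_on_polydiscD(3)[OF F that(1,2) *[OF that(3)]])
qed

lemma hol_on_polydisc_imp_sep_hol:
  assumes F: "hol_on_polydisc m s M F"
  shows "sep_hol m s M F"
  unfolding sep_hol_def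
proof (intro conjI ballI allI impI)
  fix x assume x: "x \<in> polydisc m s"
  show "norm (F x) \<le> M" by (rule hol_on_polydiscD(1)[OF F x])
  show "F x = F y" if "\<forall>i<m. x i = y i" for y
    by (rule hol_on_polydiscD(2)[OF F x]) (use that in auto)
  show "(\<lambda>z. F (x(i := z))) holomorphic_on ball 0 s" if "i < m" for i
  proof (rule hol_on_polydiscD(3)[OF F open_ball])
    show "(\<lambda>z. (x(i := z)) j) holomorphic_on ball 0 s" for j
      by (cases "j = i") (auto intro: holomorphic_intros)
  qed (use x in \<open>auto intro: polydisc_upd\<close>)
qed

lemma hol_on_polydisc_imp_analytic_germ:
  "hol_on_polydisc m s M F \<Longrightarrow> s > 0 \<Longrightarrow> analytic_germ m F"
  by (rule sep_hol_imp_analytic_germ[OF hol_on_polydisc_imp_sep_hol])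

text \<open>Abel's argument: summability at the single point with all coordinates \<open>s\<close>
  gives a majorant on the whole polydisc of radius \<open>s\<close>. Along a curve the sum is thus a
  uniform limit of polynomials in holomorphic functions. Half the radius is taken so that this point
  lies inside the given open polydisc.\<close>

lemma analytic_germ_imp_hol_on_polydisc:
  assumes "analytic_germ m F"
  obtains s M where "s > 0" "hol_on_polydisc m s M F"
proof -
  let ?A = "{\<alpha> :: nat \<Rightarrow> nat. \<forall>i\<ge>m. \<alpha> i = 0}"
  obtain c r where r: "r > 0"
    and F: "\<And>x. x \<in> polydisc m r \<Longrightarrow> ((\<lambda>\<alpha>. c \<alpha> * (\<Prod>i<m. x i ^ \<alpha> i)) has_sum F x) ?A"
    using assms unfolding analytic_germ_def by blast
  define s where "s = r / 2"
  have s: "s > 0" "s < r" using r by (auto simp: s_def)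
  define B where "B = (\<lambda>\<alpha>. norm (c \<alpha> * (\<Prod>i<m. of_real s ^ \<alpha> i)))"
  have "(\<lambda>_. of_real s) \<in> polydisc m r" using s by (auto simp: polydisc_def)
  from F[OF this] have "(\<lambda>\<alpha>. c \<alpha> * (\<Prod>i<m. of_real s ^ \<alpha> i)) summable_on ?A"
    by (rule has_sum_imp_summable)
  hence B: "B summable_on ?A"
    unfolding B_def by (simp add: summable_on_iff_abs_summable_on_complex)
  have le: "norm (c \<alpha> * (\<Prod>i<m. x i ^ \<alpha> i)) \<le> B \<alpha>" if "x \<in> polydisc m s" for x \<alpha>
    unfolding B_def norm_mult prod_norm[symmetric] norm_power
    by (intro mult_left_mono prod_mono conjI power_mono)
       (use that s in \<open>auto simp: polydisc_def intro: less_imp_le\<close>)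
  have Fs: "((\<lambda>\<alpha>. c \<alpha> * (\<Prod>i<m. x i ^ \<alpha> i)) has_sum F x) ?A" if "x \<in> polydisc m s" for x
    using that s polydisc_mono[of s r m] by (intro F) auto
  have "hol_on_polydisc m s (\<Sum>\<^sub>\<infinity>\<alpha>\<in>?A. B \<alpha>) F"
  proof (rule hol_on_polydiscI)
    fix x assume x: "x \<in> polydisc m s"
    have abs: "(\<lambda>\<alpha>. norm (c \<alpha> * (\<Prod>i<m. x i ^ \<alpha> i))) summable_on ?A"
      by (rule Infinite_Sum.abs_summable_on_comparison_test'[OF B le[OF x]])
    have "norm (F x) = norm (\<Sum>\<^sub>\<infinity>\<alpha>\<in>?A. c \<alpha> * (\<Prod>i<m. x i ^ \<alpha> i))"
      using infsumI[OF Fs[OF x]] by simp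
    also have "\<dots> \<le> (\<Sum>\<^sub>\<infinity>\<alpha>\<in>?A. norm (c \<alpha> * (\<Prod>i<m. x i ^ \<alpha> i)))"
      by (rule norm_infsum_bound[OF abs])
    also have "\<dots> \<le> (\<Sum>\<^sub>\<infinity>\<alpha>\<in>?A. B \<alpha>)"
      by (rule infsum_mono[OF abs B le[OF x]])
    finally show "norm (F x) \<le> (\<Sum>\<^sub>\<infinity>\<alpha>\<in>?A. B \<alpha>)" .
    fix y assume xy: "\<And>i. i < m \<Longrightarrow> x i = y i"
    hence y: "y \<in> polydisc m s" using x by (auto simp: polydisc_def)
    have eq: "(\<lambda>\<alpha>. c \<alpha> * (\<Prod>i<m. x i ^ \<alpha> i)) = (\<lambda>\<alpha>. c \<alpha> * (\<Prod>i<m. y i ^ \<alpha> i))"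
      using xy by (intro ext arg_cong2[of _ _ _ _ "(*)"] prod.cong refl) auto
    show "F x = F y" by (rule has_sum_unique[OF Fs[OF x, unfolded eq] Fs[OF y]])
  next
    fix u :: "complex \<Rightarrow> nat \<Rightarrow> complex" and S
    assume S: "open S" and hol: "\<And>i. i < m \<Longrightarrow> (\<lambda>z. u z i) holomorphic_on S"
      and u: "\<And>z. z \<in> S \<Longrightarrow> u z \<in> polydisc m s"
    have ulim: "uniform_limit S (\<lambda>X z. \<Sum>\<alpha>\<in>X. c \<alpha> * (\<Prod>i<m. u z i ^ \<alpha> i)) (\<lambda>z. F (u z))
            (finite_subsets_at_top ?A)"
      by (rule Weierstrass_m_test_general'[OF le[OF u] Fs[OF u] B])
    have "\<exists>d>0. (\<lambda>z. F (u z)) holomorphic_on ball z d" if z: "z \<in> S" for z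
    proof -
      obtain d where d: "d > 0" "cball z d \<subseteq> S" using S z open_contains_cball by blast
      have polyhol: "(\<lambda>z. \<Sum>\<alpha>\<in>X. c \<alpha> * (\<Prod>i<m. u z i ^ \<alpha> i)) holomorphic_on S" for X
        by (intro holomorphic_intros hol) auto
      obtain "(\<lambda>z. F (u z)) holomorphic_on ball z d"
      proof (rule holomorphic_uniform_limit)
        show "\<forall>\<^sub>F X in finite_subsets_at_top ?A.
            continuous_on (cball z d) (\<lambda>z. \<Sum>\<alpha>\<in>X. c \<alpha> * (\<Prod>i<m. u z i ^ \<alpha> i)) \<and>
            (\<lambda>z. \<Sum>\<alpha>\<in>X. c \<alpha> * (\<Prod>i<m. u z i ^ \<alpha> i)) holomorphic_on ball z d"
          using d(2) ball_subset_cball[of z d]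
          by (intro always_eventually allI conjI holomorphic_on_imp_continuous_on
                holomorphic_on_subset[OF polyhol]) auto
        show "uniform_limit (cball z d) (\<lambda>X z. \<Sum>\<alpha>\<in>X. c \<alpha> * (\<Prod>i<m. u z i ^ \<alpha> i)) (\<lambda>z. F (u z))
            (finite_subsets_at_top ?A)"
          by (rule uniform_limit_on_subset[OF ulim d(2)])
      qed auto
      thus ?thesis using d(1) by blast
    qed
    thus "(\<lambda>z. F (u z)) holomorphic_on S"
      unfolding analytic_on_open[OF S, symmetric] analytic_on_def by blast
  qed
  thus ?thesis using that s(1) by blast
qed

lemma analytic_germ_family_hol_on_polydisc:
  assumes "\<And>i. i < (m::nat) \<Longrightarrow> analytic_germ k (G i)"
  obtains s M where "s > 0" "M > 0" "\<And>i. i < m \<Longrightarrow> hol_on_polydisc k s M (G i)"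
  using assms
proof (induction m arbitrary: thesis)
  case 0
  show ?case by (rule 0(1)[of 1 1]) auto
next
  case (Suc m)
  obtain s M where sM: "s > 0" "M > 0" "\<And>i. i < m \<Longrightarrow> hol_on_polydisc k s M (G i)"
    using Suc.IH Suc.prems(2) less_Suc_eq by metis
  obtain s' M' where sM': "s' > 0" "hol_on_polydisc k s' M' (G m)"
    using analytic_germ_imp_hol_on_polydisc[OF Suc.prems(2)[OF lessI]] by blast
  show ?case
  proof (rule Suc.prems(1))
    show "min s s' > 0" "max M M' > 0" using sM sM' by auto
    fix i assume "i < Suc m"
    thus "hol_on_polydisc k (min s s') (max M M') (G i)"
      using hol_on_polydisc_mono[OF sM(3)[of i], of "min s s'" "max M M'"]
        hol_on_polydisc_mono[OF sM'(2), of "min s s'" "max M M'"]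
      by (cases "i = m") auto
  qed
qed

text \<open>Restriction to the complex line with value \<open>y\<close> at 0 and \<open>x\<close> at
  1. The line stays in the polydisc for parameters of norm below
  \<open>R = s / (2 * \<delta>)\<close>, where \<delta> is the distance of the points, and the
  one-variable estimate on that disc gives the Lipschitz bound. The last hypothesis says that
  \<open>R > 1\<close>.\<close>

lemma hol_on_polydisc_lipschitz:
  assumes F: "hol_on_polydisc m s M F" and s: "s > 0"
    and x: "x \<in> polydisc m (s / 2)" and y: "y \<in> polydisc m (s / 2)"
    and d: "(\<Sum>i<m. norm (x i - y i)) < s / 2"
  shows "norm (F x - F y) \<le> 4 * M / s * (\<Sum>i<m. norm (x i - y i))"
proof -
  define \<delta> where "\<delta> = (\<Sum>i<m. norm (x i - y i))"
  have le\<delta>: "norm (x i - y i) \<le> \<delta>" if "i < m" for i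
    unfolding \<delta>_def using that by (intro member_le_sum) auto
  have "\<delta> \<ge> 0" unfolding \<delta>_def by (intro sum_nonneg) auto
  show ?thesis
  proof (cases "\<delta> = 0")
    case True
    hence "x i = y i" if "i < m" for i using le\<delta>[OF that] by auto
    hence "F x = F y" using x polydisc_mono[of "s/2" s m] s
      by (intro hol_on_polydiscD(2)[OF F]) auto
    thus ?thesis using True by (simp add: \<delta>_def)
  next
    case False
    hence \<delta>: "\<delta> > 0" using \<open>\<delta> \<ge> 0\<close> by simp
    define R where "R = s / (2 * \<delta>)"
    have R: "R > 1" using d \<delta> by (simp add: R_def \<delta>_def[symmetric] field_simps)
    define u where "u = (\<lambda>z i. y i + z * (x i - y i))"
    have u: "u z \<in> polydisc m s" if "z \<in> ball 0 R" for z
      unfolding polydisc_def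
    proof (intro CollectI allI impI)
      fix i assume i: "i < m"
      have "norm (u z i) \<le> norm (y i) + norm z * norm (x i - y i)"
        unfolding u_def norm_mult[symmetric] by (rule norm_triangle_ineq)
      also have "norm z * norm (x i - y i) \<le> R * \<delta>"
        using that R le\<delta>[OF i] by (intro mult_mono) auto
      also have "R * \<delta> = s / 2" using \<delta> by (simp add: R_def)
      finally show "norm (u z i) < s" using y i by (auto simp: polydisc_def)
    qed
    have "norm ((\<lambda>z. F (u z)) 1 - (\<lambda>z. F (u z)) 0) \<le> 2 * M / R * norm (1 - 0 :: complex)"
    proof (rule bounded_holomorphic_diff_le)
      show "(\<lambda>z. F (u z)) holomorphic_on ball 0 R"
        by (rule hol_on_polydiscD(3)[OF F open_ball _ u])
           (auto simp: u_def intro!: holomorphic_intros)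
    qed (use R in \<open>auto intro: hol_on_polydiscD(1)[OF F u]\<close>)
    moreover have "F (u 1) = F x" "F (u 0) = F y" by (simp_all add: u_def)
    ultimately have "norm (F x - F y) \<le> 2 * M / R" by simp
    also have "2 * M / R = 4 * M / s * \<delta>" using \<delta> s by (simp add: R_def field_simps)
    finally show ?thesis by (simp add: \<delta>_def)
  qed
qed

text \<open>A radius small enough that any two points satisfy the distance hypothesis automatically.
  The summand 1 in \<open>m + 1\<close> keeps the denominator positive for
  \<open>m = 0\<close>.\<close>

lemma hol_on_polydisc_lipschitz':
  assumes F: "hol_on_polydisc m s M F" and s: "s > 0"
    and x: "x \<in> polydisc m (s / (4 * real (m + 1)))" and y: "y \<in> polydisc m (s / (4 * real (m + 1)))"
  shows "norm (F x - F y) \<le> 4 * M / s * (\<Sum>i<m. norm (x i - y i))"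
proof (rule hol_on_polydisc_lipschitz[OF F s])
  let ?e = "s / (4 * real (m + 1))"
  have "?e \<le> s / 2" using s by (simp add: field_simps)
  thus "x \<in> polydisc m (s / 2)" "y \<in> polydisc m (s / 2)"
    using x y polydisc_mono by blast+
  have "(\<Sum>i<m. norm (x i - y i)) \<le> (\<Sum>i<m. 2 * ?e)"
  proof (rule sum_mono)
    fix i assume "i \<in> {..<m}"
    hence "norm (x i) < ?e" "norm (y i) < ?e" using x y by (auto simp: polydisc_def)
    thus "norm (x i - y i) \<le> 2 * ?e" using norm_triangle_ineq4[of "x i" "y i"] by linarith
  qed
  also have "\<dots> = s / 2 * (real m / real (m + 1))" by (simp add: field_simps)
  also have "\<dots> < s / 2 * 1"
    using s by (intro mult_strict_left_mono) auto
  finally show "(\<Sum>i<m. norm (x i - y i)) < s / 2" by simp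
qed

section \<open>Closure properties of analytic germs\<close>

lemma analytic_germ_const [simp]: "analytic_germ m (\<lambda>_. c)"
  by (rule hol_on_polydisc_imp_analytic_germ[of m 1 "norm c"]) (auto intro!: hol_on_polydiscI)

lemma analytic_germ_coord:
  assumes "i < m"
  shows "analytic_germ m (\<lambda>x. x i)"
  by (rule hol_on_polydisc_imp_analytic_germ[of m 1 1])
     (use assms in \<open>auto intro!: hol_on_polydiscI simp: polydisc_def intro: less_imp_le\<close>)

lemma analytic_germ_add:
  assumes "analytic_germ m F" "analytic_germ m G"
  shows "analytic_germ m (\<lambda>x. F x + G x)"
proof -
  obtain s M s' M' where s: "s > 0" "hol_on_polydisc m s M F" "s' > 0" "hol_on_polydisc m s' M' G"
    using assms analytic_germ_imp_hol_on_polydisc by metis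
  let ?s = "min s s'"
  have F: "hol_on_polydisc m ?s M F" and G: "hol_on_polydisc m ?s M' G"
    using s by (auto intro: hol_on_polydisc_mono)
  have "hol_on_polydisc m ?s (M + M') (\<lambda>x. F x + G x)"
    by (intro hol_on_polydiscI norm_triangle_mono arg_cong2[of _ _ _ _ "(+)"] holomorphic_intros
          hol_on_polydiscD[OF F] hol_on_polydiscD[OF G])
  thus ?thesis using s by (auto intro: hol_on_polydisc_imp_analytic_germ)
qed

lemma analytic_germ_mult:
  assumes "analytic_germ m F" "analytic_germ m G"
  shows "analytic_germ m (\<lambda>x. F x * G x)"
proof -
  obtain s M s' M' where s: "s > 0" "hol_on_polydisc m s M F" "s' > 0" "hol_on_polydisc m s' M' G"
    using assms analytic_germ_imp_hol_on_polydisc by metis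
  let ?s = "min s s'"
  have F: "hol_on_polydisc m ?s M F" and G: "hol_on_polydisc m ?s M' G"
    using s by (auto intro: hol_on_polydisc_mono)
  have "norm (F x * G x) \<le> M * M'" if "x \<in> polydisc m ?s" for x
    unfolding norm_mult
    using hol_on_polydiscD(1)[OF F that] hol_on_polydiscD(1)[OF G that]
      order_trans[OF norm_ge_zero hol_on_polydiscD(1)[OF F that]]
    by (intro mult_mono) auto
  hence "hol_on_polydisc m ?s (M * M') (\<lambda>x. F x * G x)"
    by (intro hol_on_polydiscI arg_cong2[of _ _ _ _ "(*)"] holomorphic_intros
          hol_on_polydiscD(2,3)[OF F] hol_on_polydiscD(2,3)[OF G]) auto
  thus ?thesis using s by (auto intro: hol_on_polydisc_imp_analytic_germ)
qed

lemma analytic_germ_diff: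
  assumes "analytic_germ m F" "analytic_germ m G"
  shows "analytic_germ m (\<lambda>x. F x - G x)"
  using analytic_germ_add[OF assms(1) analytic_germ_mult[OF analytic_germ_const[of m "-1"] assms(2)]]
  by simp

lemma analytic_germ_sum:
  assumes "\<And>i. i \<in> I \<Longrightarrow> analytic_germ m (F i)"
  shows "analytic_germ m (\<lambda>x. \<Sum>i\<in>I. F i x)"
  using assms by (induction I rule: infinite_finite_induct) (auto intro: analytic_germ_add)

lemma analytic_germ_prod:
  assumes "\<And>i. i \<in> I \<Longrightarrow> analytic_germ m (F i)"
  shows "analytic_germ m (\<lambda>x. \<Prod>i\<in>I. F i x)"
  using assms by (induction I rule: infinite_finite_induct) (auto intro: analytic_germ_mult)

lemma analytic_germ_cong:
  assumes "analytic_germ m F" "r > 0" "\<And>x. x \<in> polydisc m r \<Longrightarrow> F x = G x"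
  shows "analytic_germ m G"
proof -
  obtain s M where s: "s > 0" "hol_on_polydisc m s M F"
    using assms(1) analytic_germ_imp_hol_on_polydisc by metis
  let ?s = "min s r"
  have F: "hol_on_polydisc m ?s M F" using s by (auto intro: hol_on_polydisc_mono)
  have eq: "F x = G x" if "x \<in> polydisc m ?s" for x
    using that polydisc_mono[of ?s r m] by (intro assms(3)) auto
  have "hol_on_polydisc m ?s M G"
  proof (rule hol_on_polydiscI)
    show "norm (G x) \<le> M" if "x \<in> polydisc m ?s" for x
      using hol_on_polydiscD(1)[OF F that] eq[OF that] by simp
    show "G x = G y" if "x \<in> polydisc m ?s" "\<And>i. i < m \<Longrightarrow> x i = y i" for x y
    proof -
      have "y \<in> polydisc m ?s" using that by (auto simp: polydisc_def)
      thus ?thesis using eq that hol_on_polydiscD(2)[OF F that] by metis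
    qed
    show "(\<lambda>z. G (u z)) holomorphic_on S" if "open S" "\<And>i. i < m \<Longrightarrow> (\<lambda>z. u z i) holomorphic_on S"
        "\<And>z. z \<in> S \<Longrightarrow> u z \<in> polydisc m ?s" for u S
      by (rule holomorphic_transform[OF hol_on_polydiscD(3)[OF F that]]) (use eq that in auto)
  qed
  thus ?thesis using s assms(2) by (auto intro: hol_on_polydisc_imp_analytic_germ)
qed

lemma analytic_germ_family_maps_into:
  assumes "\<And>i. i < m \<Longrightarrow> analytic_germ k (G i)" "\<And>i. i < m \<Longrightarrow> G i (\<lambda>_. 0) = 0" "e > 0"
  obtains s where "s > 0" "\<And>x. x \<in> polydisc k s \<Longrightarrow> (\<lambda>i. G i x) \<in> polydisc m e"
proof -
  obtain s M where sM: "s > 0" "M > 0" "\<And>i. i < m \<Longrightarrow> hol_on_polydisc k s M (G i)"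
    using analytic_germ_family_hol_on_polydisc[where m = m and k = k and G = G, OF assms(1)] by blast
  \<comment> \<open>The second bound makes the Lipschitz constant \<open>4 * M / s\<close> times the
    sum of the norms of the coordinates smaller than \<open>e\<close>.\<close>
  define r where "r = min (s / (4 * real (k + 1))) (e * s / (4 * M * real (k + 1)))"
  have r: "r > 0" using sM assms(3) by (simp add: r_def)
  show ?thesis
  proof (rule that[OF r])
    fix x assume x: "x \<in> polydisc k r"
    show "(\<lambda>i. G i x) \<in> polydisc m e"
      unfolding polydisc_def
    proof (intro CollectI allI impI)
      fix i assume i: "i < m"
      have "norm (G i x - G i (\<lambda>_. 0)) \<le> 4 * M / s * (\<Sum>j<k. norm (x j - 0))"
        using x sM polydisc_mono[of r "s / (4 * real (k + 1))" k]
        by (intro hol_on_polydisc_lipschitz'[OF sM(3)[OF i]]) (auto simp: r_def intro!: zero_in_polydisc)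
      also have "\<dots> \<le> 4 * M / s * (\<Sum>j<k. r)"
        using x sM by (intro mult_left_mono sum_mono) (auto simp: polydisc_def intro: less_imp_le)
      also have "(\<Sum>j<k. r) = real k * r" by simp
      also have "4 * M / s * \<dots> \<le> 4 * M / s * (real k * (e * s / (4 * M * real (k + 1))))"
        using sM by (intro mult_left_mono) (auto simp: r_def simp del: of_nat_add of_nat_Suc)
      also have "\<dots> = e * (real k / real (k + 1))"
        using sM by (simp add: divide_simps)
      also have "\<dots> < e * 1" using assms(3) by (intro mult_strict_left_mono) auto
      finally show "norm (G i x) < e" using assms(2)[OF i] by simp
    qed
  qed
qed

lemma analytic_germ_compose:
  assumes F: "analytic_germ m F" and G: "\<And>i. i < m \<Longrightarrow> analytic_germ k (G i)"
    and G0: "\<And>i. i < m \<Longrightarrow> G i (\<lambda>_. 0) = 0"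
  shows "analytic_germ k (\<lambda>x. F (\<lambda>i. G i x))"
proof -
  obtain e M where e: "e > 0" "hol_on_polydisc m e M F"
    using F analytic_germ_imp_hol_on_polydisc by metis
  note F = e(2)
  obtain s where s: "s > 0" "\<And>x. x \<in> polydisc k s \<Longrightarrow> (\<lambda>i. G i x) \<in> polydisc m e"
    using analytic_germ_family_maps_into[where m = m and k = k and G = G, OF G G0 e(1)] by blast
  obtain s' M' where s': "s' > 0" "\<And>i. i < m \<Longrightarrow> hol_on_polydisc k s' M' (G i)"
    using analytic_germ_family_hol_on_polydisc[where m = m and k = k and G = G, OF G] by blast
  let ?s = "min s s'"
  have G: "hol_on_polydisc k ?s M' (G i)" if "i < m" for i
    by (rule hol_on_polydisc_mono[OF s'(2)[OF that]]) auto
  have into: "(\<lambda>i. G i x) \<in> polydisc m e" if "x \<in> polydisc k ?s" for x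
    using that polydisc_mono[of ?s s k] by (intro s(2)) auto
  have "hol_on_polydisc k ?s M (\<lambda>x. F (\<lambda>i. G i x))"
  proof (rule hol_on_polydiscI)
    show "norm (F (\<lambda>i. G i x)) \<le> M" if "x \<in> polydisc k ?s" for x
      by (rule hol_on_polydiscD(1)[OF F into[OF that]])
    show "F (\<lambda>i. G i x) = F (\<lambda>i. G i y)" if "x \<in> polydisc k ?s" "\<And>i. i < k \<Longrightarrow> x i = y i" for x y
      by (rule hol_on_polydiscD(2)[OF F into[OF that(1)] hol_on_polydiscD(2)[OF G that]])
    show "(\<lambda>z. F (\<lambda>i. G i (u z))) holomorphic_on S"
      if "open S" "\<And>i. i < k \<Longrightarrow> (\<lambda>z. u z i) holomorphic_on S"
        "\<And>z. z \<in> S \<Longrightarrow> u z \<in> polydisc k ?s" for u S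
      by (rule hol_on_polydiscD(3)[OF F that(1) hol_on_polydiscD(3)[OF G that] into[OF that(3)]])
  qed
  thus ?thesis using s s' by (auto intro: hol_on_polydisc_imp_analytic_germ)
qed

lemma analytic_germ_univariate:
  assumes f: "f analytic_on {0}" and i: "i < m"
  shows "analytic_germ m (\<lambda>x. f (x i))"
proof -
  obtain r where r: "r > 0" "f holomorphic_on ball 0 r"
    using f by (auto simp: analytic_on_def)
  have "compact (f ` cball 0 (r / 2))"
    using r by (intro compact_continuous_image holomorphic_on_imp_continuous_on)
               (auto intro: holomorphic_on_subset[OF r(2)])
  then obtain M where M: "\<And>z. z \<in> cball 0 (r / 2) \<Longrightarrow> norm (f z) \<le> M"
    by (meson bounded_iff compact_imp_bounded imageI)
  have "hol_on_polydisc m (r / 2) M (\<lambda>x. f (x i))"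
  proof (rule hol_on_polydiscI)
    show "norm (f (x i)) \<le> M" if "x \<in> polydisc m (r / 2)" for x
      using that i by (intro M) (auto simp: polydisc_def intro: less_imp_le)
    show "(\<lambda>z. f (u z i)) holomorphic_on S" if "\<And>i. i < m \<Longrightarrow> (\<lambda>z. u z i) holomorphic_on S"
        "\<And>z. z \<in> S \<Longrightarrow> u z \<in> polydisc m (r / 2)" for u S
    proof (rule holomorphic_on_compose_gen[of "\<lambda>z. u z i", OF _ r(2), unfolded o_def])
      show "(\<lambda>z. u z i) holomorphic_on S" by (rule that(1)[OF i])
      have "norm (u z i) < r" if "z \<in> S" for z
        using \<open>z \<in> S \<Longrightarrow> u z \<in> polydisc m (r / 2)\<close>[OF that] i r by (auto simp: polydisc_def)
      thus "(\<lambda>z. u z i) ` S \<subseteq> ball 0 r" by auto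
    qed
  qed (use i in simp)
  thus ?thesis using r by (auto intro: hol_on_polydisc_imp_analytic_germ)
qed

section \<open>Germs along a curve, and Hadamard's lemma\<close>

lemma parametrization_local:
  assumes "parametrization m \<phi>" "e > 0"
  obtains d where "d > 0" "\<And>i. i < m \<Longrightarrow> (\<lambda>t. \<phi> t i) holomorphic_on ball 0 d"
    "\<And>t. t \<in> ball 0 d \<Longrightarrow> \<phi> t \<in> polydisc m e"
  using assms(1)
proof (induction m arbitrary: thesis)
  case 0
  show ?case by (rule 0(1)[of 1]) (auto simp: polydisc_def)
next
  case (Suc m)
  have "parametrization m \<phi>" using Suc.prems(2) by (auto simp: parametrization_def)
  then obtain d where d: "d > 0" "\<And>i. i < m \<Longrightarrow> (\<lambda>t. \<phi> t i) holomorphic_on ball 0 d"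
    "\<And>t. t \<in> ball 0 d \<Longrightarrow> \<phi> t \<in> polydisc m e" using Suc.IH by blast
  have an: "(\<lambda>t. \<phi> t m) analytic_on {0}" and z: "\<phi> 0 m = 0"
    using Suc.prems(2) by (auto simp: parametrization_def)
  obtain r where r: "r > 0" "(\<lambda>t. \<phi> t m) holomorphic_on ball 0 r"
    using an by (auto simp: analytic_on_def)
  have "isCont (\<lambda>t. \<phi> t m) 0" using an by (rule analytic_at_imp_isCont)
  hence "eventually (\<lambda>t. norm (\<phi> t m) < e) (nhds 0)"
    using tendsto_norm[of "\<lambda>t. \<phi> t m" 0 "nhds 0"] z assms(2)
    by (intro order_tendstoD(2)[of _ 0]) (auto simp: continuous_at_imp_continuous_on isCont_def tendsto_nhds_iff)
  then obtain r' where r': "r' > 0" "\<And>t. norm t < r' \<Longrightarrow> norm (\<phi> t m) < e"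
    by (auto simp: eventually_nhds_metric)
  show ?case
  proof (rule Suc.prems(1)[of "min d (min r r')"])
    show "min d (min r r') > 0" using d r r' by auto
    show "(\<lambda>t. \<phi> t i) holomorphic_on ball 0 (min d (min r r'))" if "i < Suc m" for i
    proof (cases "i = m")
      case True thus ?thesis by (auto intro: holomorphic_on_subset[OF r(2)])
    next
      case False
      hence "i < m" using that by simp
      thus ?thesis by (auto intro: holomorphic_on_subset[OF d(2)])
    qed
    show "\<phi> t \<in> polydisc (Suc m) e" if "t \<in> ball 0 (min d (min r r'))" for t
      using d(3)[of t] r'(2)[of t] that by (auto simp: polydisc_def less_Suc_eq)
  qed
qed

lemma analytic_germ_along_curve:
  assumes "analytic_germ m F" "parametrization m \<phi>"
  shows "(\<lambda>t. F (\<phi> t)) analytic_on {0}"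
proof -
  obtain s M where s: "s > 0" "hol_on_polydisc m s M F"
    using assms(1) analytic_germ_imp_hol_on_polydisc by metis
  obtain d where d: "d > 0" "\<And>i. i < m \<Longrightarrow> (\<lambda>t. \<phi> t i) holomorphic_on ball 0 d"
    "\<And>t. t \<in> ball 0 d \<Longrightarrow> \<phi> t \<in> polydisc m s"
    using parametrization_local[OF assms(2) s(1)] by blast
  have "(\<lambda>t. F (\<phi> t)) holomorphic_on ball 0 d"
    by (rule hol_on_polydiscD(3)[OF s(2) open_ball d(2,3)])
  thus ?thesis using d(1) by (auto simp: analytic_on_def)
qed

text \<open>The coordinates are set to 0 one at a time. Passing from \<open>Z k x\<close> to
  \<open>Z (Suc k) x\<close> changes the value by \<open>x k\<close> times a Hadamard quotient,
  which is a germ by Osgood's lemma, and these changes telescope.\<close>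

lemma analytic_germ_hadamard:
  assumes F: "analytic_germ m F"
  shows "\<exists>r u. r > 0 \<and> (\<forall>i<m. analytic_germ m (u i)) \<and>
    (\<forall>x\<in>polydisc m r. F x = F (\<lambda>_. 0) + (\<Sum>i<m. x i * u i x))"
proof -
  obtain s M where s: "s > 0" "hol_on_polydisc m s M F"
    using assms(1) analytic_germ_imp_hol_on_polydisc by metis
  define Z where "Z = (\<lambda>k (x :: nat \<Rightarrow> complex) i. if i < k then 0 else x i)"
  define u where "u = (\<lambda>k x. had_quot k F (Z k x))"
  have u: "analytic_germ m (u k)" if "k < m" for k
    unfolding u_def
  proof (rule analytic_germ_compose[where F = "had_quot k F" and G = "\<lambda>i x. Z k x i" and m = m])
    show "analytic_germ m (had_quot k F)"
      by (rule sep_hol_imp_analytic_germ[OF sep_hol_had_quot[OF hol_on_polydisc_imp_sep_hol[OF s(2)] that] s(1)])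
    show "analytic_germ m (\<lambda>x. Z k x i)" if "i < m" for i
      using that by (cases "i < k") (auto simp: Z_def intro: analytic_germ_coord)
    show "Z k (\<lambda>_. 0) i = 0" for i by (auto simp: Z_def)
  qed
  have step: "F (Z k x) = F (Z (Suc k) x) + x k * u k x" for k x
  proof -
    have "(Z k x)(k := 0) = Z (Suc k) x" by (auto simp: Z_def fun_eq_iff)
    thus ?thesis using had_quot_eq[of F "Z k x" k] by (simp add: u_def Z_def)
  qed
  have telescope: "F (Z 0 x) = F (Z k x) + (\<Sum>i<k. x i * u i x)" for k x
  proof (induction k)
    case (Suc k)
    show ?case unfolding Suc by (subst step) simp
  qed simp
  have "F (Z m x) = F (\<lambda>_. 0)" for x
    by (rule hol_on_polydiscD(2)[OF s(2)]) (use s(1) in \<open>auto simp: Z_def polydisc_def\<close>)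
  hence eq: "F x = F (\<lambda>_. 0) + (\<Sum>i<m. x i * u i x)" for x
    using telescope[of x m] by (simp add: Z_def)
  show ?thesis
    by (intro exI[of _ s] exI[of _ u] conjI allI impI ballI s(1) u eq)
qed

subsection \<open>The analytic inverse function theorem\<close>

lemma linear_dependence:
  fixes M :: "'a \<Rightarrow> nat \<Rightarrow> complex"
  assumes "finite J" "card J > k"
  shows "\<exists>b. (\<exists>j\<in>J. b j \<noteq> 0) \<and> (\<forall>i<k. (\<Sum>j\<in>J. b j * M j i) = 0)"
  using assms
proof (induction k arbitrary: J M)
  case 0
  then obtain j where "j \<in> J" by fastforce
  thus ?case by (intro exI[of _ "\<lambda>_. 1"]) auto
next
  case (Suc k)
  show ?case
  proof (cases "\<forall>j\<in>J. M j k = 0")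
    case True
    obtain b where "\<exists>j\<in>J. b j \<noteq> 0" "\<forall>i<k. (\<Sum>j\<in>J. b j * M j i) = 0"
      using Suc.IH[of J M] Suc.prems by auto
    thus ?thesis using True by (intro exI[of _ b]) (auto simp: less_Suc_eq)
  next
    case False
    \<comment> \<open>Gaussian elimination with pivot \<open>p\<close>: multiples of
      \<open>M p\<close> clear the coordinate \<open>k\<close> of the other vectors, and the
      coefficient \<open>c\<close> of the pivot collects those multiples.\<close>
    then obtain p where p: "p \<in> J" "M p k \<noteq> 0" by auto
    have "card (J - {p}) > k" using Suc.prems p by simp
    then obtain b where b: "\<exists>j\<in>J-{p}. b j \<noteq> 0"
      "\<And>i. i < k \<Longrightarrow> (\<Sum>j\<in>J-{p}. b j * (M j i - M j k / M p k * M p i)) = 0"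
      using Suc.IH[of "J - {p}" "\<lambda>j i. M j i - M j k / M p k * M p i"] Suc.prems by auto
    define c where "c = - (\<Sum>j\<in>J-{p}. b j * M j k) / M p k"
    have split: "(\<Sum>j\<in>J. (b(p := c)) j * M j i) = c * M p i + (\<Sum>j\<in>J-{p}. b j * M j i)" for i
      using sum.remove[OF Suc.prems(1) p(1), of "\<lambda>j. (b(p := c)) j * M j i"]
      by (auto intro!: sum.cong)
    have "(\<Sum>j\<in>J. (b(p := c)) j * M j i) = 0" if "i < Suc k" for i
    proof (cases "i = k")
      case True
      thus ?thesis unfolding split using p by (simp add: c_def)
    next
      case False
      hence "(\<Sum>j\<in>J-{p}. b j * M j i) - (\<Sum>j\<in>J-{p}. b j * M j k) / M p k * M p i = 0"
        using b(2)[of i] that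
        by (simp add: sum_subtractf sum_distrib_right sum_divide_distrib right_diff_distrib mult.assoc)
      thus ?thesis unfolding split by (simp add: c_def)
    qed
    moreover have "\<exists>j\<in>J. (b(p := c)) j \<noteq> 0" using b(1) by auto
    ultimately show ?thesis by blast
  qed
qed

text \<open>Invertibility in the form in which it gets verified. The rows are the linear parts of
  the components of a map, and the condition says that no nontrivial combination of them
  vanishes.\<close>

definition trivial_left_kernel :: "nat \<Rightarrow> (nat \<Rightarrow> nat \<Rightarrow> complex) \<Rightarrow> bool" where
  "trivial_left_kernel N L \<longleftrightarrow>
     (\<forall>b. (\<forall>j<N. (\<Sum>i<N. b i * L i j) = 0) \<longrightarrow> (\<forall>i<N. b i = 0))"

lemma sum_delta_left:
  "j < N \<Longrightarrow> (\<Sum>i<(N::nat). b i * (if i = j then 1 else 0)) = (b j :: complex)"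
  by (simp add: mult_delta_right sum.delta)

text \<open>A unit vector appended to the \<open>N\<close> rows gives \<open>N + 1\<close> vectors
  in \<open>N\<close>-space, hence a relation. The unit vector has a nonzero coefficient in it since
  the rows are independent, and solving for it gives a row of the inverse.\<close>

lemma left_inverse_exists:
  assumes "trivial_left_kernel N L"
  shows "\<exists>L'. \<forall>i<N. \<forall>j<N. (\<Sum>k<N. L' i k * L k j) = (if i = j then 1 else 0)"
proof -
  have "\<exists>c. \<forall>j<N. (\<Sum>k<N. c k * L k j) = (if i = j then 1 else 0)" if i: "i < N" for i
  proof -
    define M where "M = (\<lambda>k j. if k = N then (if i = j then 1 else 0) else L k j)"
    obtain b where b: "\<exists>k\<in>{..N}. b k \<noteq> 0" "\<forall>j<N. (\<Sum>k\<in>{..N}. b k * M k j) = 0"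
      using linear_dependence[of "{..N}" N M] by auto
    have eq: "(\<Sum>k<N. b k * L k j) + b N * (if i = j then 1 else 0) = 0" if "j < N" for j
      using b(2) that by (simp add: lessThan_Suc_atMost[symmetric] M_def)
    have "b N \<noteq> 0"
    proof
      assume "b N = 0"
      hence "\<forall>k<N. b k = 0" using assms eq unfolding trivial_left_kernel_def by simp
      thus False using b(1) \<open>b N = 0\<close> by (auto simp: le_less)
    qed
    have "(\<Sum>k<N. - b k / b N * L k j) = (if i = j then 1 else 0)" if "j < N" for j
    proof -
      have "(\<Sum>k<N. - b k / b N * L k j) = - (\<Sum>k<N. b k * L k j) / b N"
        by (simp add: sum_divide_distrib sum_negf)
      also have "(\<Sum>k<N. b k * L k j) = - (b N * (if i = j then 1 else 0))"
        using eq[OF that] by (simp add: eq_neg_iff_add_eq_0)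
      finally show ?thesis using \<open>b N \<noteq> 0\<close> by simp
    qed
    thus ?thesis by (intro exI[of _ "\<lambda>k. - b k / b N"]) simp
  qed
  hence "\<forall>i. \<exists>c. i < N \<longrightarrow> (\<forall>j<N. (\<Sum>k<N. c k * L k j) = (if i = j then 1 else 0))"
    by blast
  from choice[OF this] obtain L' where
    "\<forall>i. i < N \<longrightarrow> (\<forall>j<N. (\<Sum>k<N. L' i k * L k j) = (if i = j then 1 else 0))" ..
  thus ?thesis by (intro exI[of _ L']) simp
qed

text \<open>The left inverse has trivial left kernel itself, hence a left inverse
  \<open>L''\<close>. The usual associativity argument gives \<open>L'' = L\<close>, so
  \<open>L'\<close> is inverse on both sides.\<close>

lemma inverse_matrix_exists:
  assumes "trivial_left_kernel N L"
  obtains L' where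
    "\<And>i v. i < N \<Longrightarrow> (\<Sum>j<N. L' i j * (\<Sum>k<N. L j k * v k)) = v i"
    "\<And>i v. i < N \<Longrightarrow> (\<Sum>j<N. L i j * (\<Sum>k<N. L' j k * v k)) = v i"
proof -
  have assoc: "(\<Sum>j<N. a j * (\<Sum>k<N. B j k * v k)) = (\<Sum>k<N. (\<Sum>j<N. a j * B j k) * v k)"
    for a v :: "nat \<Rightarrow> complex" and B
    unfolding sum_distrib_left sum_distrib_right mult.assoc by (rule sum.swap)
  obtain L' where L': "\<And>i j. i < N \<Longrightarrow> j < N \<Longrightarrow> (\<Sum>k<N. L' i k * L k j) = (if i = j then 1 else 0)"
    using left_inverse_exists[OF assms] by blast
  have "trivial_left_kernel N L'"
    unfolding trivial_left_kernel_def
  proof (intro allI impI)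
    fix b i assume b: "\<forall>j<N. (\<Sum>i<N. b i * L' i j) = 0" and i: "i < N"
    have "b i = (\<Sum>j<N. b j * (\<Sum>k<N. L' j k * L k i))"
      using i by (simp add: L' sum_delta_left)
    also have "\<dots> = 0" unfolding assoc using b by simp
    finally show "b i = 0" .
  qed
  then obtain L'' where L'': "\<And>i j. i < N \<Longrightarrow> j < N \<Longrightarrow> (\<Sum>k<N. L'' i k * L' k j) = (if i = j then 1 else 0)"
    using left_inverse_exists by blast
  have "L'' i j = L i j" if "i < N" "j < N" for i j
  proof -
    have "L'' i j = (\<Sum>k<N. L'' i k * (\<Sum>l<N. L' k l * L l j))"
      using that by (simp add: L' sum_delta_left)
    also have "\<dots> = (\<Sum>l<N. (if i = l then 1 else 0) * L l j)"
      unfolding assoc using that by (intro sum.cong refl) (simp add: L'')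
    also have "\<dots> = L i j" using that by (simp add: mult_delta_left sum.delta)
    finally show ?thesis .
  qed
  hence R: "(\<Sum>k<N. L i k * L' k j) = (if i = j then 1 else 0)" if "i < N" "j < N" for i j
    using L''[OF that] that by simp
  show ?thesis
  proof (rule that[of L'])
    fix i v assume i: "i < N"
    show "(\<Sum>j<N. L' i j * (\<Sum>k<N. L j k * v k)) = v i"
      unfolding assoc using i by (simp add: L' mult_delta_left sum.delta)
    show "(\<Sum>j<N. L i j * (\<Sum>k<N. L' j k * v k)) = v i"
      unfolding assoc using i by (simp add: R mult_delta_left sum.delta)
  qed
qed

text \<open>By Hadamard's lemma this is membership in the square of the maximal ideal.\<close>

definition in_max_sq :: "nat \<Rightarrow> ((nat \<Rightarrow> complex) \<Rightarrow> complex) \<Rightarrow> bool" where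
  "in_max_sq m q \<longleftrightarrow> (\<exists>u r. r > 0 \<and> (\<forall>i<m. analytic_germ m (u i) \<and> u i (\<lambda>_. 0) = 0) \<and>
     (\<forall>x\<in>polydisc m r. q x = (\<Sum>i<m. x i * u i x)))"

lemma in_max_sq_analytic_germ:
  assumes "in_max_sq m q"
  shows "analytic_germ m q"
proof -
  obtain r u where u': "r > 0" "\<forall>i<m. analytic_germ m (u i) \<and> u i (\<lambda>_. 0) = 0"
    "\<forall>x\<in>polydisc m r. q x = (\<Sum>i<m. x i * u i x)"
    using assms unfolding in_max_sq_def by blast
  note u = u'(1) u'(2)[rule_format, THEN conjunct1] u'(2)[rule_format, THEN conjunct2] u'(3)[rule_format]
  have "analytic_germ m (\<lambda>x. \<Sum>i<m. x i * u i x)"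
    by (intro analytic_germ_sum analytic_germ_mult analytic_germ_coord u) auto
  thus ?thesis by (rule analytic_germ_cong[OF _ u(1)]) (simp add: u)
qed

lemma in_max_sq_zero:
  assumes "in_max_sq m q"
  shows "q (\<lambda>_. 0) = 0"
  using assms by (auto simp: in_max_sq_def zero_in_polydisc)

lemma linear_part:
  assumes F: "analytic_germ m F"
  obtains l q where "in_max_sq m q" "\<And>x. F x = F (\<lambda>_. 0) + (\<Sum>i<m. l i * x i) + q x"
proof -
  obtain r u where u': "r > 0" "\<forall>i<m. analytic_germ m (u i)"
    "\<forall>x\<in>polydisc m r. F x = F (\<lambda>_. 0) + (\<Sum>i<m. x i * u i x)"
    using analytic_germ_hadamard[OF F] by blast
  note u = u'(1) u'(2,3)[rule_format]
  define l where "l = (\<lambda>i. u i (\<lambda>_. 0))"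
  define q where "q = (\<lambda>x. F x - F (\<lambda>_. 0) - (\<Sum>i<m. l i * x i))"
  have "in_max_sq m q"
    unfolding in_max_sq_def
  proof (intro exI[of _ "\<lambda>i x. u i x - l i"] exI[of _ r] conjI allI impI ballI u)
    show "analytic_germ m (\<lambda>x. u i x - l i)" if "i < m" for i
      by (intro analytic_germ_diff u that analytic_germ_const)
    show "q x = (\<Sum>i<m. x i * (u i x - l i))" if "x \<in> polydisc m r" for x
      unfolding q_def u(3)[OF that] by (simp add: right_diff_distrib sum_subtractf mult.commute)
  qed (simp add: l_def)
  thus ?thesis by (rule that[of q l]) (simp add: q_def)
qed

lemma common_radius:
  assumes "\<And>i. i < n \<Longrightarrow> \<exists>s>0. P i s"
    and mono: "\<And>i s t. P i s \<Longrightarrow> 0 < t \<Longrightarrow> t \<le> s \<Longrightarrow> P i (t :: real)"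
  shows "\<exists>s>0. \<forall>i<(n::nat). P i s"
  using assms(1)
proof (induction n)
  case 0
  show ?case by (intro exI[of _ 1]) auto
next
  case (Suc n)
  obtain s t where s: "s > 0" "\<forall>i<n. P i s" and t: "t > 0" "P n t"
    using Suc.IH Suc.prems by (meson less_Suc_eq)
  have "P i (min s t)" if "i < Suc n" for i
    using that s t mono[of i s "min s t"] mono[of n t "min s t"] by (auto simp: less_Suc_eq)
  thus ?case using s t by (intro exI[of _ "min s t"]) auto
qed

lemma in_max_sq_linear_combination:
  assumes "\<And>j. j < (n::nat) \<Longrightarrow> in_max_sq m (q j)"
  shows "in_max_sq m (\<lambda>x. \<Sum>j<n. b j * q j x)"
proof -
  have "\<forall>j<n. \<exists>u. (\<forall>i<m. analytic_germ m (u i) \<and> u i (\<lambda>_. 0) = 0) \<and>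
     (\<exists>r>0. \<forall>x\<in>polydisc m r. q j x = (\<Sum>i<m. x i * u i x))"
    using assms unfolding in_max_sq_def by blast
  hence "\<forall>j. \<exists>u. j < n \<longrightarrow> (\<forall>i<m. analytic_germ m (u i) \<and> u i (\<lambda>_. 0) = 0) \<and>
     (\<exists>r>0. \<forall>x\<in>polydisc m r. q j x = (\<Sum>i<m. x i * u i x))"
    by blast
  from choice[OF this] obtain u where
    u: "\<And>j i. j < n \<Longrightarrow> i < m \<Longrightarrow> analytic_germ m (u j i) \<and> u j i (\<lambda>_. 0) = 0"
    "\<And>j. j < n \<Longrightarrow> \<exists>r>0. \<forall>x\<in>polydisc m r. q j x = (\<Sum>i<m. x i * u j i x)"
    by blast
  have "\<exists>r>0. \<forall>j<n. \<forall>x\<in>polydisc m r. q j x = (\<Sum>i<m. x i * u j i x)"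
  proof (rule common_radius[where P = "\<lambda>j r. \<forall>x\<in>polydisc m r. q j x = (\<Sum>i<m. x i * u j i x)", OF u(2)])
    fix j s t assume "\<forall>x\<in>polydisc m s. q j x = (\<Sum>i<m. x i * u j i x)" "(0::real) < t" "t \<le> s"
    thus "\<forall>x\<in>polydisc m t. q j x = (\<Sum>i<m. x i * u j i x)" using polydisc_mono[of t s m] by blast
  qed
  then obtain r where r: "r > 0" "\<And>j x. j < n \<Longrightarrow> x \<in> polydisc m r \<Longrightarrow> q j x = (\<Sum>i<m. x i * u j i x)"
    by blast
  show ?thesis
    unfolding in_max_sq_def
  proof (intro exI[of _ "\<lambda>i x. \<Sum>j<n. b j * u j i x"] exI[of _ r] conjI allI impI ballI r)
    show "analytic_germ m (\<lambda>x. \<Sum>j<n. b j * u j i x)" if "i < m" for i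
      by (intro analytic_germ_sum analytic_germ_mult analytic_germ_const) (use u that in auto)
    show "(\<Sum>j<n. b j * u j i (\<lambda>_. 0)) = 0" if "i < m" for i
      using u that by simp
    show "(\<Sum>j<n. b j * q j x) = (\<Sum>i<m. x i * (\<Sum>j<n. b j * u j i x))" if "x \<in> polydisc m r" for x
    proof -
      have "(\<Sum>j<n. b j * q j x) = (\<Sum>j<n. \<Sum>i<m. x i * (b j * u j i x))"
        by (intro sum.cong refl) (simp add: r(2)[OF _ that] sum_distrib_left mult_ac)
      also have "\<dots> = (\<Sum>i<m. x i * (\<Sum>j<n. b j * u j i x))"
        unfolding sum_distrib_left by (rule sum.swap)
      finally show ?thesis .
    qed
  qed
qed

lemma in_max_sq_mult:
  assumes F: "analytic_germ m F" "F (\<lambda>_. 0) = 0" and G: "analytic_germ m G" "G (\<lambda>_. 0) = 0"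
  shows "in_max_sq m (\<lambda>x. F x * G x)"
proof -
  obtain r u where u': "r > 0" "\<forall>i<m. analytic_germ m (u i)"
    "\<forall>x\<in>polydisc m r. F x = F (\<lambda>_. 0) + (\<Sum>i<m. x i * u i x)"
    using analytic_germ_hadamard[OF F(1)] by blast
  note u = u'(1) u'(2,3)[rule_format]
  show ?thesis
    unfolding in_max_sq_def
  proof (intro exI[of _ "\<lambda>i x. u i x * G x"] exI[of _ r] conjI allI impI ballI u(1))
    show "F x * G x = (\<Sum>i<m. x i * (u i x * G x))" if "x \<in> polydisc m r" for x
      unfolding u(3)[OF that] F(2) by (simp add: sum_distrib_right mult.assoc)
  qed (simp_all add: G(2) analytic_germ_mult[OF u(2) G(1)])
qed

text \<open>Both factors in \<open>x i * u i x\<close> vanish at the origin, so the Lipschitz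
  constant can be made arbitrarily small near it. This replaces the statement that the derivative of
  \<open>q\<close> at 0 vanishes.\<close>

lemma in_max_sq_lipschitz:
  assumes "in_max_sq m q" "\<epsilon> > 0"
  shows "\<exists>s>0. \<forall>x\<in>polydisc m s. \<forall>y\<in>polydisc m s. norm (q x - q y) \<le> \<epsilon> * (\<Sum>i<m. norm (x i - y i))"
proof -
  obtain r u where u': "r > 0" "\<forall>i<m. analytic_germ m (u i) \<and> u i (\<lambda>_. 0) = 0"
    "\<forall>x\<in>polydisc m r. q x = (\<Sum>i<m. x i * u i x)"
    using assms(1) unfolding in_max_sq_def by blast
  note u = u'(1) u'(2)[rule_format, THEN conjunct1] u'(2)[rule_format, THEN conjunct2] u'(3)[rule_format]
  obtain s0 M where s0: "s0 > 0" "M > 0" "\<And>i. i < m \<Longrightarrow> hol_on_polydisc m s0 M (u i)"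
    using analytic_germ_family_hol_on_polydisc[where m = m and k = m and G = u, OF u(2)] by blast
  define C where "C = 4 * M / s0"
  have C: "C > 0" using s0 by (simp add: C_def)
  \<comment> \<open>The three bounds serve the representation of \<open>q\<close>, the Lipschitz
    estimate for \<open>u\<close>, and the final inequality
    \<open>2 * C * real m * s \<le> \<epsilon>\<close>.\<close>
  define s where "s = min r (min (s0 / (4 * real (m + 1))) (\<epsilon> / (2 * C * real (m + 1))))"
  have s: "s > 0" using u(1) s0 C assms(2) by (simp add: s_def)
  have lip: "norm (u i x - u i y) \<le> C * (\<Sum>i<m. norm (x i - y i))"
    if "x \<in> polydisc m s" "y \<in> polydisc m s" "i < m" for x y i
    unfolding C_def
  proof (rule hol_on_polydisc_lipschitz'[OF s0(3)[OF that(3)] s0(1)])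
    have "polydisc m s \<subseteq> polydisc m (s0 / (4 * real (m + 1)))"
      by (rule polydisc_mono) (simp add: s_def)
    thus "x \<in> polydisc m (s0 / (4 * real (m + 1)))" "y \<in> polydisc m (s0 / (4 * real (m + 1)))"
      using that by auto
  qed
  have "norm (q x - q y) \<le> \<epsilon> * (\<Sum>i<m. norm (x i - y i))"
    if x: "x \<in> polydisc m s" and y: "y \<in> polydisc m s" for x y
  proof -
    define \<delta> where "\<delta> = (\<Sum>i<m. norm (x i - y i))"
    have \<delta>: "\<delta> \<ge> 0" unfolding \<delta>_def by (intro sum_nonneg) auto
    have ux: "norm (u i x) \<le> C * (real m * s)" if i: "i < m" for i
    proof -
      have "norm (u i x - u i (\<lambda>_. 0)) \<le> C * (\<Sum>i<m. norm (x i - 0))"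
        by (rule lip[OF x _ i]) (use s in \<open>simp add: zero_in_polydisc\<close>)
      also have "\<dots> \<le> C * (\<Sum>i<m. s)"
        using x C by (intro mult_left_mono sum_mono) (auto simp: polydisc_def intro: less_imp_le)
      finally show ?thesis using u(3)[OF i] by simp
    qed
    have "polydisc m s \<subseteq> polydisc m r" by (rule polydisc_mono) (simp add: s_def)
    hence xr: "x \<in> polydisc m r" and yr: "y \<in> polydisc m r" using x y by auto
    have "q x - q y = (\<Sum>i<m. (x i - y i) * u i x + y i * (u i x - u i y))"
      unfolding u(4)[OF xr] u(4)[OF yr] sum_subtractf[symmetric]
      by (intro sum.cong refl) (simp add: algebra_simps)
    also have "norm \<dots> \<le> (\<Sum>i<m. norm (x i - y i) * (C * (real m * s)) + s * (C * \<delta>))"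
    proof (rule sum_norm_le)
      fix i assume "i \<in> {..<m}"
      hence i: "i < m" by simp
      have "norm ((x i - y i) * u i x) \<le> norm (x i - y i) * (C * (real m * s))"
        unfolding norm_mult by (intro mult_left_mono ux i) auto
      moreover have "norm (y i * (u i x - u i y)) \<le> s * (C * \<delta>)"
        unfolding norm_mult \<delta>_def using s y i
        by (intro mult_mono lip x y) (auto simp: polydisc_def intro: less_imp_le)
      ultimately show "norm ((x i - y i) * u i x + y i * (u i x - u i y))
          \<le> norm (x i - y i) * (C * (real m * s)) + s * (C * \<delta>)"
        by (rule norm_triangle_mono)
    qed
    also have "\<dots> = 2 * C * real m * s * \<delta>"
      by (simp add: sum.distrib sum_distrib_right[symmetric] \<delta>_def[symmetric])
    also have "\<dots> \<le> \<epsilon> * \<delta>"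
    proof (rule mult_right_mono[OF _ \<delta>])
      have "2 * C * real m * s \<le> 2 * C * real (m + 1) * (\<epsilon> / (2 * C * real (m + 1)))"
        using C s by (intro mult_mono) (auto simp: s_def)
      also have "\<dots> = \<epsilon>" using C by simp
      finally show "2 * C * real m * s \<le> \<epsilon>" .
    qed
    finally show ?thesis by (simp add: \<delta>_def)
  qed
  thus ?thesis using s by blast
qed

text \<open>Since holomorphy is tested along curves, the one-variable theorem on uniform limits
  applies to one curve at a time.\<close>

lemma hol_on_polydisc_uniform_limit:
  assumes f: "\<And>k. hol_on_polydisc m r M (f k)" and lim: "uniform_limit (polydisc m r) f g sequentially"
  shows "hol_on_polydisc m r M g"
proof (rule hol_on_polydiscI)
  have ptw: "(\<lambda>k. f k x) \<longlonglongrightarrow> g x" if "x \<in> polydisc m r" for x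
    using tendsto_uniform_limitI[OF lim that] .
  show "norm (g x) \<le> M" if "x \<in> polydisc m r" for x
    by (rule Lim_bounded[OF tendsto_norm[OF ptw[OF that]], of 0]) (auto intro: hol_on_polydiscD(1)[OF f that])
  show "g x = g y" if x: "x \<in> polydisc m r" and xy: "\<And>i. i < m \<Longrightarrow> x i = y i" for x y
  proof -
    have y: "y \<in> polydisc m r" using x xy by (auto simp: polydisc_def)
    have "f k x = f k y" for k by (rule hol_on_polydiscD(2)[OF f x xy])
    hence "(\<lambda>k. f k y) \<longlonglongrightarrow> g x" using ptw[OF x] by simp
    thus ?thesis using ptw[OF y] by (rule LIMSEQ_unique)
  qed
  fix u :: "complex \<Rightarrow> nat \<Rightarrow> complex" and S
  assume S: "open S" and hol: "\<And>i. i < m \<Longrightarrow> (\<lambda>z. u z i) holomorphic_on S"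
    and u: "\<And>z. z \<in> S \<Longrightarrow> u z \<in> polydisc m r"
  show "(\<lambda>z. g (u z)) holomorphic_on S"
  proof (rule holomorphic_uniform_sequence[OF S])
    show "(\<lambda>z. f k (u z)) holomorphic_on S" for k
      by (rule hol_on_polydiscD(3)[OF f S hol u])
    fix z assume "z \<in> S"
    then obtain d where d: "d > 0" "cball z d \<subseteq> S" using S open_contains_cball by blast
    have "uniform_limit S (\<lambda>k z. f k (u z)) (\<lambda>z. g (u z)) sequentially"
      by (rule uniform_limit_compose'[OF lim]) (use u in auto)
    hence "uniform_limit (cball z d) (\<lambda>k z. f k (u z)) (\<lambda>z. g (u z)) sequentially"
      by (rule uniform_limit_on_subset[OF _ d(2)])
    thus "\<exists>d>0. cball z d \<subseteq> S \<and> uniform_limit (cball z d) (\<lambda>k z. f k (u z)) (\<lambda>z. g (u z)) sequentially"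
      using d by blast
  qed
qed

text \<open>With \<open>L'\<close> the inverse matrix, the equation \<open>\<sigma> x = y\<close>
  becomes the fixed point equation \<open>x = \<Lambda> y - T x\<close>, where
  \<open>\<Lambda>\<close> applies \<open>L'\<close> to \<open>y\<close> and \<open>T\<close>
  applies it to the part \<open>q\<close>. Near 0 the map \<open>T\<close> contracts. The Picard
  iterates are holomorphic in \<open>y\<close> and converge uniformly, which makes the inverse
  analytic.\<close>

theorem analytic_inverse_function:
  fixes \<sigma> :: "(nat \<Rightarrow> complex) \<Rightarrow> nat \<Rightarrow> complex"
  assumes q: "\<And>i. i < N \<Longrightarrow> in_max_sq N (q i)"
    and \<sigma>: "\<And>i x. i < N \<Longrightarrow> \<sigma> x i = (\<Sum>j<N. L i j * x j) + q i x"
    and L: "trivial_left_kernel N L"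
  shows "\<exists>\<sigma>'. space_diff N \<sigma> \<sigma>'"
proof -
  obtain L' where LL: "\<And>i v. i < N \<Longrightarrow> (\<Sum>j<N. L' i j * (\<Sum>k<N. L j k * v k)) = v i"
    "\<And>i v. i < N \<Longrightarrow> (\<Sum>j<N. L i j * (\<Sum>k<N. L' j k * v k)) = v i"
    using inverse_matrix_exists[OF L] by blast
  define T where "T = (\<lambda>i x. \<Sum>j<N. L' i j * q j x)"
  define \<Lambda> where "\<Lambda> = (\<lambda>i (y :: nat \<Rightarrow> complex). \<Sum>j<N. L' i j * y j)"
  define D where "D = (\<lambda>x y :: nat \<Rightarrow> complex. \<Sum>i<N. norm (x i - y i))"
  have D_nonneg: "D x y \<ge> 0" for x y unfolding D_def by (intro sum_nonneg) auto
  have D_ge: "norm (x i - y i) \<le> D x y" if "i < N" for x y i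
    unfolding D_def using that by (intro member_le_sum) auto
  have T: "in_max_sq N (T i)" for i
    unfolding T_def by (rule in_max_sq_linear_combination[OF q])
  have T0: "T i (\<lambda>_. 0) = 0" for i by (rule in_max_sq_zero[OF T])
  \<comment> \<open>The distance \<open>D\<close> sums over the coordinates. The constant
    \<open>1 / (2 * real (N + 1))\<close> for each component adds up to a contraction by at least
    the factor \<open>1 / 2\<close>.\<close>
  have "\<exists>s>0. \<forall>i<N. \<forall>x\<in>polydisc N s. \<forall>y\<in>polydisc N s.
      norm (T i x - T i y) \<le> 1 / (2 * real (N + 1)) * (\<Sum>i<N. norm (x i - y i))"
  proof (rule common_radius)
    show "\<exists>s>0. \<forall>x\<in>polydisc N s. \<forall>y\<in>polydisc N s.
      norm (T i x - T i y) \<le> 1 / (2 * real (N + 1)) * (\<Sum>i<N. norm (x i - y i))" for i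
      by (rule in_max_sq_lipschitz[OF T]) simp
  next
    fix i and s t :: real
    assume "\<forall>x\<in>polydisc N s. \<forall>y\<in>polydisc N s.
      norm (T i x - T i y) \<le> 1 / (2 * real (N + 1)) * (\<Sum>i<N. norm (x i - y i))" "t \<le> s"
    thus "\<forall>x\<in>polydisc N t. \<forall>y\<in>polydisc N t.
      norm (T i x - T i y) \<le> 1 / (2 * real (N + 1)) * (\<Sum>i<N. norm (x i - y i))"
      using polydisc_mono[of t s N] by blast
  qed
  then obtain s1 where s1: "s1 > 0" "\<And>i x y. i < N \<Longrightarrow> x \<in> polydisc N s1 \<Longrightarrow> y \<in> polydisc N s1 \<Longrightarrow>
      norm (T i x - T i y) \<le> 1 / (2 * real (N + 1)) * D x y"
    unfolding D_def by blast
  obtain s2 M where s2: "s2 > 0" "M > 0" "\<And>i. i < N \<Longrightarrow> hol_on_polydisc N s2 M (T i)"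
    using analytic_germ_family_hol_on_polydisc[where m = N and k = N and G = T, OF in_max_sq_analytic_germ[OF T]]
    by blast
  define s where "s = min s1 s2"
  have s: "s > 0" using s1 s2 by (simp add: s_def)
  have T_hol: "hol_on_polydisc N s M (T i)" if "i < N" for i
    by (rule hol_on_polydisc_mono[OF s2(3)[OF that]]) (auto simp: s_def)
  have T_lip: "norm (T i x - T i y) \<le> 1 / (2 * real (N + 1)) * D x y"
    if "i < N" "x \<in> polydisc N s" "y \<in> polydisc N s" for i x y
    using that polydisc_mono[of s s1 N] by (intro s1(2)) (auto simp: s_def)
  have T_contr: "(\<Sum>i<N. norm (T i x - T i y)) \<le> 1 / 2 * D x y"
    if "x \<in> polydisc N s" "y \<in> polydisc N s" for x y
  proof -
    have "(\<Sum>i<N. norm (T i x - T i y)) \<le> (\<Sum>i<N. 1 / (2 * real (N + 1)) * D x y)"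
      using that by (intro sum_mono T_lip) auto
    also have "\<dots> = real N / real (N + 1) * (1 / 2 * D x y)" by simp
    also have "\<dots> \<le> 1 * (1 / 2 * D x y)"
      using D_nonneg[of x y] by (intro mult_right_mono) auto
    finally show ?thesis by simp
  qed
  define K where "K = (\<Sum>i<N. \<Sum>j<N. norm (L' i j)) + 1"
  have K: "K > 0" unfolding K_def by (intro add_nonneg_pos sum_nonneg) auto
  \<comment> \<open>The radius makes \<open>\<Lambda> y\<close> at most \<open>s / 4\<close> in
    norm. Together with the contraction of points of norm at most \<open>s / 2\<close> this gives
    \<open>s / 4 + s / 4\<close>, so the iterates never leave the region where \<open>T\<close> is
    controlled.\<close>
  define r where "r = s / (4 * K)"
  have r: "r > 0" using s K by (simp add: r_def)
  have \<Lambda>_small: "(\<Sum>i<N. norm (\<Lambda> i y)) \<le> s / 4" if y: "y \<in> polydisc N r" for y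
  proof -
    have "(\<Sum>i<N. norm (\<Lambda> i y)) \<le> (\<Sum>i<N. \<Sum>j<N. norm (L' i j) * r)"
      unfolding \<Lambda>_def
    proof (intro sum_mono sum_norm_le)
      fix i j assume "j \<in> {..<N}"
      thus "norm (L' i j * y j) \<le> norm (L' i j) * r"
        unfolding norm_mult using y by (intro mult_left_mono) (auto simp: polydisc_def intro: less_imp_le)
    qed
    also have "\<dots> = (K - 1) * r" by (simp add: K_def sum_distrib_right)
    also have "\<dots> \<le> K * r" using r by (simp add: left_diff_distrib)
    also have "\<dots> = s / 4" using K by (simp add: r_def)
    finally show ?thesis .
  qed
  define X where "X = (\<lambda>y. rec_nat (\<lambda>_. 0) (\<lambda>_ x i. if i < N then \<Lambda> i y - T i x else 0))"
  have X_0: "X y 0 = (\<lambda>_. 0)" and X_Suc: "X y (Suc k) = (\<lambda>i. if i < N then \<Lambda> i y - T i (X y k) else 0)" for y k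
    unfolding X_def by simp_all
  have D0_in: "x \<in> polydisc N s" if "D x (\<lambda>_. 0) \<le> s / 2" for x
    unfolding polydisc_def
  proof (intro CollectI allI impI)
    fix i assume "i < N"
    from D_ge[OF this, of x "\<lambda>_. 0"] show "norm (x i) < s" using that s by simp
  qed
  have X_small: "D (X y k) (\<lambda>_. 0) \<le> s / 2" if y: "y \<in> polydisc N r" for y k
  proof (induction k)
    case 0
    show ?case using s by (simp add: X_0 D_def)
  next
    case (Suc k)
    have "D (X y (Suc k)) (\<lambda>_. 0) = (\<Sum>i<N. norm (\<Lambda> i y - (T i (X y k) - T i (\<lambda>_. 0))))"
      by (simp add: D_def X_Suc T0)
    also have "\<dots> \<le> (\<Sum>i<N. norm (\<Lambda> i y)) + (\<Sum>i<N. norm (T i (X y k) - T i (\<lambda>_. 0)))"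
      unfolding sum.distrib[symmetric] by (intro sum_mono norm_triangle_ineq4)
    also have "\<dots> \<le> s / 4 + 1 / 2 * D (X y k) (\<lambda>_. 0)"
      by (intro add_mono \<Lambda>_small[OF y] T_contr D0_in[OF Suc] zero_in_polydisc s)
    also have "\<dots> \<le> s / 4 + 1 / 2 * (s / 2)" using Suc by simp
    finally show ?case by simp
  qed
  have X_in: "X y k \<in> polydisc N s" if "y \<in> polydisc N r" for y k
    by (rule D0_in[OF X_small[OF that]])
  have X_step: "D (X y (Suc k)) (X y k) \<le> (1 / 2) ^ k * s" if y: "y \<in> polydisc N r" for y k
  proof (induction k)
    case 0
    show ?case using X_small[OF y, of 1] s by (simp add: X_0)
  next
    case (Suc k)
    have "D (X y (Suc (Suc k))) (X y (Suc k)) = (\<Sum>i<N. norm (T i (X y k) - T i (X y (Suc k))))"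
      unfolding D_def by (intro sum.cong refl) (simp add: X_Suc[of y "Suc k"] X_Suc[of y k])
    also have "\<dots> = (\<Sum>i<N. norm (T i (X y (Suc k)) - T i (X y k)))"
      by (simp add: norm_minus_commute)
    also have "\<dots> \<le> 1 / 2 * D (X y (Suc k)) (X y k)"
      by (intro T_contr X_in y)
    also have "\<dots> \<le> 1 / 2 * ((1 / 2) ^ k * s)" using Suc by simp
    finally show ?case by simp
  qed
  have X_hol: "hol_on_polydisc N r s (\<lambda>y. X y k i)" if i: "i < N" for k i
  proof (rule hol_on_polydiscI)
    fix y assume y: "y \<in> polydisc N r"
    show "norm (X y k i) \<le> s" using X_in[OF y, of k] i by (auto simp: polydisc_def intro: less_imp_le)
    fix y' assume yy': "\<And>i. i < N \<Longrightarrow> y i = y' i"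
    have eq: "\<Lambda> i y = \<Lambda> i y'" for i unfolding \<Lambda>_def using yy' by (intro sum.cong) auto
    have "X y k = X y' k" by (induction k) (simp_all only: X_0 X_Suc eq)
    thus "X y k i = X y' k i" by simp
  next
    fix u :: "complex \<Rightarrow> nat \<Rightarrow> complex" and S
    assume S: "open S" and hol: "\<And>i. i < N \<Longrightarrow> (\<lambda>z. u z i) holomorphic_on S"
      and u: "\<And>z. z \<in> S \<Longrightarrow> u z \<in> polydisc N r"
    have "(\<lambda>z. X (u z) k i) holomorphic_on S" if "i < N" for i
      using that
    proof (induction k arbitrary: i)
      case (Suc k)
      have "(\<lambda>z. T i (X (u z) k)) holomorphic_on S"
        by (rule hol_on_polydiscD(3)[OF T_hol[OF Suc.prems] S Suc.IH X_in[OF u]])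
      thus ?case using Suc.prems unfolding X_Suc \<Lambda>_def
        by (auto intro!: holomorphic_intros hol)
    qed (simp add: X_0)
    thus "(\<lambda>z. X (u z) k i) holomorphic_on S" using i .
  qed
  \<comment> \<open>The limit is written as the sum of the successive differences, so that the
    geometric bound \<open>X_step\<close> yields uniform convergence by the M-test.\<close>
  define Y where "Y = (\<lambda>y i. \<Sum>k. X y (Suc k) i - X y k i)"
  have telescope: "(\<Sum>k<n. X y (Suc k) i - X y k i) = X y n i" for y n i
    using sum_lessThan_telescope[of "\<lambda>k. X y k i" n] by (simp add: X_0)
  have Y_lim: "uniform_limit (polydisc N r) (\<lambda>k y. X y k i) (\<lambda>y. Y y i) sequentially" if i: "i < N" for i
  proof -
    have "uniform_limit (polydisc N r) (\<lambda>n y. \<Sum>k<n. X y (Suc k) i - X y k i) (\<lambda>y. Y y i) sequentially"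
      unfolding Y_def
    proof (rule Weierstrass_m_test)
      show "norm (X y (Suc k) i - X y k i) \<le> (1 / 2) ^ k * s" if "y \<in> polydisc N r" for k y
        using D_ge[OF i, of "X y (Suc k)" "X y k"] X_step[OF that, of k] by linarith
      show "summable (\<lambda>k. (1 / 2) ^ k * s)"
        by (intro summable_mult2 summable_geometric) simp
    qed
    thus ?thesis unfolding telescope .
  qed
  have Y_hol: "hol_on_polydisc N r s (\<lambda>y. Y y i)" if "i < N" for i
    by (rule hol_on_polydisc_uniform_limit[OF X_hol[OF that] Y_lim[OF that]])
  have X_tendsto: "(\<lambda>k. X y k i) \<longlonglongrightarrow> Y y i" if "i < N" "y \<in> polydisc N r" for y i
    using tendsto_uniform_limitI[OF Y_lim[OF that(1)] that(2)] .
  have Y_small: "D (Y y) (\<lambda>_. 0) \<le> s / 2" if y: "y \<in> polydisc N r" for y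
  proof (rule Lim_bounded)
    show "(\<lambda>k. D (X y k) (\<lambda>_. 0)) \<longlonglongrightarrow> D (Y y) (\<lambda>_. 0)"
      unfolding D_def by (intro tendsto_intros X_tendsto y) auto
    show "\<forall>k\<ge>0. D (X y k) (\<lambda>_. 0) \<le> s / 2" using X_small[OF y] by simp
  qed
  have Y_in: "Y y \<in> polydisc N s" if "y \<in> polydisc N r" for y
    by (rule D0_in[OF Y_small[OF that]])
  have Y_fix: "Y y i = \<Lambda> i y - T i (Y y)" if i: "i < N" and y: "y \<in> polydisc N r" for y i
  proof (rule LIMSEQ_unique)
    show "(\<lambda>k. X y (Suc k) i) \<longlonglongrightarrow> Y y i"
      by (rule LIMSEQ_Suc[OF X_tendsto[OF i y]])
    have "(\<lambda>k. T i (X y k) - T i (Y y)) \<longlonglongrightarrow> 0"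
    proof (rule Lim_null_comparison)
      show "\<forall>\<^sub>F k in sequentially. norm (T i (X y k) - T i (Y y)) \<le> 1 / (2 * real (N + 1)) * D (X y k) (Y y)"
        by (intro always_eventually allI T_lip i X_in Y_in y)
      have "(\<lambda>k. 1 / (2 * real (N + 1)) * D (X y k) (Y y)) \<longlonglongrightarrow> 1 / (2 * real (N + 1)) * D (Y y) (Y y)"
        unfolding D_def by (intro tendsto_intros X_tendsto y) auto
      thus "(\<lambda>k. 1 / (2 * real (N + 1)) * D (X y k) (Y y)) \<longlonglongrightarrow> 0" by (simp add: D_def)
    qed
    hence "(\<lambda>k. T i (X y k)) \<longlonglongrightarrow> T i (Y y)" by (simp add: LIM_zero_iff)
    hence "(\<lambda>k. \<Lambda> i y - T i (X y k)) \<longlonglongrightarrow> \<Lambda> i y - T i (Y y)" by (intro tendsto_intros)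
    thus "(\<lambda>k. X y (Suc k) i) \<longlonglongrightarrow> \<Lambda> i y - T i (Y y)" using i by (simp add: X_Suc)
  qed
  have right: "\<sigma> (Y y) i = y i" if i: "i < N" and y: "y \<in> polydisc N r" for y i
  proof -
    have "\<sigma> (Y y) i = (\<Sum>j<N. L i j * Y y j) + q i (Y y)" by (rule \<sigma>[OF i])
    also have "(\<Sum>j<N. L i j * Y y j) = (\<Sum>j<N. L i j * (\<Sum>k<N. L' j k * (y k - q k (Y y))))"
    proof (intro sum.cong refl)
      fix j assume "j \<in> {..<N}"
      hence "Y y j = \<Lambda> j y - T j (Y y)" using Y_fix y by simp
      also have "\<dots> = (\<Sum>k<N. L' j k * (y k - q k (Y y)))"
        by (simp add: \<Lambda>_def T_def right_diff_distrib sum_subtractf)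
      finally show "L i j * Y y j = L i j * (\<Sum>k<N. L' j k * (y k - q k (Y y)))" by simp
    qed
    also have "\<dots> = y i - q i (Y y)" by (rule LL(2)[OF i])
    finally show ?thesis by simp
  qed
  have \<sigma>_germ: "analytic_germ N (\<lambda>x. \<sigma> x i)" if i: "i < N" for i
  proof -
    have "analytic_germ N (\<lambda>x. (\<Sum>j<N. L i j * x j) + q i x)"
      by (intro analytic_germ_add analytic_germ_sum analytic_germ_mult analytic_germ_const
            analytic_germ_coord in_max_sq_analytic_germ q i) auto
    thus ?thesis using \<sigma>[OF i] by simp
  qed
  have \<sigma>_0: "\<sigma> (\<lambda>_. 0) i = 0" if "i < N" for i
    using \<sigma>[OF that] in_max_sq_zero[OF q[OF that]] by simp
  obtain t where t: "t > 0" "\<And>x. x \<in> polydisc N t \<Longrightarrow> (\<lambda>i. \<sigma> x i) \<in> polydisc N r"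
    using analytic_germ_family_maps_into[where G = "\<lambda>i x. \<sigma> x i" and m = N and k = N, OF \<sigma>_germ \<sigma>_0 r]
    by blast
  \<comment> \<open>Both \<open>x\<close> and \<open>Y (\<sigma> x)\<close> are fixed points of the
    same contraction, so their distance is at most half of itself.\<close>
  have left: "Y (\<sigma> x) i = x i" if x: "x \<in> polydisc N (min t s)" and i: "i < N" for x i
  proof -
    have xs: "x \<in> polydisc N s" and xt: "x \<in> polydisc N t"
      using x polydisc_mono[of "min t s" s N] polydisc_mono[of "min t s" t N] by auto
    have \<sigma>x: "\<sigma> x \<in> polydisc N r" using t(2)[OF xt] .
    have fixpt: "x i = \<Lambda> i (\<sigma> x) - T i x" if "i < N" for i
    proof -
      have "\<Lambda> i (\<sigma> x) - T i x = (\<Sum>j<N. L' i j * (\<sigma> x j - q j x))"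
        by (simp add: \<Lambda>_def T_def right_diff_distrib sum_subtractf)
      also have "\<dots> = (\<Sum>j<N. L' i j * (\<Sum>k<N. L j k * x k))"
        by (intro sum.cong refl) (simp add: \<sigma>)
      also have "\<dots> = x i" by (rule LL(1)[OF that])
      finally show ?thesis by simp
    qed
    have "D (Y (\<sigma> x)) x = (\<Sum>i<N. norm (T i x - T i (Y (\<sigma> x))))"
      unfolding D_def
    proof (intro sum.cong refl arg_cong[of _ _ norm])
      fix i assume "i \<in> {..<N}"
      hence "i < N" by simp
      from Y_fix[OF this \<sigma>x] fixpt[OF this]
      show "Y (\<sigma> x) i - x i = T i x - T i (Y (\<sigma> x))" by (simp only:) simp
    qed
    also have "\<dots> \<le> 1 / 2 * D x (Y (\<sigma> x))" by (intro T_contr xs Y_in \<sigma>x)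
    also have "D x (Y (\<sigma> x)) = D (Y (\<sigma> x)) x" by (simp add: D_def norm_minus_commute)
    finally have "D (Y (\<sigma> x)) x \<le> 0" by simp
    with D_ge[OF i, of "Y (\<sigma> x)" x] have "norm (Y (\<sigma> x) i - x i) \<le> 0" by linarith
    thus ?thesis by simp
  qed
  have "Y (\<lambda>_. 0) i = 0" if i: "i < N" for i
  proof -
    have "X (\<lambda>_. 0) k = (\<lambda>_. 0)" for k
      by (induction k) (auto simp: X_0 X_Suc T0 \<Lambda>_def)
    thus ?thesis by (simp add: Y_def)
  qed
  moreover have "\<exists>d>0. \<forall>x\<in>polydisc N d. \<forall>i<N. \<sigma> (Y x) i = x i \<and> Y (\<sigma> x) i = x i"
  proof (intro exI[of _ "min r (min t s)"] conjI ballI allI impI)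
    show "min r (min t s) > 0" using r s t by simp
    fix x i assume x: "x \<in> polydisc N (min r (min t s))" and i: "i < N"
    show "\<sigma> (Y x) i = x i"
      by (rule right[OF i]) (use x polydisc_mono[of "min r (min t s)" r N] in auto)
    show "Y (\<sigma> x) i = x i"
      by (rule left[OF _ i]) (use x polydisc_mono[of "min r (min t s)" "min t s" N] min.cobounded2 in blast)
  qed
  ultimately have "space_diff N \<sigma> Y"
    unfolding space_diff_def
    using \<sigma>_germ \<sigma>_0 hol_on_polydisc_imp_analytic_germ[OF Y_hol r] by blast
  thus ?thesis by blast
qed

subsection \<open>The ring of a parametrized curve\<close>

unbundle no vec_syntax
unbundle fps_syntax

section \<open>Germs in one variable and their expansions\<close>

lemma has_fps_expansion_unique_eventually:
  fixes f g :: "complex \<Rightarrow> complex"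
  assumes "f has_fps_expansion F" "g has_fps_expansion F"
  shows "\<forall>\<^sub>F t in nhds 0. f t = g t"
  using assms unfolding has_fps_expansion_def by (auto elim: eventually_elim2)

lemma has_fps_expansion_eqI:
  fixes f g :: "complex \<Rightarrow> complex"
  assumes "f has_fps_expansion F" "g has_fps_expansion G" "\<forall>\<^sub>F t in nhds 0. f t = g t"
  shows "F = G"
  using assms has_fps_expansion_cong[OF assms(3) refl, of F] fps_expansion_unique_complex by blast

lemma germ_ord_has_fps_expansion:
  assumes "f has_fps_expansion F"
  shows "germ_ord f = (if F = 0 then \<infinity> else enat (subdegree F))"
proof -
  have "(\<forall>\<^sub>F t in nhds 0. f t = 0) \<longleftrightarrow> F = 0"
    using has_fps_expansion_0_iff[of f] assms fps_expansion_unique_complex by blast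
  thus ?thesis by (simp add: germ_ord_def fps_expansion_eqI[OF assms])
qed

lemma eventually_nhds_0_compose:
  fixes g :: "complex \<Rightarrow> complex"
  assumes "eventually P (nhds 0)" "isCont g 0" "g 0 = 0"
  shows "\<forall>\<^sub>F t in nhds 0. P (g t)"
proof -
  have "filterlim g (nhds 0) (nhds 0)"
    using assms(2,3) by (metis isCont_def tendsto_at_iff_tendsto_nhds)
  with assms(1) show ?thesis by (simp add: filterlim_iff)
qed

lemma eventually_nhds_0_compose_fps:
  fixes g :: "complex \<Rightarrow> complex"
  assumes "eventually P (nhds 0)" "g has_fps_expansion G" "G $ 0 = 0"
  shows "\<forall>\<^sub>F t in nhds 0. P (g t)"
proof (rule eventually_nhds_0_compose[OF assms(1)])
  show "isCont g 0" using has_fps_expansion_imp_continuous[OF assms(2), of UNIV] by simp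
  show "g 0 = 0" using has_fps_expansion_imp_0_eq_fps_nth_0[OF assms(2)] assms(3) by simp
qed

lemma has_fps_expansion_scale:
  fixes f :: "complex \<Rightarrow> complex"
  assumes "f has_fps_expansion F"
  shows "(\<lambda>t. f (c * t)) has_fps_expansion (F oo (fps_const c * fps_X))"
proof -
  have "(\<lambda>t. c * t) has_fps_expansion (fps_const c * fps_X)" by (intro fps_expansion_intros)
  from has_fps_expansion_compose[OF assms this] show ?thesis by (simp add: o_def)
qed

text \<open>Convergence at \<open>w\<close> bounds \<open>norm (F $ n) * w ^ n\<close> by a
  constant. At the point \<open>w ^ k / 2\<close> the section is then dominated by a geometric
  series of ratio \<open>1 / 2\<close>.\<close>

lemma fps_conv_radius_section:
  fixes F :: "complex fps"
  assumes "fps_conv_radius F > 0" "k > 0"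
  shows "fps_conv_radius (Abs_fps (\<lambda>j. F $ (k * j))) > 0"
proof -
  obtain w where w: "w > 0" "ereal w < fps_conv_radius F"
    using ereal_dense2[OF assms(1)] by (metis ereal_less(2) less_ereal.simps(1) zero_ereal_def)
  have "summable (\<lambda>n. norm (F $ n * of_real w ^ n))"
    using abs_summable_in_conv_radius[of "of_real w :: complex" "fps_nth F"] w by (simp add: fps_conv_radius_def)
  hence "(\<lambda>n. norm (F $ n * of_real w ^ n)) \<longlonglongrightarrow> 0" by (rule summable_LIMSEQ_zero)
  hence "Bseq (\<lambda>n. norm (F $ n * of_real w ^ n))" by (rule convergent_imp_Bseq[OF convergentI])
  then obtain C where C: "\<And>n. norm (F $ n) * w ^ n \<le> C"
    using w by (auto simp: Bseq_def norm_mult norm_power)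
  define z :: complex where "z = of_real (w ^ k / 2)"
  have "summable (\<lambda>j. F $ (k * j) * z ^ j)"
  proof (rule summable_comparison_test')
    show "summable (\<lambda>j. C * (1 / 2) ^ j)" by (intro summable_mult summable_geometric) simp
    show "norm (F $ (k * j) * z ^ j) \<le> C * (1 / 2) ^ j" for j
    proof -
      have "norm (F $ (k * j) * z ^ j) = norm (F $ (k * j)) * w ^ (k * j) * (1 / 2) ^ j"
        using w unfolding z_def norm_mult norm_power norm_of_real
        by (simp add: power_mult power_divide)
      also have "\<dots> \<le> C * (1 / 2) ^ j" by (intro mult_right_mono C) auto
      finally show ?thesis .
    qed
  qed
  hence "norm z \<le> fps_conv_radius (Abs_fps (\<lambda>j. F $ (k * j)))"
    unfolding fps_conv_radius_def by (intro conv_radius_geI) simp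
  moreover have "ereal (norm z) > 0" using w by (simp add: z_def norm_power norm_divide norm_mult)
  ultimately show ?thesis by (metis less_le_trans)
qed

lemma fps_section_compose:
  fixes F :: "complex fps"
  assumes "k > 0" "\<And>j. F $ j \<noteq> 0 \<Longrightarrow> k dvd j"
  shows "Abs_fps (\<lambda>j. F $ (k * j)) oo fps_X ^ k = F"
proof (rule fps_ext)
  fix n
  have "(Abs_fps (\<lambda>j. F $ (k * j)) oo fps_X ^ k) $ n = (\<Sum>i=0..n. F $ (k * i) * (if n = k * i then 1 else 0))"
    unfolding fps_compose_nth by (simp add: power_mult[symmetric] fps_X_power_nth)
  also have "\<dots> = F $ n"
  proof (cases "k dvd n")
    case True
    then obtain j where j: "n = k * j" by auto
    have "(\<Sum>i=0..n. F $ (k * i) * (if n = k * i then 1 else 0)) = (\<Sum>i=0..n. if i = j then F $ (k * j) else 0)"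
      using assms(1) by (intro sum.cong refl) (auto simp: j)
    also have "\<dots> = F $ n" using assms(1) by (simp add: j)
    finally show ?thesis .
  next
    case False
    hence "F $ n = 0" using assms(2) by blast
    moreover have "(\<Sum>i=0..n. F $ (k * i) * (if n = k * i then 1 else 0)) = 0"
      using False by (intro sum.neutral) auto
    ultimately show ?thesis by simp
  qed
  finally show "(Abs_fps (\<lambda>j. F $ (k * j)) oo fps_X ^ k) $ n = F $ n" .
qed

text \<open>Invariance means \<open>\<zeta> ^ j * F $ j = F $ j\<close> for all \<open>j\<close>, so
  only exponents with \<open>\<zeta> ^ j = 1\<close> occur, and these are multiples of
  \<open>k\<close>.\<close>

lemma rotation_invariant_factor:
  assumes f: "f analytic_on {0}" and inv: "\<forall>\<^sub>F t in nhds 0. f (\<zeta> * t) = f t"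
    and k: "k > 0" "\<And>j. \<zeta> ^ j = 1 \<Longrightarrow> k dvd j"
  shows "\<exists>B. B analytic_on {0} \<and> (\<forall>\<^sub>F t in nhds 0. f t = B (t ^ k))"
proof -
  define F where "F = fps_expansion f 0"
  have F: "f has_fps_expansion F" unfolding F_def by (rule analytic_at_imp_has_fps_expansion_0[OF f])
  have "F oo (fps_const \<zeta> * fps_X) = F"
    by (rule has_fps_expansion_eqI[OF has_fps_expansion_scale[OF F] F inv])
  hence "\<zeta> ^ j * F $ j = F $ j" for j
    by (metis fps_compose_linear fps_nth_Abs_fps)
  hence dv: "k dvd j" if "F $ j \<noteq> 0" for j
    using that k(2)[of j] by (metis mult_cancel_right1)
  define G where "G = Abs_fps (\<lambda>j. F $ (k * j))"
  have G: "eval_fps G has_fps_expansion G"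
    unfolding G_def using F k(1)
    by (intro eval_fps_has_fps_expansion fps_conv_radius_section) (auto simp: has_fps_expansion_def)
  have "(eval_fps G \<circ> (\<lambda>t. t ^ k)) has_fps_expansion (G oo fps_X ^ k)"
    by (rule has_fps_expansion_compose[OF G]) (use k in \<open>auto intro!: fps_expansion_intros\<close>)
  also have "G oo fps_X ^ k = F" unfolding G_def by (rule fps_section_compose[OF k(1) dv])
  finally have "\<forall>\<^sub>F t in nhds 0. f t = eval_fps G (t ^ k)"
    using has_fps_expansion_unique_eventually[OF F] by (simp add: o_def)
  thus ?thesis using has_fps_expansion_imp_analytic_0[OF G] by blast
qed

text \<open>The ring of the curve, as a set of formal expansions instead of germs. Equality of germs
  becomes equality, and the order of a nonzero element is its \<open>subdegree\<close>; since
  \<open>subdegree 0 = 0\<close>, the zero series is removed whenever values are taken.\<close>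

definition germ_ring :: "nat \<Rightarrow> (complex \<Rightarrow> nat \<Rightarrow> complex) \<Rightarrow> complex fps set" where
  "germ_ring m \<phi> = {F. \<exists>g. analytic_germ m g \<and> (\<lambda>t. g (\<phi> t)) has_fps_expansion F}"

lemma germ_ringI: "analytic_germ m g \<Longrightarrow> (\<lambda>t. g (\<phi> t)) has_fps_expansion F \<Longrightarrow> F \<in> germ_ring m \<phi>"
  unfolding germ_ring_def by blast

lemma germ_ring_convergent: "F \<in> germ_ring m \<phi> \<Longrightarrow> fps_conv_radius F > 0"
  unfolding germ_ring_def by (auto simp: has_fps_expansion_def)

lemma germ_ring_expansion:
  assumes "parametrization m \<phi>" "analytic_germ m g"
  shows "(\<lambda>t. g (\<phi> t)) has_fps_expansion fps_expansion (\<lambda>t. g (\<phi> t)) 0"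
  by (rule analytic_at_imp_has_fps_expansion_0[OF analytic_germ_along_curve[OF assms(2,1)]])

lemma germ_ring_const [simp]: "fps_const c \<in> germ_ring m \<phi>"
  by (rule germ_ringI[OF analytic_germ_const[of m c]]) (auto intro: fps_expansion_intros)

lemma germ_ring_zero [simp]: "0 \<in> germ_ring m \<phi>"
  using germ_ring_const[of 0] by simp

lemma germ_ring_add:
  assumes "F \<in> germ_ring m \<phi>" "G \<in> germ_ring m \<phi>"
  shows "F + G \<in> germ_ring m \<phi>"
proof -
  obtain f g where "analytic_germ m f" "(\<lambda>t. f (\<phi> t)) has_fps_expansion F"
    and "analytic_germ m g" "(\<lambda>t. g (\<phi> t)) has_fps_expansion G"
    using assms by (auto simp: germ_ring_def)
  thus ?thesis
    by (intro germ_ringI[of m "\<lambda>x. f x + g x"] analytic_germ_add has_fps_expansion_add)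
qed

lemma germ_ring_mult:
  assumes "F \<in> germ_ring m \<phi>" "G \<in> germ_ring m \<phi>"
  shows "F * G \<in> germ_ring m \<phi>"
proof -
  obtain f g where "analytic_germ m f" "(\<lambda>t. f (\<phi> t)) has_fps_expansion F"
    and "analytic_germ m g" "(\<lambda>t. g (\<phi> t)) has_fps_expansion G"
    using assms by (auto simp: germ_ring_def)
  thus ?thesis
    by (intro germ_ringI[of m "\<lambda>x. f x * g x"] analytic_germ_mult has_fps_expansion_mult)
qed

lemma germ_ring_diff:
  assumes "F \<in> germ_ring m \<phi>" "G \<in> germ_ring m \<phi>"
  shows "F - G \<in> germ_ring m \<phi>"
proof -
  obtain f g where "analytic_germ m f" "(\<lambda>t. f (\<phi> t)) has_fps_expansion F"
    and "analytic_germ m g" "(\<lambda>t. g (\<phi> t)) has_fps_expansion G"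
    using assms by (auto simp: germ_ring_def)
  thus ?thesis
    by (intro germ_ringI[of m "\<lambda>x. f x - g x"] analytic_germ_diff has_fps_expansion_diff)
qed

lemma germ_ring_sum: "(\<And>i. i \<in> I \<Longrightarrow> F i \<in> germ_ring m \<phi>) \<Longrightarrow> (\<Sum>i\<in>I. F i) \<in> germ_ring m \<phi>"
  by (induction I rule: infinite_finite_induct) (auto intro: germ_ring_add)

lemma germ_ring_power: "F \<in> germ_ring m \<phi> \<Longrightarrow> F ^ k \<in> germ_ring m \<phi>"
  using germ_ring_const[of 1] by (induction k) (auto intro: germ_ring_mult)

lemma germ_ring_coord:
  assumes "i < m" "(\<lambda>t. \<phi> t i) has_fps_expansion F"
  shows "F \<in> germ_ring m \<phi>"
  by (rule germ_ringI[of m "\<lambda>x. x i"]) (use assms in \<open>auto intro: analytic_germ_coord\<close>)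

lemma value_set_germ_ring:
  assumes "parametrization m \<phi>"
  shows "value_set m \<phi> = subdegree ` (germ_ring m \<phi> - {0})"
proof (intro equalityI subsetI)
  fix k assume "k \<in> value_set m \<phi>"
  then obtain g where g: "analytic_germ m g" "germ_ord (\<lambda>t. g (\<phi> t)) = enat k"
    by (auto simp: value_set_def)
  let ?F = "fps_expansion (\<lambda>t. g (\<phi> t)) 0"
  have F: "(\<lambda>t. g (\<phi> t)) has_fps_expansion ?F" by (rule germ_ring_expansion[OF assms g(1)])
  have "?F \<noteq> 0" "subdegree ?F = k"
    using germ_ord_has_fps_expansion[OF F] g(2) by (auto split: if_splits)
  thus "k \<in> subdegree ` (germ_ring m \<phi> - {0})" using germ_ringI[OF g(1) F] by blast
next
  fix k assume "k \<in> subdegree ` (germ_ring m \<phi> - {0})"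
  then obtain F g where F: "F \<noteq> 0" "k = subdegree F" "analytic_germ m g" "(\<lambda>t. g (\<phi> t)) has_fps_expansion F"
    by (auto simp: germ_ring_def)
  thus "k \<in> value_set m \<phi>"
    using germ_ord_has_fps_expansion[OF F(4)] by (auto simp: value_set_def)
qed

lemma parametrization_compose:
  assumes "parametrization m \<phi>" "\<rho> has_fps_expansion P" "P $ 0 = 0"
  shows "parametrization m (\<lambda>t. \<phi> (\<rho> t))"
proof -
  have an: "\<rho> analytic_on {0}" and 0: "\<rho> 0 = 0"
    using has_fps_expansion_imp_analytic_0[OF assms(2)] has_fps_expansion_imp_0_eq_fps_nth_0[OF assms(2)] assms(3)
    by simp_all
  have "(\<lambda>t. \<phi> (\<rho> t) i) analytic_on {0}" if "i < m" for i
    using analytic_on_compose[OF an, of "\<lambda>t. \<phi> t i"] assms(1) that 0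
    by (simp add: o_def parametrization_def)
  thus ?thesis using assms(1) 0 by (simp add: parametrization_def)
qed

lemma germ_ring_compose:
  assumes "parametrization m \<phi>" "\<rho> has_fps_expansion P" "P $ 0 = 0"
  shows "germ_ring m (\<lambda>t. \<phi> (\<rho> t)) = (\<lambda>F. F oo P) ` germ_ring m \<phi>"
proof (intro equalityI subsetI)
  fix G assume "G \<in> germ_ring m (\<lambda>t. \<phi> (\<rho> t))"
  then obtain g where g: "analytic_germ m g" "(\<lambda>t. g (\<phi> (\<rho> t))) has_fps_expansion G"
    by (auto simp: germ_ring_def)
  let ?F = "fps_expansion (\<lambda>t. g (\<phi> t)) 0"
  have F: "(\<lambda>t. g (\<phi> t)) has_fps_expansion ?F" by (rule germ_ring_expansion[OF assms(1) g(1)])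
  have "(\<lambda>t. g (\<phi> (\<rho> t))) has_fps_expansion (?F oo P)"
    using has_fps_expansion_compose[OF F assms(2,3)] by (simp add: o_def)
  with g(2) have "G = ?F oo P" by (rule fps_expansion_unique_complex)
  thus "G \<in> (\<lambda>F. F oo P) ` germ_ring m \<phi>" using germ_ringI[OF g(1) F] by blast
next
  fix G assume "G \<in> (\<lambda>F. F oo P) ` germ_ring m \<phi>"
  then obtain F g where F: "G = F oo P" "analytic_germ m g" "(\<lambda>t. g (\<phi> t)) has_fps_expansion F"
    by (auto simp: germ_ring_def)
  show "G \<in> germ_ring m (\<lambda>t. \<phi> (\<rho> t))"
    unfolding F(1)
  proof (rule germ_ringI[OF F(2)])
    show "(\<lambda>t. g (\<phi> (\<rho> t))) has_fps_expansion (F oo P)"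
      using has_fps_expansion_compose[OF F(3) assms(2,3)] by (simp add: o_def)
  qed
qed

section \<open>Changes of the parameter\<close>

lemma line_diff_sym: "line_diff \<rho> \<rho>' \<Longrightarrow> line_diff \<rho>' \<rho>"
  unfolding line_diff_def by (simp add: conj_commute)

lemma local_inverse_exists:
  assumes f: "f has_fps_expansion F" and F: "F $ 0 = 0" "F $ 1 \<noteq> 0"
  shows "\<exists>h. line_diff f h"
proof -
  have an: "f analytic_on {0}" and f0: "f 0 = 0"
    using has_fps_expansion_imp_analytic_0[OF f] has_fps_expansion_imp_0_eq_fps_nth_0[OF f] F(1) by simp_all
  then obtain e where e: "e > 0" "f holomorphic_on ball 0 e" by (auto simp: analytic_on_def)
  have "deriv f 0 = F $ 1" using fps_nth_fps_expansion[OF f, of 1] by simp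
  hence d: "deriv f 0 \<noteq> 0" using F by simp
  have z: "0 \<in> ball (0::complex) e" using e(1) by simp
  obtain r where r: "r > 0" "ball (0::complex) r \<subseteq> ball 0 e" "inj_on f (ball 0 r)"
    by (rule has_complex_derivative_locally_injective[OF e(2) z open_ball d]) (rule that)
  have hol: "f holomorphic_on ball 0 r" by (rule holomorphic_on_subset[OF e(2) r(2)])
  obtain h where h: "h holomorphic_on (f ` ball 0 r)" "\<And>z. z \<in> ball 0 r \<Longrightarrow> h (f z) = z"
    by (rule holomorphic_has_inverse[OF hol open_ball r(3)]) (rule that; simp)
  have op: "open (f ` ball 0 r)" by (rule open_mapping_thm3[OF hol open_ball r(3)])
  have in0: "0 \<in> f ` ball 0 r" using f0 r(1) by (intro image_eqI[of _ _ 0]) auto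
  have "h analytic_on f ` ball 0 r" unfolding analytic_on_open[OF op] by (rule h(1))
  hence "h analytic_on {0}" by (rule analytic_on_subset) (use in0 in simp)
  moreover have "h 0 = 0" using h(2)[of 0] f0 r(1) by simp
  moreover have "\<forall>\<^sub>F t in nhds 0. t \<in> f ` ball 0 r" by (rule eventually_nhds_in_open[OF op in0])
  hence "\<forall>\<^sub>F t in nhds 0. f (h t) = t" by eventually_elim (use h(2) in auto)
  moreover have "\<forall>\<^sub>F t in nhds 0. h (f t) = t"
    using eventually_nhds_in_open[OF open_ball, of 0 0 r] r(1) by (auto elim!: eventually_mono simp: h(2))
  ultimately show ?thesis using an f0 unfolding line_diff_def
    by (intro exI[of _ h]) (auto elim: eventually_elim2)
qed

lemma line_diff_expansion:
  assumes "line_diff f h" "f has_fps_expansion F" "h has_fps_expansion H"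
  shows "F $ 0 = 0" "H $ 0 = 0" "F oo H = fps_X" "H oo F = fps_X" "F $ 1 * H $ 1 = 1"
proof -
  show F0: "F $ 0 = 0" and H0: "H $ 0 = 0"
    using assms(1) has_fps_expansion_imp_0_eq_fps_nth_0[OF assms(2)] has_fps_expansion_imp_0_eq_fps_nth_0[OF assms(3)]
    by (simp_all add: line_diff_def)
  show FH: "F oo H = fps_X"
  proof (rule has_fps_expansion_eqI)
    show "(f \<circ> h) has_fps_expansion (F oo H)" by (rule has_fps_expansion_compose[OF assms(2,3) H0])
    show "\<forall>\<^sub>F t in nhds 0. (f \<circ> h) t = t"
      using assms(1) by (auto simp: line_diff_def elim: eventually_mono)
  qed (rule has_fps_expansion_fps_X)
  show "H oo F = fps_X"
  proof (rule has_fps_expansion_eqI)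
    show "(h \<circ> f) has_fps_expansion (H oo F)" by (rule has_fps_expansion_compose[OF assms(3,2) F0])
    show "\<forall>\<^sub>F t in nhds 0. (h \<circ> f) t = t"
      using assms(1) by (auto simp: line_diff_def elim: eventually_mono)
  qed (rule has_fps_expansion_fps_X)
  have "(F oo H) $ 1 = F $ 1 * H $ 1" using F0 by (simp add: fps_compose_nth)
  thus "F $ 1 * H $ 1 = 1" unfolding FH by simp
qed

text \<open>Write \<open>U = V * fps_X ^ N\<close> with \<open>V $ 0 = a\<close> nonzero. An
  \<open>N\<close>-th root \<open>S\<close> of \<open>U\<close> is \<open>b * t\<close> times a root
  of \<open>V / a\<close>, where \<open>b ^ N = a\<close>, and \<open>Q\<close> is the compositional
  inverse of \<open>S\<close>. For leading coefficient 1 the choice of \<open>b\<close> gives 1, so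
  \<open>Q\<close> is tangent to the identity, as the later elimination requires.\<close>

lemma root_parameter:
  fixes U :: "complex fps"
  assumes U: "fps_conv_radius U > 0" "U \<noteq> 0" "subdegree U = N" and N: "N > 0"
  shows "\<exists>Q. fps_conv_radius Q > 0 \<and> Q $ 0 = 0 \<and> Q $ 1 \<noteq> 0 \<and> (U $ N = 1 \<longrightarrow> Q $ 1 = 1) \<and>
    U oo Q = fps_X ^ N"
proof -
  define a where "a = U $ N"
  have a: "a \<noteq> 0" using U by (auto simp: a_def)
  define V where "V = fps_shift N U"
  have UV: "U = V * fps_X ^ N" unfolding V_def using subdegree_decompose'[of N U] U(3) by simp
  define v where "v = eval_fps V"
  have "(\<lambda>t. if t = 0 then U $ N else eval_fps U t / t ^ N) has_fps_expansion V"
    unfolding V_def by (intro has_fps_expansion_shift eval_fps_has_fps_expansion U(1)) (use U(3) in auto)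
  hence v: "v has_fps_expansion V"
    unfolding v_def by (intro eval_fps_has_fps_expansion) (simp add: has_fps_expansion_def)
  have v0: "v 0 = a" using has_fps_expansion_imp_0_eq_fps_nth_0[OF v] by (simp add: V_def a_def)
  define b where "b = exp (Ln a / of_nat N)"
  have b: "b ^ N = a" using N a by (simp add: b_def exp_of_nat_mult[symmetric])
  \<comment> \<open>The division by \<open>a\<close> places the argument of \<open>Ln\<close> near
    1, away from the branch cut.\<close>
  define w where "w = (\<lambda>t. exp (Ln (v t / a) / of_nat N))"
  have an: "(\<lambda>t. v t / a) analytic_on {0}"
    by (intro analytic_intros has_fps_expansion_imp_analytic_0[OF v]) (use a in auto)
  have "w analytic_on {0}"
    unfolding w_def by (intro analytic_intros an) (use v0 a N in auto)
  hence W: "w has_fps_expansion fps_expansion w 0" (is "_ has_fps_expansion ?W")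
    by (rule analytic_at_imp_has_fps_expansion_0)
  have W0: "?W $ 0 = 1" using has_fps_expansion_imp_0_eq_fps_nth_0[OF W] a v0 by (simp add: w_def)
  define S where "S = fps_const b * fps_X * ?W"
  have s: "(\<lambda>t. b * t * w t) has_fps_expansion S"
    unfolding S_def by (intro fps_expansion_intros W)
  have S: "S $ 0 = 0" "S $ 1 = b" using W0 by (simp_all add: S_def mult.assoc)
  have b0: "b \<noteq> 0" by (simp add: b_def)
  then obtain h where h: "line_diff (\<lambda>t. b * t * w t) h" using local_inverse_exists[OF s] S by auto
  hence "h analytic_on {0}" by (simp add: line_diff_def)
  hence Q: "h has_fps_expansion fps_expansion h 0" (is "_ has_fps_expansion ?Q")
    by (rule analytic_at_imp_has_fps_expansion_0)
  note SQ = line_diff_expansion[OF h s Q]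
  have "isCont v 0" using has_fps_expansion_imp_continuous[OF v, of UNIV] by simp
  hence "((\<lambda>t. v t) \<longlongrightarrow> a) (nhds 0)"
    using v0 by (metis isCont_def tendsto_at_iff_tendsto_nhds)
  hence "\<forall>\<^sub>F t in nhds 0. v t \<noteq> 0" using a by (rule tendsto_imp_eventually_ne)
  hence "\<forall>\<^sub>F t in nhds 0. (b * t * w t) ^ N = v t * t ^ N"
  proof eventually_elim
    case (elim t)
    have "w t ^ N = v t / a" using elim a N by (simp add: w_def exp_of_nat_mult[symmetric])
    thus ?case using a by (simp add: power_mult_distrib b)
  qed
  moreover have "(\<lambda>t. (b * t * w t) ^ N) has_fps_expansion S ^ N" by (intro fps_expansion_intros s)
  moreover have "(\<lambda>t. v t * t ^ N) has_fps_expansion U" unfolding UV by (intro fps_expansion_intros v)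
  ultimately have "S ^ N = U" using has_fps_expansion_eqI by blast
  hence "U oo ?Q = (S oo ?Q) ^ N" using fps_compose_power[OF SQ(2), of S N] by simp
  hence "U oo ?Q = fps_X ^ N" by (simp add: SQ(3))
  moreover have "?Q $ 1 \<noteq> 0" using SQ(5) by auto
  moreover have "?Q $ 1 = 1" if "U $ N = 1"
    using SQ(5) S(2) that by (simp add: b_def a_def)
  moreover have "fps_conv_radius ?Q > 0" using Q by (simp add: has_fps_expansion_def)
  ultimately show ?thesis using SQ(2) by blast
qed

subsection \<open>The conductor\<close>

lemma analytic_scale: "f analytic_on {0} \<Longrightarrow> (\<lambda>t. f (c * t)) analytic_on {0}" for f :: "complex \<Rightarrow> complex"
  using has_fps_expansion_imp_analytic_0[OF has_fps_expansion_scale[OF analytic_at_imp_has_fps_expansion_0]] .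

text \<open>
  In the expression
  \<open>\<Sum>\<^bsub>\<zeta>\<^esub> f (\<zeta> t) \<Prod>\<^bsub>\<zeta>' \<noteq> 1\<^esub> (x\<^bsub>i \<zeta>'\<^esub> - \<phi>\<^bsub>i \<zeta>'\<^esub> (\<zeta> \<zeta>' t))\<close>, with sum and product over the
  \<open>N\<close>-th roots of unity, the coefficients of the monomials in \<open>x\<close> are invariant under \<open>t \<mapsto> \<omega> t\<close>, hence
  germs in \<open>t ^ N\<close>; at \<open>x = \<phi> t\<close> only the summand \<open>\<zeta> = 1\<close> survives, as \<open>\<zeta>' = 1 / \<zeta>\<close> kills the others.
\<close>

lemma conductor_multiple:
  assumes \<phi>: "parametrization m \<phi>" and i0: "i0 < m" "\<forall>\<^sub>F t in nhds 0. \<phi> t i0 = t ^ N" and N: "N > 0"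
    and idx: "\<And>\<zeta>. \<zeta> ^ N = 1 \<Longrightarrow> \<zeta> \<noteq> 1 \<Longrightarrow> idx \<zeta> < m"
    and f: "f analytic_on {0}"
  shows "\<exists>g. analytic_germ m g \<and> (\<forall>\<^sub>F t in nhds 0. g (\<phi> t) =
    f t * (\<Prod>\<zeta>\<in>{\<zeta>. \<zeta> ^ N = 1} - {1}. \<phi> t (idx \<zeta>) - \<phi> (\<zeta> * t) (idx \<zeta>)))"
proof -
  define Z where "Z = {\<zeta> :: complex. \<zeta> ^ N = 1}"
  have fin: "finite Z" using N by (auto simp: Z_def intro: finite_nth_roots)
  have one: "1 \<in> Z" by (simp add: Z_def)
  have idxZ: "idx \<zeta> < m" if "\<zeta> \<in> Z - {1}" for \<zeta> using that idx by (auto simp: Z_def)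
  \<comment> \<open>The coordinate \<open>idx \<zeta>'\<close> depends on \<open>\<zeta>'\<close>
    alone, and \<open>\<zeta>\<close> enters only through \<open>\<zeta> * t\<close>. Replacing
    \<open>t\<close> by \<open>\<omega> * t\<close> therefore just permutes the summands.\<close>
  define A where "A = (\<lambda>S t. \<Sum>\<zeta>\<in>Z. f (\<zeta> * t) * (\<Prod>\<zeta>'\<in>(Z - {1}) - S. - \<phi> (\<zeta> * \<zeta>' * t) (idx \<zeta>')))"
  define \<omega> :: complex where "\<omega> = exp (2 * of_real pi * \<i> / of_nat N)"
  have \<omega>_pow: "\<omega> ^ j = exp (2 * of_real pi * \<i> * of_nat j / of_nat N)" for j
    by (simp add: \<omega>_def exp_of_nat_mult[symmetric] mult_ac)
  have \<omega>_eq: "\<omega> ^ j = 1 \<longleftrightarrow> N dvd j" for j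
    unfolding \<omega>_pow using complex_root_unity_eq_1[of N j] N by simp
  have \<omega>_N: "\<omega> ^ N = 1" by (simp add: \<omega>_eq)
  have \<omega>_0: "\<omega> \<noteq> 0" by (simp add: \<omega>_def)
  have "\<exists>B. B analytic_on {0} \<and> (\<forall>\<^sub>F t in nhds 0. A S t = B (t ^ N))" for S
  proof (rule rotation_invariant_factor[where \<zeta> = \<omega>])
    show "A S analytic_on {0}"
      unfolding A_def
      by (intro analytic_intros analytic_scale f analytic_scale[of "\<lambda>t. \<phi> t (idx _)"])
         (use \<phi> idxZ in \<open>auto simp: parametrization_def\<close>)
    have "A S (\<omega> * t) = A S t" for t
      unfolding A_def
    proof (rule sum.reindex_bij_witness[of _ "\<lambda>\<zeta>. \<zeta> / \<omega>" "\<lambda>\<zeta>. \<zeta> * \<omega>"])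
      fix \<zeta> assume "\<zeta> \<in> Z"
      show "f (\<zeta> * \<omega> * t) * (\<Prod>\<zeta>'\<in>(Z - {1}) - S. - \<phi> (\<zeta> * \<omega> * \<zeta>' * t) (idx \<zeta>')) =
          f (\<zeta> * (\<omega> * t)) * (\<Prod>\<zeta>'\<in>(Z - {1}) - S. - \<phi> (\<zeta> * \<zeta>' * (\<omega> * t)) (idx \<zeta>'))"
        by (simp add: mult_ac)
    qed (use \<omega>_0 \<omega>_N in \<open>auto simp: Z_def power_mult_distrib power_divide\<close>)
    thus "\<forall>\<^sub>F t in nhds 0. A S (\<omega> * t) = A S t" by simp
  qed (use N \<omega>_eq in auto)
  hence "\<forall>S. \<exists>B. B analytic_on {0} \<and> (\<forall>\<^sub>F t in nhds 0. A S t = B (t ^ N))" by blast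
  from choice[OF this] obtain B where B: "\<And>S. B S analytic_on {0}" "\<And>S. \<forall>\<^sub>F t in nhds 0. A S t = B S (t ^ N)"
    by auto
  \<comment> \<open>The product multiplied out: \<open>S\<close> collects the factors that
    contribute the variable, and the coordinate \<open>i0\<close>, equal to \<open>t ^ N\<close> on
    the curve, is inserted into the coefficient \<open>B S\<close>.\<close>
  define g where "g = (\<lambda>x. \<Sum>S\<in>Pow (Z - {1}). (\<Prod>\<zeta>\<in>S. x (idx \<zeta>)) * B S (x i0))"
  have "analytic_germ m g"
    unfolding g_def
    by (intro analytic_germ_sum analytic_germ_mult analytic_germ_prod analytic_germ_univariate B i0
        analytic_germ_coord idxZ) auto
  moreover have "\<forall>\<^sub>F t in nhds 0. \<forall>S\<in>Pow (Z - {1}). A S t = B S (t ^ N)"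
    using fin by (intro eventually_ball_finite ballI B) auto
  hence "\<forall>\<^sub>F t in nhds 0. g (\<phi> t) = f t * (\<Prod>\<zeta>\<in>Z - {1}. \<phi> t (idx \<zeta>) - \<phi> (\<zeta> * t) (idx \<zeta>))"
    using i0(2)
  proof eventually_elim
    case (elim t)
    have "g (\<phi> t) = (\<Sum>S\<in>Pow (Z - {1}). (\<Prod>\<zeta>\<in>S. \<phi> t (idx \<zeta>)) * A S t)"
      unfolding g_def using elim by (intro sum.cong refl) auto
    also have "\<dots> = (\<Sum>\<zeta>\<in>Z. f (\<zeta> * t) * (\<Sum>S\<in>Pow (Z - {1}). (\<Prod>\<zeta>'\<in>S. \<phi> t (idx \<zeta>')) *
        (\<Prod>\<zeta>'\<in>(Z - {1}) - S. - \<phi> (\<zeta> * \<zeta>' * t) (idx \<zeta>'))))"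
      unfolding A_def sum_distrib_left by (subst sum.swap) (simp add: mult_ac)
    also have "\<dots> = (\<Sum>\<zeta>\<in>Z. f (\<zeta> * t) * (\<Prod>\<zeta>'\<in>Z - {1}. \<phi> t (idx \<zeta>') + - \<phi> (\<zeta> * \<zeta>' * t) (idx \<zeta>')))"
      using fin by (subst prod_add) auto
    also have "\<dots> = f (1 * t) * (\<Prod>\<zeta>'\<in>Z - {1}. \<phi> t (idx \<zeta>') + - \<phi> (1 * \<zeta>' * t) (idx \<zeta>')) +
        (\<Sum>\<zeta>\<in>Z - {1}. f (\<zeta> * t) * (\<Prod>\<zeta>'\<in>Z - {1}. \<phi> t (idx \<zeta>') + - \<phi> (\<zeta> * \<zeta>' * t) (idx \<zeta>')))"
      by (rule sum.remove[OF fin one])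
    also have "(\<Sum>\<zeta>\<in>Z - {1}. f (\<zeta> * t) * (\<Prod>\<zeta>'\<in>Z - {1}. \<phi> t (idx \<zeta>') + - \<phi> (\<zeta> * \<zeta>' * t) (idx \<zeta>'))) = 0"
    proof (intro sum.neutral ballI)
      fix \<zeta> assume \<zeta>: "\<zeta> \<in> Z - {1}"
      hence \<zeta>0: "\<zeta> \<noteq> 0" using N by (auto simp: Z_def power_0_left)
      have inv: "1 / \<zeta> \<in> Z - {1}" using \<zeta> by (auto simp: Z_def power_divide)
      have "(\<Prod>\<zeta>'\<in>Z - {1}. \<phi> t (idx \<zeta>') + - \<phi> (\<zeta> * \<zeta>' * t) (idx \<zeta>')) = 0"
        using fin inv \<zeta>0 by (intro prod_zero bexI[OF _ inv]) auto
      thus "f (\<zeta> * t) * (\<Prod>\<zeta>'\<in>Z - {1}. \<phi> t (idx \<zeta>') + - \<phi> (\<zeta> * \<zeta>' * t) (idx \<zeta>')) = 0" by simp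
    qed
    finally show ?case by simp
  qed
  ultimately show ?thesis unfolding Z_def by blast
qed

text \<open>The number \<open>c\<close> is any exponent from which on all convergent series belong
  to \<open>W\<close>; it is an upper bound for the conductor, not necessarily the
  conductor.\<close>

definition conductor_bound :: "nat \<Rightarrow> complex fps set \<Rightarrow> bool" where
  "conductor_bound c W \<longleftrightarrow> (\<forall>F. fps_conv_radius F > 0 \<longrightarrow> (\<forall>j<c. F $ j = 0) \<longrightarrow> F \<in> W)"

text \<open>For each root of unity other than 1, \<open>idx\<close> selects a coordinate that it
  moves, so the product \<open>D\<close> of the differences is nonzero. A series whose order is at
  least that of \<open>D\<close> is divisible by \<open>D\<close>, and
  \<open>conductor_multiple\<close> applied to the quotient shows that it lies in the ring.\<close>

lemma conductor_normalized:
  assumes \<phi>: "parametrization m \<phi>" and i0: "i0 < m" "\<forall>\<^sub>F t in nhds 0. \<phi> t i0 = t ^ N" and N: "N > 0"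
    and sep: "\<And>\<zeta>. \<zeta> ^ N = 1 \<Longrightarrow> \<zeta> \<noteq> 1 \<Longrightarrow> \<exists>i<m. \<not> (\<forall>\<^sub>F t in nhds 0. \<phi> (\<zeta> * t) i = \<phi> t i)"
  shows "\<exists>c. conductor_bound c (germ_ring m \<phi>)"
proof -
  have "\<forall>\<zeta>. \<exists>i. \<zeta> ^ N = 1 \<and> \<zeta> \<noteq> 1 \<longrightarrow> i < m \<and> \<not> (\<forall>\<^sub>F t in nhds 0. \<phi> (\<zeta> * t) i = \<phi> t i)"
    using sep by blast
  from choice[OF this] obtain idx where idx: "\<And>\<zeta>. \<zeta> ^ N = 1 \<Longrightarrow> \<zeta> \<noteq> 1 \<Longrightarrow> idx \<zeta> < m"
    "\<And>\<zeta>. \<zeta> ^ N = 1 \<Longrightarrow> \<zeta> \<noteq> 1 \<Longrightarrow> \<not> (\<forall>\<^sub>F t in nhds 0. \<phi> (\<zeta> * t) (idx \<zeta>) = \<phi> t (idx \<zeta>))"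
    by auto
  define E where "E = (\<lambda>i. fps_expansion (\<lambda>t. \<phi> t i) 0)"
  have E: "(\<lambda>t. \<phi> t i) has_fps_expansion E i" if "i < m" for i
    unfolding E_def using \<phi> that by (intro analytic_at_imp_has_fps_expansion_0) (auto simp: parametrization_def)
  let ?Z = "{\<zeta> :: complex. \<zeta> ^ N = 1} - {1}"
  define d where "d = (\<lambda>t. \<Prod>\<zeta>\<in>?Z. \<phi> t (idx \<zeta>) - \<phi> (\<zeta> * t) (idx \<zeta>))"
  define D where "D = (\<Prod>\<zeta>\<in>?Z. E (idx \<zeta>) - (E (idx \<zeta>) oo (fps_const \<zeta> * fps_X)))"
  have D: "d has_fps_expansion D"
    unfolding d_def D_def
    by (intro has_fps_expansion_prod has_fps_expansion_diff E has_fps_expansion_scale[OF E]) (use idx in auto)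
  have "E (idx \<zeta>) - (E (idx \<zeta>) oo (fps_const \<zeta> * fps_X)) \<noteq> 0" if "\<zeta> \<in> ?Z" for \<zeta>
  proof
    assume "E (idx \<zeta>) - (E (idx \<zeta>) oo (fps_const \<zeta> * fps_X)) = 0"
    hence eq: "E (idx \<zeta>) oo (fps_const \<zeta> * fps_X) = E (idx \<zeta>)" by simp
    have i: "idx \<zeta> < m" using idx(1)[of \<zeta>] that by simp
    have "\<forall>\<^sub>F t in nhds 0. \<phi> (\<zeta> * t) (idx \<zeta>) = \<phi> t (idx \<zeta>)"
      by (rule has_fps_expansion_unique_eventually[OF has_fps_expansion_scale[OF E[OF i], of \<zeta>, unfolded eq] E[OF i]])
    thus False using idx(2)[of \<zeta>] that by simp
  qed
  hence D0: "D \<noteq> 0" unfolding D_def using N by (subst prod_zero_iff) (auto intro: finite_nth_roots)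
  have "F \<in> germ_ring m \<phi>" if F: "fps_conv_radius F > 0" "\<forall>j<subdegree D. F $ j = 0" for F
  proof (cases "F = 0")
    case False
    have le: "subdegree D \<le> subdegree F" using F(2) False by (intro subdegree_geI) auto
    define c where "c = F $ subdegree D / D $ subdegree D"
    define q where "q = (\<lambda>x. if x = 0 then c else eval_fps F x / d x)"
    have q: "q has_fps_expansion F / D"
      unfolding q_def by (rule has_fps_expansion_divide[OF eval_fps_has_fps_expansion[OF F(1)] D le D0 c_def])
    obtain g where g: "analytic_germ m g" "\<forall>\<^sub>F t in nhds 0. g (\<phi> t) = q t * d t"
      using conductor_multiple[where idx = idx, OF \<phi> i0 N idx(1) has_fps_expansion_imp_analytic_0[OF q]]
      unfolding d_def by blast
    have "(\<lambda>t. q t * d t) has_fps_expansion F / D * D" by (intro has_fps_expansion_mult q D)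
    also have "F / D * D = F" using le False D0 by (intro dvd_div_mult_self) (simp add: fps_dvd_iff)
    finally have "(\<lambda>t. g (\<phi> t)) has_fps_expansion F"
      using has_fps_expansion_cong[OF g(2) refl] by simp
    thus ?thesis by (rule germ_ringI[OF g(1)])
  qed simp
  thus ?thesis unfolding conductor_bound_def by blast
qed

lemma root_of_unity_order:
  fixes \<zeta> :: complex
  assumes "\<zeta> ^ N = 1" "N > 0"
  shows "\<exists>k>0. \<zeta> ^ k = 1 \<and> (\<forall>j. \<zeta> ^ j = 1 \<longrightarrow> k dvd j)"
proof -
  define k where "k = (LEAST k. k > 0 \<and> \<zeta> ^ k = 1)"
  have k: "k > 0 \<and> \<zeta> ^ k = 1" unfolding k_def by (rule LeastI[of _ N]) (use assms in auto)
  have "k dvd j" if j: "\<zeta> ^ j = 1" for j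
  proof -
    have "\<zeta> ^ j = \<zeta> ^ (k * (j div k) + j mod k)" by simp
    also have "\<dots> = \<zeta> ^ (j mod k)" using k by (simp only: power_add power_mult power_one) simp
    finally have "\<zeta> ^ (j mod k) = 1" using j by simp
    moreover have "j mod k < k" using k by simp
    ultimately have "j mod k = 0" using not_less_Least[of "j mod k" "\<lambda>k. k > 0 \<and> \<zeta> ^ k = 1"] k_def by auto
    thus ?thesis by auto
  qed
  thus ?thesis using k by blast
qed

lemma fps_compose_vanish:
  fixes F Q :: "complex fps"
  assumes "\<forall>j<c. F $ j = 0"
  shows "\<forall>j<c. (F oo Q) $ j = 0"
  using assms by (auto simp: fps_compose_nth intro!: sum.neutral)

lemma fps_compose_convergent:
  fixes F Q :: "complex fps"
  assumes "fps_conv_radius F > 0" "fps_conv_radius Q > 0" "Q $ 0 = 0"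
  shows "fps_conv_radius (F oo Q) > 0"
  using has_fps_expansion_compose[OF eval_fps_has_fps_expansion[OF assms(1)] eval_fps_has_fps_expansion[OF assms(2)] assms(3)]
  by (simp add: has_fps_expansion_def)

lemma fps_compose_cancel:
  fixes F G Q :: "complex fps"
  assumes "F oo Q = G oo Q" "Q $ 0 = 0" "Q \<noteq> 0"
  shows "F = G"
proof -
  have "(F - G) oo Q = 0" using assms(1) by (simp add: fps_compose_sub_distrib)
  thus ?thesis using fps_compose_eq_0_iff[OF assms(2), of "F - G"] assms(3) by simp
qed

text \<open>In a parameter where one coordinate is \<open>t ^ N\<close>, a root of unity \<zeta>
  other than 1 that fixed all coordinates would make them series in \<open>t ^ k\<close>, with
  \<open>k \<ge> 2\<close> the order of \<zeta>, against primitivity. A substitution of order 1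
  carries the conductor bound back unchanged.\<close>

lemma primitive_conductor:
  assumes \<phi>: "parametrization m \<phi>" and prim: "primitive m \<phi>"
  shows "\<exists>c. conductor_bound c (germ_ring m \<phi>)"
proof -
  have E: "(\<lambda>t. \<phi> t i) has_fps_expansion fps_expansion (\<lambda>t. \<phi> t i) 0" if "i < m" for i
    using \<phi> that by (intro analytic_at_imp_has_fps_expansion_0) (auto simp: parametrization_def)
  obtain i0 where i0: "i0 < m" "\<not> (\<forall>\<^sub>F t in nhds 0. \<phi> t i0 = 0)"
  proof (rule ccontr)
    assume "\<not> thesis"
    hence "\<forall>i\<in>{..<m}. \<forall>\<^sub>F t in nhds 0. \<phi> t i = 0" using that by auto
    hence "\<forall>\<^sub>F t in nhds 0. \<forall>i\<in>{..<m}. \<phi> t i = 0" by (intro eventually_ball_finite) auto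
    \<comment> \<open>The zero curve factors through \<open>\<tau> = 0\<close>, whose order is
      infinite, so it is not primitive.\<close>
    moreover have "germ_ord (\<lambda>_. 0) \<ge> 2" by (simp add: germ_ord_def)
    ultimately have "\<not> primitive m \<phi>"
      unfolding primitive_def not_not
      by (intro exI[of _ "\<lambda>_ _. 0"] exI[of _ "\<lambda>_. 0"]) (simp add: parametrization_def Ball_def)
    thus False using prim by simp
  qed
  let ?U = "fps_expansion (\<lambda>t. \<phi> t i0) 0"
  note U = E[OF i0(1)]
  have U0: "?U \<noteq> 0" using i0(2) U has_fps_expansion_0_iff[of "\<lambda>t. \<phi> t i0"] by auto
  have "?U $ 0 = 0" using has_fps_expansion_imp_0_eq_fps_nth_0[OF U] \<phi> i0(1) by (simp add: parametrization_def)
  hence N: "subdegree ?U > 0" using U0 by (intro subdegree_greaterI) auto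
  define N where "N = subdegree ?U"
  obtain Q where Q: "fps_conv_radius Q > 0" "Q $ 0 = 0" "Q $ 1 \<noteq> 0" "?U oo Q = fps_X ^ N"
    using root_parameter[OF _ U0 refl N] U by (auto simp: N_def has_fps_expansion_def)
  note N = N[folded N_def]
  have Q': "eval_fps Q has_fps_expansion Q" by (rule eval_fps_has_fps_expansion[OF Q(1)])
  obtain h where h: "line_diff (eval_fps Q) h" using local_inverse_exists[OF Q' Q(2,3)] by blast
  define \<phi>' where "\<phi>' = (\<lambda>t. \<phi> (eval_fps Q t))"
  have \<phi>': "parametrization m \<phi>'" unfolding \<phi>'_def by (rule parametrization_compose[OF \<phi> Q' Q(2)])
  have "(\<lambda>t. \<phi>' t i0) has_fps_expansion fps_X ^ N"
    using has_fps_expansion_compose[OF U Q' Q(2)] by (simp add: o_def \<phi>'_def Q(4))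
  hence norm: "\<forall>\<^sub>F t in nhds 0. \<phi>' t i0 = t ^ N"
    by (rule has_fps_expansion_unique_eventually) (intro fps_expansion_intros)
  have sep: "\<exists>i<m. \<not> (\<forall>\<^sub>F t in nhds 0. \<phi>' (\<zeta> * t) i = \<phi>' t i)" if \<zeta>: "\<zeta> ^ N = 1" "\<zeta> \<noteq> 1" for \<zeta>
  proof (rule ccontr)
    assume "\<not> ?thesis"
    hence inv: "\<forall>\<^sub>F t in nhds 0. \<phi>' (\<zeta> * t) i = \<phi>' t i" if "i < m" for i using that by blast
    obtain k where k: "k > 0" "\<zeta> ^ k = 1" "\<And>j. \<zeta> ^ j = 1 \<Longrightarrow> k dvd j"
      using root_of_unity_order[OF \<zeta>(1) N] by blast
    have k2: "k \<ge> 2" using k(1,2) \<zeta>(2) by (cases "k = 1") auto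
    have "\<forall>i. \<exists>B. i < m \<longrightarrow> B analytic_on {0} \<and> (\<forall>\<^sub>F t in nhds 0. \<phi>' t i = B (t ^ k))"
    proof
      fix i
      show "\<exists>B. i < m \<longrightarrow> B analytic_on {0} \<and> (\<forall>\<^sub>F t in nhds 0. \<phi>' t i = B (t ^ k))"
      proof (cases "i < m")
        case True
        have "(\<lambda>t. \<phi>' t i) analytic_on {0}" using \<phi>' True by (auto simp: parametrization_def)
        from rotation_invariant_factor[OF this inv[OF True] k(1,3)] show ?thesis by blast
      qed simp
    qed
    from choice[OF this] obtain B where B: "\<And>i. i < m \<Longrightarrow> B i analytic_on {0}"
      "\<And>i. i < m \<Longrightarrow> \<forall>\<^sub>F t in nhds 0. \<phi>' t i = B i (t ^ k)" by auto
    define \<psi> where "\<psi> = (\<lambda>s i. B i s)"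
    have B0: "B i 0 = 0" if "i < m" for i
    proof -
      have "\<phi>' 0 i = B i (0 ^ k)" by (rule eventually_nhds_x_imp_x[OF B(2)[OF that]])
      thus ?thesis using k(1) \<phi>' that by (simp add: parametrization_def power_0_left)
    qed
    have \<psi>: "parametrization m \<psi>" using B B0 by (simp add: parametrization_def \<psi>_def)
    have hH: "h has_fps_expansion fps_expansion h 0"
      using h by (intro analytic_at_imp_has_fps_expansion_0) (simp add: line_diff_def)
    have H0: "fps_expansion h 0 $ 0 = 0"
      using has_fps_expansion_imp_0_eq_fps_nth_0[OF hH] h by (simp add: line_diff_def)
    \<comment> \<open>This is \<open>t ^ k\<close> seen from the original parameter, as
      \<open>h\<close> inverts the normalizing substitution.\<close>
    define \<tau> where "\<tau> = (\<lambda>t. h t ^ k)"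
    have \<tau>: "\<tau> has_fps_expansion fps_expansion h 0 ^ k" unfolding \<tau>_def by (intro fps_expansion_intros hH)
    have ord: "germ_ord \<tau> \<ge> 2"
    proof (cases "fps_expansion h 0 = 0")
      case True
      thus ?thesis using germ_ord_has_fps_expansion[OF \<tau>] k(1) by simp
    next
      case False
      have "subdegree (fps_expansion h 0) > 0" using False H0 by (intro subdegree_greaterI) auto
      hence "2 \<le> k * subdegree (fps_expansion h 0)" using k2 by (metis One_nat_def Suc_leI mult.right_neutral mult_le_mono)
      hence "(2 :: enat) \<le> enat (k * subdegree (fps_expansion h 0))" by (simp add: numeral_eq_enat)
      thus ?thesis using germ_ord_has_fps_expansion[OF \<tau>] False by simp
    qed
    have "\<forall>i\<in>{..<m}. \<forall>\<^sub>F t in nhds 0. \<phi> t i = \<psi> (\<tau> t) i"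
    proof
      fix i assume "i \<in> {..<m}"
      hence i: "i < m" by simp
      have "\<forall>\<^sub>F t in nhds 0. \<phi>' (h t) i = B i (h t ^ k)"
        by (rule eventually_nhds_0_compose_fps[OF B(2)[OF i] hH H0])
      moreover have "\<forall>\<^sub>F t in nhds 0. eval_fps Q (h t) = t"
        using h by (auto simp: line_diff_def elim: eventually_mono)
      ultimately show "\<forall>\<^sub>F t in nhds 0. \<phi> t i = \<psi> (\<tau> t) i"
        by eventually_elim (simp add: \<phi>'_def \<psi>_def \<tau>_def)
    qed
    hence "\<forall>\<^sub>F t in nhds 0. \<forall>i\<in>{..<m}. \<phi> t i = \<psi> (\<tau> t) i" by (intro eventually_ball_finite) auto
    hence "\<not> primitive m \<phi>"
      unfolding primitive_def not_not
      using \<psi> has_fps_expansion_imp_analytic_0[OF \<tau>] ord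
      by (intro exI[of _ \<psi>] exI[of _ \<tau>]) (simp add: Ball_def)
    thus False using prim by simp
  qed
  obtain c where c: "conductor_bound c (germ_ring m \<phi>')"
    using conductor_normalized[OF \<phi>' i0(1) norm N sep] by blast
  have "F \<in> germ_ring m \<phi>" if F: "fps_conv_radius F > 0" "\<forall>j<c. F $ j = 0" for F
  proof -
    have "F oo Q \<in> germ_ring m \<phi>'"
      using c fps_compose_convergent[OF F(1) Q(1,2)] fps_compose_vanish[OF F(2)]
      unfolding conductor_bound_def by blast
    then obtain G where "G \<in> germ_ring m \<phi>" "F oo Q = G oo Q"
      unfolding \<phi>'_def germ_ring_compose[OF \<phi> Q' Q(2)] by blast
    moreover have "Q \<noteq> 0" using Q(3) by auto
    ultimately show ?thesis using fps_compose_cancel[of F Q G] Q(2) by simp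
  qed
  thus ?thesis unfolding conductor_bound_def by blast
qed

subsection \<open>Values and coordinate changes\<close>

lemma parametrization_mono: "parametrization m \<phi> \<Longrightarrow> k \<le> m \<Longrightarrow> parametrization k \<phi>"
  by (simp add: parametrization_def)

lemma parametrization_expansion:
  "parametrization m \<phi> \<Longrightarrow> i < m \<Longrightarrow> (\<lambda>t. \<phi> t i) has_fps_expansion fps_expansion (\<lambda>t. \<phi> t i) 0"
  by (intro analytic_at_imp_has_fps_expansion_0) (auto simp: parametrization_def)

lemma analytic_germ_along_cong:
  assumes g: "analytic_germ m g" and \<phi>: "parametrization m \<phi>"
    and eq: "\<forall>\<^sub>F t in nhds 0. \<forall>i<m. \<phi> t i = \<phi>' t i"
  shows "\<forall>\<^sub>F t in nhds 0. g (\<phi> t) = g (\<phi>' t)"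
proof -
  obtain s M where s: "s > 0" "hol_on_polydisc m s M g"
    using analytic_germ_imp_hol_on_polydisc[OF g] by blast
  obtain d where d: "d > 0" "\<And>i. i < m \<Longrightarrow> (\<lambda>t. \<phi> t i) holomorphic_on ball 0 d"
    "\<And>t. t \<in> ball 0 d \<Longrightarrow> \<phi> t \<in> polydisc m s"
    using parametrization_local[OF \<phi> s(1)] by blast
  have "\<forall>\<^sub>F t in nhds 0. t \<in> ball (0::complex) d"
    using d(1) by (intro eventually_nhds_in_open) auto
  thus ?thesis using eq
  proof eventually_elim
    case (elim t)
    show ?case by (rule hol_on_polydiscD(2)[OF s(2) d(3)[OF elim(1)]]) (use elim in simp)
  qed
qed

lemma analytic_germ_at_zero:
  assumes "analytic_germ m g" "parametrization m \<phi>"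
  shows "g (\<phi> 0) = g (\<lambda>_. 0)"
proof -
  obtain s M where s: "s > 0" "hol_on_polydisc m s M g"
    using analytic_germ_imp_hol_on_polydisc[OF assms(1)] by blast
  show ?thesis
    by (rule hol_on_polydiscD(2)[OF s(2)]) (use assms(2) s(1) in \<open>auto simp: parametrization_def polydisc_def\<close>)
qed

lemma germ_ring_cong:
  assumes "parametrization m \<phi>" "parametrization m \<phi>'" "\<forall>\<^sub>F t in nhds 0. \<forall>i<m. \<phi> t i = \<phi>' t i"
  shows "germ_ring m \<phi> = germ_ring m \<phi>'"
  unfolding germ_ring_def
  using has_fps_expansion_cong[OF analytic_germ_along_cong[OF _ assms(1,3)] refl] by blast

text \<open>A factorization through \<tau> makes every value a multiple of the order of \<tau>,
  which is impossible for two consecutive values if that order is at least 2.\<close>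

lemma primitive_if_consecutive_values:
  assumes \<phi>: "parametrization m \<phi>" and c: "c \<in> value_set m \<phi>" "Suc c \<in> value_set m \<phi>"
  shows "primitive m \<phi>"
  unfolding primitive_def
proof (rule notI, elim exE conjE)
  fix \<psi> \<tau>
  assume \<psi>: "parametrization m \<psi>" and an: "\<tau> analytic_on {0}" and ord: "2 \<le> germ_ord \<tau>"
    and eq: "\<forall>\<^sub>F t in nhds 0. \<forall>i<m. \<phi> t i = \<psi> (\<tau> t) i"
  define T where "T = fps_expansion \<tau> 0"
  have T: "\<tau> has_fps_expansion T" unfolding T_def by (rule analytic_at_imp_has_fps_expansion_0[OF an])
  have T2: "T = 0 \<or> subdegree T \<ge> 2"
  proof (cases "T = 0")
    case False
    hence "(2::enat) \<le> enat (subdegree T)" using ord germ_ord_has_fps_expansion[OF T] by simp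
    thus ?thesis by (simp add: numeral_eq_enat)
  qed simp
  have T0: "T $ 0 = 0"
  proof (cases "T = 0")
    case False
    hence "0 < subdegree T" using T2 by linarith
    thus ?thesis by (rule nth_less_subdegree_zero)
  qed simp
  have "germ_ring m \<phi> = (\<lambda>F. F oo T) ` germ_ring m \<psi>"
    using germ_ring_cong[OF \<phi> parametrization_compose[OF \<psi> T T0] eq] germ_ring_compose[OF \<psi> T T0] by simp
  hence dvd: "subdegree T dvd k" if "k \<in> value_set m \<phi>" for k
    using that unfolding value_set_germ_ring[OF \<phi>] by (auto simp: T0)
  have "subdegree T dvd Suc c - c" by (intro dvd_diff_nat dvd c)
  \<comment> \<open>If \<open>T\<close> is zero its subdegree is 0 by convention, and 0 does not
    divide \<open>Suc c\<close>; otherwise a number at least 2 would divide 1.\<close>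
  thus False using T2 dvd[OF c(2)] by auto
qed

text \<open>Exponents are treated in increasing order: a multiple of an element of order
  \<open>c\<close> adjusts the coefficient at \<open>c\<close> and leaves the lower ones alone. Only
  a linear space \<open>V\<close> is required, so that it can also be applied to the elements of
  high order alone.\<close>

lemma eliminate_values:
  assumes zero: "0 \<in> V" and add: "\<And>F G. F \<in> V \<Longrightarrow> G \<in> V \<Longrightarrow> F + G \<in> V"
    and scale: "\<And>a F. F \<in> V \<Longrightarrow> fps_const a * F \<in> V"
  shows "\<exists>H\<in>V. \<forall>j<c. j \<in> subdegree ` (V - {0}) \<longrightarrow> (F - H :: complex fps) $ j = 0"
proof (induction c)
  case 0
  show ?case using zero by auto
next
  case (Suc c)
  then obtain H where H: "H \<in> V" "\<And>j. j < c \<Longrightarrow> j \<in> subdegree ` (V - {0}) \<Longrightarrow> (F - H) $ j = 0" by blast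
  show ?case
  proof (cases "c \<in> subdegree ` (V - {0})")
    case False
    thus ?thesis using H by (intro bexI[of _ H]) (auto simp: less_Suc_eq)
  next
    case True
    then obtain Z where Z: "Z \<in> V" "Z \<noteq> 0" "subdegree Z = c" by auto
    define H' where "H' = H + fps_const ((F - H) $ c / Z $ c) * Z"
    have Zc: "Z $ c \<noteq> 0" using Z by auto
    have "(F - H') $ j = 0" if "j < Suc c" "j \<in> subdegree ` (V - {0})" for j
    proof (cases "j = c")
      case True
      thus ?thesis using Zc by (simp add: H'_def)
    next
      case False
      hence "j < c" using that by simp
      hence "Z $ j = 0" "(F - H) $ j = 0"
        using nth_less_subdegree_zero[of j Z] that Z(3) H(2)[of j] by simp_all
      thus ?thesis by (simp add: H'_def)
    qed
    moreover have "H' \<in> V" unfolding H'_def by (intro add H scale Z)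
    ultimately show ?thesis by blast
  qed
qed

lemma germ_ring_eliminate:
  "\<exists>H\<in>germ_ring m \<phi>. \<forall>j<c. j \<in> subdegree ` (germ_ring m \<phi> - {0}) \<longrightarrow> (F - H) $ j = 0"
  by (rule eliminate_values) (auto intro: germ_ring_add germ_ring_mult)

text \<open>Once all values of the small ring below \<open>c\<close> have been eliminated, a
  remainder of order below \<open>c\<close> would have as order a value of the large ring, hence one
  of the small ring, where its coefficient is already 0.\<close>

lemma germ_ring_approximation:
  assumes sub: "germ_ring k \<psi> \<subseteq> germ_ring m \<phi>" and \<psi>: "parametrization k \<psi>" and \<phi>: "parametrization m \<phi>"
    and val: "\<And>j. j \<in> value_set m \<phi> \<Longrightarrow> j < c \<Longrightarrow> j \<in> value_set k \<psi>" and F: "F \<in> germ_ring m \<phi>"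
  shows "\<exists>H\<in>germ_ring k \<psi>. \<forall>j<c. (F - H) $ j = 0"
proof -
  obtain H where H: "H \<in> germ_ring k \<psi>"
    "\<And>j. j < c \<Longrightarrow> j \<in> value_set k \<psi> \<Longrightarrow> (F - H) $ j = 0"
    using germ_ring_eliminate[of k \<psi> c F] unfolding value_set_germ_ring[OF \<psi>] by blast
  have FH: "F - H \<in> germ_ring m \<phi>" using F H(1) sub by (blast intro: germ_ring_diff)
  have "(F - H) $ j = 0" if j: "j < c" for j
  proof (cases "F - H = 0 \<or> j < subdegree (F - H)")
    case False
    have "subdegree (F - H) \<in> value_set m \<phi>" using FH False unfolding value_set_germ_ring[OF \<phi>] by blast
    moreover have "subdegree (F - H) < c" using False j by auto
    ultimately have "(F - H) $ subdegree (F - H) = 0" using H(2) val by blast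
    moreover have "(F - H) $ subdegree (F - H) \<noteq> 0" using False by (intro nth_subdegree_nonzero) blast
    ultimately show ?thesis by blast
  qed auto
  thus ?thesis using H(1) by blast
qed

text \<open>Membership of the components in the ring is turned into germs \<open>s\<close> that
  express \<psi> through \<phi>. They vanish at the origin because both curves pass through
  it.\<close>

lemma germ_ring_lift:
  assumes \<psi>: "parametrization k \<psi>" and \<phi>: "parametrization m \<phi>"
    and mem: "\<And>i. i < k \<Longrightarrow> fps_expansion (\<lambda>t. \<psi> t i) 0 \<in> germ_ring m \<phi>"
  shows "\<exists>s. (\<forall>i<k. analytic_germ m (s i) \<and> s i (\<lambda>_. 0) = 0) \<and>
    (\<forall>\<^sub>F t in nhds 0. \<forall>i<k. \<psi> t i = s i (\<phi> t))"
proof -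
  have "\<forall>i. \<exists>s. i < k \<longrightarrow> analytic_germ m s \<and> (\<lambda>t. s (\<phi> t)) has_fps_expansion fps_expansion (\<lambda>t. \<psi> t i) 0"
    using mem by (auto simp: germ_ring_def)
  from choice[OF this] obtain s where s: "\<And>i. i < k \<Longrightarrow> analytic_germ m (s i)"
    "\<And>i. i < k \<Longrightarrow> (\<lambda>t. s i (\<phi> t)) has_fps_expansion fps_expansion (\<lambda>t. \<psi> t i) 0" by auto
  have ev: "\<forall>\<^sub>F t in nhds 0. \<psi> t i = s i (\<phi> t)" if "i < k" for i
    by (rule has_fps_expansion_unique_eventually[OF parametrization_expansion[OF \<psi> that] s(2)[OF that]])
  have "s i (\<lambda>_. 0) = 0" if "i < k" for i
    using eventually_nhds_x_imp_x[OF ev[OF that]] analytic_germ_at_zero[OF s(1)[OF that] \<phi>] \<psi> that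
    by (simp add: parametrization_def)
  moreover have "\<forall>\<^sub>F t in nhds 0. \<forall>i\<in>{..<k}. \<psi> t i = s i (\<phi> t)"
    by (intro eventually_ball_finite) (auto intro: ev)
  ultimately show ?thesis using s(1) by (intro exI[of _ s]) (simp add: Ball_def)
qed

lemma germ_ring_subset:
  assumes \<psi>: "parametrization k \<psi>" and \<phi>: "parametrization m \<phi>"
    and mem: "\<And>i. i < k \<Longrightarrow> fps_expansion (\<lambda>t. \<psi> t i) 0 \<in> germ_ring m \<phi>"
  shows "germ_ring k \<psi> \<subseteq> germ_ring m \<phi>"
proof
  fix F assume "F \<in> germ_ring k \<psi>"
  then obtain g where g: "analytic_germ k g" "(\<lambda>t. g (\<psi> t)) has_fps_expansion F" by (auto simp: germ_ring_def)
  obtain s where s': "\<forall>i<k. analytic_germ m (s i) \<and> s i (\<lambda>_. 0) = 0"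
    "\<forall>\<^sub>F t in nhds 0. \<forall>i<k. \<psi> t i = s i (\<phi> t)"
    using germ_ring_lift[OF \<psi> \<phi> mem] by blast
  note s = s'(1)[rule_format, THEN conjunct1] s'(1)[rule_format, THEN conjunct2] s'(2)
  have "\<forall>\<^sub>F t in nhds 0. g (\<psi> t) = g (\<lambda>i. s i (\<phi> t))"
    by (rule analytic_germ_along_cong[OF g(1) \<psi> s(3)])
  hence "(\<lambda>t. g (\<lambda>i. s i (\<phi> t))) has_fps_expansion F"
    using g(2) has_fps_expansion_cong[of "\<lambda>t. g (\<psi> t)" "\<lambda>t. g (\<lambda>i. s i (\<phi> t))", OF _ refl] by simp
  thus "F \<in> germ_ring m \<phi>"
    using germ_ringI[of m "\<lambda>x. g (\<lambda>i. s i x)" \<phi> F]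
      analytic_germ_compose[where F = g and G = s and m = k and k = m, OF g(1) s(1,2)] by blast
qed

lemma trivial_left_kernel_row_replaced:
  assumes "p < N" "b p \<noteq> 0"
  shows "trivial_left_kernel N (\<lambda>i j. if i = p then b j else if i = j then 1 else 0)"
  unfolding trivial_left_kernel_def
proof (intro allI impI)
  fix c i assume c: "\<forall>j<N. (\<Sum>i<N. c i * (if i = p then b j else if i = j then 1 else 0)) = (0::complex)"
    and i: "i < N"
  have split: "(\<Sum>i<N. c i * (if i = p then b j else if i = j then 1 else 0)) =
      c p * b j + (\<Sum>i\<in>{..<N}-{p}. if i = j then c i else 0)" for j
  proof -
    have "(\<Sum>i<N. c i * (if i = p then b j else if i = j then 1 else 0)) =
      c p * b j + (\<Sum>i\<in>{..<N}-{p}. c i * (if i = p then b j else if i = j then 1 else 0))"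
      using sum.remove[of "{..<N}" p "\<lambda>i. c i * (if i = p then b j else if i = j then 1 else 0)"] assms(1) by simp
    also have "(\<Sum>i\<in>{..<N}-{p}. c i * (if i = p then b j else if i = j then 1 else 0)) =
        (\<Sum>i\<in>{..<N}-{p}. if i = j then c i else 0)"
      by (intro sum.cong) auto
    finally show ?thesis .
  qed
  have "c p * b p = 0" using c assms(1) split[of p] by simp
  hence cp: "c p = 0" using assms(2) by simp
  show "c i = 0"
  proof (cases "i = p")
    case False
    thus ?thesis using c i split[of i] cp by simp
  qed (use cp in simp)
qed

text \<open>Each curve is expressed through the other, \<phi> by \<open>h\<close> and \<psi> by
  \<open>s\<close>. The \<open>m\<close> linear parts of \<open>h\<close> in \<open>k < m\<close>
  variables are dependent, so a combination of the components of \<phi> with coefficients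
  \<open>b\<close> lies in the square of the maximal ideal. Moving it to one side gives a function
  with linear part \<open>b\<close> that vanishes along \<phi>, and it can serve as a new coordinate
  \<open>p\<close>.\<close>

lemma degenerate_if_generated_by_fewer:
  assumes \<phi>: "parametrization m \<phi>" and \<psi>: "parametrization k \<psi>" and k: "k < m"
    and mem: "\<And>i. i < k \<Longrightarrow> fps_expansion (\<lambda>t. \<psi> t i) 0 \<in> germ_ring m \<phi>"
    and sub: "germ_ring m \<phi> \<subseteq> germ_ring k \<psi>"
  shows "degenerate m \<phi>"
proof -
  obtain s where s': "\<forall>i<k. analytic_germ m (s i) \<and> s i (\<lambda>_. 0) = 0"
    "\<forall>\<^sub>F t in nhds 0. \<forall>i<k. \<psi> t i = s i (\<phi> t)"
    using germ_ring_lift[OF \<psi> \<phi> mem] by blast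
  note s = s'(1)[rule_format, THEN conjunct1] s'(1)[rule_format, THEN conjunct2] s'(2)
  have mem': "fps_expansion (\<lambda>t. \<phi> t j) 0 \<in> germ_ring k \<psi>" if "j < m" for j
    using germ_ring_coord[where \<phi> = \<phi>, OF that parametrization_expansion[OF \<phi> that]] sub by blast
  obtain h where h': "\<forall>j<m. analytic_germ k (h j) \<and> h j (\<lambda>_. 0) = 0"
    "\<forall>\<^sub>F t in nhds 0. \<forall>j<m. \<phi> t j = h j (\<psi> t)"
    using germ_ring_lift[OF \<phi> \<psi> mem'] by blast
  note h = h'(1)[rule_format, THEN conjunct1] h'(1)[rule_format, THEN conjunct2] h'(2)
  have "\<forall>j. \<exists>l q. j < m \<longrightarrow> in_max_sq k q \<and> (\<forall>x. h j x = (\<Sum>i<k. l i * x i) + q x)"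
  proof
    fix j
    show "\<exists>l q. j < m \<longrightarrow> in_max_sq k q \<and> (\<forall>x. h j x = (\<Sum>i<k. l i * x i) + q x)"
    proof (cases "j < m")
      case True
      obtain l q where "in_max_sq k q" "\<And>x. h j x = h j (\<lambda>_. 0) + (\<Sum>i<k. l i * x i) + q x"
        using linear_part[OF h(1)[OF True]] by metis
      thus ?thesis using h(2)[OF True] by (intro exI[of _ l] exI[of _ q]) simp
    qed simp
  qed
  then obtain l q where lq: "\<And>j. j < m \<Longrightarrow> in_max_sq k (q j)"
    "\<And>j x. j < m \<Longrightarrow> h j x = (\<Sum>i<k. l j i * x i) + q j x"
    by metis
  obtain b where b: "\<exists>j\<in>{..<m}. b j \<noteq> 0" "\<forall>i<k. (\<Sum>j\<in>{..<m}. b j * l j i) = 0"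
    using linear_dependence[of "{..<m}" k l] k by auto
  then obtain p where p: "p < m" "b p \<noteq> 0" by auto
  have rel: "(\<Sum>j<m. b j * h j x) = (\<Sum>j<m. b j * q j x)" for x
  proof -
    have "(\<Sum>j<m. b j * h j x) = (\<Sum>j<m. b j * (\<Sum>i<k. l j i * x i)) + (\<Sum>j<m. b j * q j x)"
      unfolding sum.distrib[symmetric] by (intro sum.cong refl) (simp add: lq(2) distrib_left)
    also have "(\<Sum>j<m. b j * (\<Sum>i<k. l j i * x i)) = (\<Sum>i<k. (\<Sum>j<m. b j * l j i) * x i)"
      unfolding sum_distrib_left sum_distrib_right mult.assoc by (rule sum.swap)
    also have "\<dots> = 0" using b(2) by simp
    finally show ?thesis by simp
  qed
  have "in_max_sq k (\<lambda>x. \<Sum>j<m. b j * q j x)" by (rule in_max_sq_linear_combination[OF lq(1)])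
  then obtain r u where u': "r > 0" "\<forall>i<k. analytic_germ k (u i) \<and> u i (\<lambda>_. 0) = 0"
    "\<forall>x\<in>polydisc k r. (\<Sum>j<m. b j * q j x) = (\<Sum>i<k. x i * u i x)"
    unfolding in_max_sq_def by blast
  note u = u'(1) u'(2)[rule_format, THEN conjunct1] u'(2)[rule_format, THEN conjunct2] u'(3)[rule_format]
  \<comment> \<open>The quadratic side of the relation, rewritten through \<open>s\<close> in the
    ambient coordinates and negated, so that the combination with coefficients \<open>b\<close> plus
    \<open>q'\<close> vanishes along \<phi>.\<close>
  define q' where "q' = (\<lambda>x. \<Sum>i<k. -1 * (s i x * u i (\<lambda>j. s j x)))"
  have q': "in_max_sq m q'"
    unfolding q'_def
  proof (rule in_max_sq_linear_combination[where b = "\<lambda>_. -1"], rule in_max_sq_mult)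
    fix i assume i: "i < k"
    show "analytic_germ m (s i)" "s i (\<lambda>_. 0) = 0" by (fact s(1)[OF i] s(2)[OF i])+
    show "analytic_germ m (\<lambda>x. u i (\<lambda>j. s j x))"
      by (rule analytic_germ_compose[where F = "u i" and G = s and m = k and k = m, OF u(2)[OF i] s(1,2)])
    have "u i (\<lambda>j. s j (\<lambda>_. 0)) = u i (\<lambda>_. 0)"
      using analytic_germ_at_zero[OF u(2)[OF i], of "\<lambda>_ j. s j (\<lambda>_. 0)"] s(2)
      by (simp add: parametrization_def)
    thus "u i (\<lambda>j. s j (\<lambda>_. 0)) = 0" using u(3)[OF i] by simp
  qed
  define L :: "nat \<Rightarrow> nat \<Rightarrow> complex" where "L = (\<lambda>i j. if i = p then b j else if i = j then 1 else 0)"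
  define \<sigma> where "\<sigma> = (\<lambda>x i. (\<Sum>j<m. L i j * x j) + (if i = p then q' x else 0))"
  have "\<exists>\<sigma>'. space_diff m \<sigma> \<sigma>'"
  proof (rule analytic_inverse_function[where L = L and q = "\<lambda>i x. if i = p then q' x else 0"])
    show "in_max_sq m (\<lambda>x. if i = p then q' x else 0)" for i
      using q' in_max_sq_linear_combination[of 0 m] by (cases "i = p") auto
    show "trivial_left_kernel m L" unfolding L_def by (rule trivial_left_kernel_row_replaced[where b = b, OF p])
  qed (simp add: \<sigma>_def)
  then obtain \<sigma>' where \<sigma>': "space_diff m \<sigma> \<sigma>'" by blast
  define \<chi> where "\<chi> = (\<lambda>t. \<sigma> (\<phi> t))"
  have "A_equivalent m \<phi> \<chi>"
    unfolding A_equivalent_def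
    by (rule exI[of _ "\<lambda>t. t"], rule exI[of _ "\<lambda>t. t"], rule exI[of _ \<sigma>], rule exI[of _ \<sigma>'])
       (simp add: \<sigma>' \<chi>_def line_diff_def analytic_intros)
  moreover have "parametrization m \<chi>"
    unfolding parametrization_def
  proof (intro allI impI conjI)
    fix i assume i: "i < m"
    have g: "analytic_germ m (\<lambda>x. \<sigma> x i)" "\<sigma> (\<lambda>_. 0) i = 0" using \<sigma>' i by (auto simp: space_diff_def)
    show "(\<lambda>t. \<chi> t i) analytic_on {0}" unfolding \<chi>_def by (rule analytic_germ_along_curve[OF g(1) \<phi>])
    show "\<chi> 0 i = 0" unfolding \<chi>_def using analytic_germ_at_zero[OF g(1) \<phi>] g(2) by simp
  qed
  moreover have "\<forall>\<^sub>F t in nhds 0. \<chi> t p = 0"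
  proof -
    obtain d where d: "d > 0" "\<And>t. t \<in> ball 0 d \<Longrightarrow> \<psi> t \<in> polydisc k r"
      using parametrization_local[OF \<psi> u(1)] by metis
    have "\<forall>\<^sub>F t in nhds 0. t \<in> ball (0::complex) d" using d(1) by (intro eventually_nhds_in_open) auto
    moreover have "\<forall>\<^sub>F t in nhds 0. \<forall>i\<in>{..<k}. u i (\<psi> t) = u i (\<lambda>j. s j (\<phi> t))"
      by (intro eventually_ball_finite ballI analytic_germ_along_cong[OF u(2) \<psi> s(3)]) auto
    ultimately show ?thesis using h(3) s(3)
    proof eventually_elim
      case (elim t)
      have "(\<Sum>j<m. b j * \<phi> t j) = (\<Sum>j<m. b j * h j (\<psi> t))" using elim by (intro sum.cong) auto
      also have "\<dots> = (\<Sum>i<k. \<psi> t i * u i (\<psi> t))" using rel u(4) d(2) elim by simp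
      also have "\<dots> = - q' (\<phi> t)" unfolding q'_def sum_negf[symmetric]
        using elim by (intro sum.cong) auto
      finally show ?case by (simp add: \<chi>_def \<sigma>_def L_def)
    qed
  qed
  ultimately show ?thesis unfolding degenerate_def using p(1) by blast
qed

text \<open>The range \<open>j \<le> c\<close> reaches one exponent further than the hypothesis on
  \<open>A\<close>; the gain comes from \<open>B $ 0 = 0\<close> and is what decides the coefficient
  at \<open>w p\<close> below.\<close>

lemma fps_mult_vanish:
  fixes A B :: "complex fps"
  assumes "\<forall>j<c. A $ j = 0" "B $ 0 = 0" "j \<le> c"
  shows "(A * B) $ j = 0"
  unfolding fps_mult_nth
proof (intro sum.neutral ballI)
  fix i assume "i \<in> {0..j}"
  thus "A $ i * B $ (j - i) = 0" using assms by (cases "i < c") auto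
qed

text \<open>Any \<open>s\<close> with \<psi> expressed through \<phi> is a diffeomorphism. A
  relation \<open>b\<close> between the rows of its linear part would put the combination
  \<open>F\<close> of the components of \<psi> into the square of the maximal ideal. Replacing all
  factors by elements of \<open>germ_ring p \<psi>\<close> keeps its order \<open>w p\<close>, which
  is not a value of that ring.\<close>

lemma minimal_values_coordinate_change:
  assumes \<phi>: "parametrization N \<phi>" and \<psi>: "parametrization N \<psi>"
    and mem: "\<And>i. i < N \<Longrightarrow> fps_expansion (\<lambda>t. \<psi> t i) 0 \<in> germ_ring N \<phi>"
    and w: "\<And>i. i < N \<Longrightarrow> fps_expansion (\<lambda>t. \<psi> t i) 0 \<noteq> 0"
      "\<And>i. i < N \<Longrightarrow> subdegree (fps_expansion (\<lambda>t. \<psi> t i) 0) = w i"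
      "\<And>i j. i < j \<Longrightarrow> j < N \<Longrightarrow> w i < w j"
      "\<And>i. i < N \<Longrightarrow> w i \<notin> value_set i \<psi>"
      "\<And>i j. i < N \<Longrightarrow> j \<in> value_set N \<phi> \<Longrightarrow> j < w i \<Longrightarrow> j \<in> value_set i \<psi>"
  shows "\<exists>\<sigma> \<sigma>'. space_diff N \<sigma> \<sigma>' \<and> (\<forall>\<^sub>F t in nhds 0. \<forall>i<N. \<psi> t i = \<sigma> (\<phi> t) i)"
proof -
  define E where "E = (\<lambda>i. fps_expansion (\<lambda>t. \<psi> t i) 0)"
  have E: "(\<lambda>t. \<psi> t i) has_fps_expansion E i" if "i < N" for i
    unfolding E_def by (rule parametrization_expansion[OF \<psi> that])
  define \<Phi> where "\<Phi> = (\<lambda>i. fps_expansion (\<lambda>t. \<phi> t i) 0)"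
  have \<Phi>: "(\<lambda>t. \<phi> t i) has_fps_expansion \<Phi> i" if "i < N" for i
    unfolding \<Phi>_def by (rule parametrization_expansion[OF \<phi> that])
  obtain s where s': "\<forall>i<N. analytic_germ N (s i) \<and> s i (\<lambda>_. 0) = 0"
    "\<forall>\<^sub>F t in nhds 0. \<forall>i<N. \<psi> t i = s i (\<phi> t)"
    using germ_ring_lift[OF \<psi> \<phi> mem] by blast
  note s = s'(1)[rule_format, THEN conjunct1] s'(1)[rule_format, THEN conjunct2] s'(2)
  have "\<forall>i. \<exists>l q. i < N \<longrightarrow> in_max_sq N q \<and> (\<forall>x. s i x = (\<Sum>j<N. l j * x j) + q x)"
  proof
    fix i
    show "\<exists>l q. i < N \<longrightarrow> in_max_sq N q \<and> (\<forall>x. s i x = (\<Sum>j<N. l j * x j) + q x)"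
    proof (cases "i < N")
      case True
      obtain l q where "in_max_sq N q" "\<And>x. s i x = s i (\<lambda>_. 0) + (\<Sum>j<N. l j * x j) + q x"
        using linear_part[OF s(1)[OF True]] by metis
      thus ?thesis using s(2)[OF True] by (intro exI[of _ l] exI[of _ q]) simp
    qed simp
  qed
  then obtain L q where Lq: "\<And>i. i < N \<Longrightarrow> in_max_sq N (q i)"
    "\<And>i x. i < N \<Longrightarrow> s i x = (\<Sum>j<N. L i j * x j) + q i x"
    by metis
  have "trivial_left_kernel N L"
    unfolding trivial_left_kernel_def
  proof (intro allI impI, rule ccontr)
    fix b i assume b: "\<forall>j<N. (\<Sum>i<N. b i * L i j) = 0" and "i < N" "b i \<noteq> 0"
    \<comment> \<open>With \<open>p\<close> the least index in the relation and \<open>w\<close>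
      increasing, the order of \<open>F\<close> is exactly \<open>w p\<close>.\<close>
    then obtain p where p: "p < N" "b p \<noteq> 0" and min: "\<And>i. i < p \<Longrightarrow> b i = 0"
      using exists_least_iff[of "\<lambda>i. i < N \<and> b i \<noteq> 0"] less_trans by metis
    define F where "F = (\<Sum>i<N. fps_const (b i) * E i)"
    have F_nth: "F $ j = (\<Sum>i<N. b i * E i $ j)" for j by (simp add: F_def fps_sum_nth)
    have lower: "b i * E i $ j = 0" if "i < N" "i \<noteq> p" "j \<le> w p" for i j
    proof (cases "i < p")
      case False
      hence "j < subdegree (E i)" using that w(2)[OF that(1)] w(3)[of p i] by (auto simp: E_def)
      thus ?thesis by auto
    qed (simp add: min)
    have F_low: "F $ j = 0" if "j < w p" for j
      unfolding F_nth
    proof (intro sum.neutral ballI)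
      fix i assume "i \<in> {..<N}"
      hence i: "i < N" by simp
      show "b i * E i $ j = 0"
      proof (cases "i = p")
        case True
        hence "j < subdegree (E i)" using that w(2)[OF p(1)] by (simp add: E_def)
        thus ?thesis by auto
      qed (use lower[OF i] that in simp)
    qed
    have "F $ w p = b p * E p $ w p + (\<Sum>i\<in>{..<N}-{p}. b i * E i $ w p)"
      unfolding F_nth using p(1) by (intro sum.remove) auto
    also have "(\<Sum>i\<in>{..<N}-{p}. b i * E i $ w p) = 0"
      by (intro sum.neutral ballI lower) auto
    finally have F_top: "F $ w p \<noteq> 0"
      using p(2) nth_subdegree_nonzero[OF w(1)[OF p(1)]] w(2)[OF p(1)] by (simp add: E_def)
    have "in_max_sq N (\<lambda>x. \<Sum>i<N. b i * q i x)" by (rule in_max_sq_linear_combination[OF Lq(1)])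
    then obtain r u where u': "r > 0" "\<forall>i<N. analytic_germ N (u i) \<and> u i (\<lambda>_. 0) = 0"
      "\<forall>x\<in>polydisc N r. (\<Sum>i<N. b i * q i x) = (\<Sum>i<N. x i * u i x)"
      unfolding in_max_sq_def by blast
    note u = u'(1) u'(2)[rule_format, THEN conjunct1] u'(2)[rule_format, THEN conjunct2] u'(3)[rule_format]
    define U where "U = (\<lambda>i. fps_expansion (\<lambda>t. u i (\<phi> t)) 0)"
    have U: "(\<lambda>t. u i (\<phi> t)) has_fps_expansion U i" if "i < N" for i
      unfolding U_def by (rule germ_ring_expansion[OF \<phi> u(2)[OF that]])
    obtain d where d: "d > 0" "\<And>t. t \<in> ball 0 d \<Longrightarrow> \<phi> t \<in> polydisc N r"
      using parametrization_local[OF \<phi> u(1)] by metis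
    have "\<forall>\<^sub>F t in nhds 0. t \<in> ball (0::complex) d" using d(1) by (intro eventually_nhds_in_open) auto
    hence ev: "\<forall>\<^sub>F t in nhds 0. (\<Sum>i<N. b i * \<psi> t i) = (\<Sum>i<N. \<phi> t i * u i (\<phi> t))"
      using s(3)
    proof eventually_elim
      case (elim t)
      have "(\<Sum>i<N. b i * \<psi> t i) = (\<Sum>i<N. b i * (\<Sum>j<N. L i j * \<phi> t j)) + (\<Sum>i<N. b i * q i (\<phi> t))"
        unfolding sum.distrib[symmetric] using elim by (intro sum.cong refl) (simp add: Lq(2) distrib_left)
      also have "(\<Sum>i<N. b i * (\<Sum>j<N. L i j * \<phi> t j)) = (\<Sum>j<N. (\<Sum>i<N. b i * L i j) * \<phi> t j)"
        unfolding sum_distrib_left sum_distrib_right mult.assoc by (rule sum.swap)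
      also have "\<dots> = 0" using b by simp
      finally show ?case using u(4) d(2) elim by simp
    qed
    have F_eq: "F = (\<Sum>i<N. \<Phi> i * U i)"
    proof (rule has_fps_expansion_eqI[OF _ _ ev])
      show "(\<lambda>t. \<Sum>i<N. b i * \<psi> t i) has_fps_expansion F"
        unfolding F_def by (intro has_fps_expansion_sum has_fps_expansion_cmult_left E) auto
      show "(\<lambda>t. \<Sum>i<N. \<phi> t i * u i (\<phi> t)) has_fps_expansion (\<Sum>i<N. \<Phi> i * U i)"
        by (intro has_fps_expansion_sum has_fps_expansion_mult \<Phi> U) auto
    qed
    have \<psi>p: "parametrization p \<psi>" using parametrization_mono[OF \<psi>] p(1) by simp
    have sub: "germ_ring p \<psi> \<subseteq> germ_ring N \<phi>"
      by (rule germ_ring_subset[OF \<psi>p \<phi>]) (use mem p(1) in simp)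
    have appr: "\<exists>H\<in>germ_ring p \<psi>. \<forall>j<w p. (Z - H) $ j = 0" if "Z \<in> germ_ring N \<phi>" for Z
      by (rule germ_ring_approximation[OF sub \<psi>p \<phi> w(5)[OF p(1)] that])
    have "\<forall>i. \<exists>H. i < N \<longrightarrow> H \<in> germ_ring p \<psi> \<and> (\<forall>j<w p. (\<Phi> i - H) $ j = 0)"
      using appr germ_ring_coord[where \<phi> = \<phi>, OF _ \<Phi>] by blast
    from choice[OF this] obtain A where A: "\<And>i. i < N \<Longrightarrow> A i \<in> germ_ring p \<psi>"
      "\<And>i. i < N \<Longrightarrow> \<forall>j<w p. (\<Phi> i - A i) $ j = 0" by blast
    have "\<forall>i. \<exists>H. i < N \<longrightarrow> H \<in> germ_ring p \<psi> \<and> (\<forall>j<w p. (U i - H) $ j = 0)"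
      using appr germ_ringI[where \<phi> = \<phi>, OF u(2) U] by blast
    from choice[OF this] obtain C where C: "\<And>i. i < N \<Longrightarrow> C i \<in> germ_ring p \<psi>"
      "\<And>i. i < N \<Longrightarrow> \<forall>j<w p. (U i - C i) $ j = 0" by blast
    have E0: "E p $ 0 = 0"
      using has_fps_expansion_imp_0_eq_fps_nth_0[OF E[OF p(1)]] \<psi> p(1) by (simp add: parametrization_def)
    have wp: "w p > 0"
      using w(1,2)[OF p(1)] E0 by (metis E_def gr0I nth_subdegree_nonzero)
    have U0: "U i $ 0 = 0" if "i < N" for i
      using has_fps_expansion_imp_0_eq_fps_nth_0[OF U[OF that]] analytic_germ_at_zero[OF u(2)[OF that] \<phi>]
        u(3)[OF that] by simp
    have A0: "A i $ 0 = 0" if "i < N" for i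
      using has_fps_expansion_imp_0_eq_fps_nth_0[OF \<Phi>[OF that]] A(2)[OF that] wp \<phi> that
      by (auto simp: parametrization_def)
    \<comment> \<open>All factors \<open>\<Phi> i\<close>, \<open>U i\<close> and \<open>A i\<close>
      vanish at 0, so the exchange of factors agreeing below \<open>w p\<close> alters the products
      only beyond the exponent \<open>w p\<close>.\<close>
    define F' where "F' = (\<Sum>i<N. A i * C i)"
    have F'_mem: "F' \<in> germ_ring p \<psi>" unfolding F'_def by (intro germ_ring_sum germ_ring_mult A C) auto
    have same: "F' $ j = F $ j" if j: "j \<le> w p" for j
    proof -
      have "(\<Phi> i * U i) $ j = (A i * C i) $ j" if i: "i < N" for i
      proof -
        have "\<Phi> i * U i = A i * C i + ((\<Phi> i - A i) * U i + (U i - C i) * A i)"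
          by (simp add: algebra_simps)
        moreover have "((\<Phi> i - A i) * U i) $ j = 0"
          by (rule fps_mult_vanish[OF A(2)[OF i] U0[OF i] j])
        moreover have "((U i - C i) * A i) $ j = 0"
          by (rule fps_mult_vanish[OF C(2)[OF i] A0[OF i] j])
        ultimately show ?thesis by simp
      qed
      thus ?thesis unfolding F_eq F'_def by (simp add: fps_sum_nth)
    qed
    have "subdegree F' = w p"
      by (rule subdegreeI) (use same F_top F_low in auto)
    moreover have "F' \<noteq> 0" using same[of "w p"] F_top by auto
    ultimately have "w p \<in> value_set p \<psi>"
      using F'_mem unfolding value_set_germ_ring[OF \<psi>p] by (intro image_eqI[of _ subdegree F']) auto
    thus False using w(4)[OF p(1)] by blast
  qed
  hence "\<exists>\<sigma>'. space_diff N (\<lambda>x i. s i x) \<sigma>'"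
    by (intro analytic_inverse_function[where q = q and L = L] Lq)
  thus ?thesis using s(3) by blast
qed

subsection \<open>Zariski's elimination\<close>

lemma one_plus_power_nth:
  fixes B :: "complex fps"
  assumes e: "e > 0"
  shows "(\<forall>j<e. ((1 + fps_X ^ e * B) ^ i) $ j = (if j = 0 then 1 else 0)) \<and>
    ((1 + fps_X ^ e * B) ^ i) $ e = of_nat i * B $ 0"
proof (induction i)
  case (Suc i)
  let ?V = "(1 + fps_X ^ e * B) ^ i"
  have "(1 + fps_X ^ e * B) ^ Suc i = ?V + fps_X ^ e * (B * ?V)"
    by (simp add: distrib_right mult.assoc)
  hence nth: "((1 + fps_X ^ e * B) ^ Suc i) $ j = ?V $ j + (if j < e then 0 else (B * ?V) $ (j - e))" for j
    by (simp add: fps_X_power_mult_nth)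
  have "?V $ 0 = 1" using Suc e by simp
  thus ?case unfolding nth using Suc by (simp add: algebra_simps)
qed (use e in simp)

lemma near_identity_power_nth:
  fixes Q :: "complex fps"
  assumes Q: "Q $ 0 = 0" "Q $ 1 = 1" "\<And>j. 1 < j \<Longrightarrow> j \<le> e \<Longrightarrow> Q $ j = 0" and e: "e > 0"
  shows "n < i \<Longrightarrow> (Q ^ i) $ n = 0"
    and "i \<le> n \<Longrightarrow> n < i + e \<Longrightarrow> (Q ^ i) $ n = (if n = i then 1 else 0)"
    and "(Q ^ i) $ (i + e) = of_nat i * Q $ (e + 1)"
proof -
  define B where "B = fps_shift (e + 1) Q"
  have "Q = fps_X * (1 + fps_X ^ e * B)"
  proof (rule fps_ext)
    fix n
    consider "n = 0" | "n = 1" | "1 < n" "n \<le> e" | "n = (n - (e + 1)) + (e + 1)" "n > e" by linarith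
    thus "Q $ n = (fps_X * (1 + fps_X ^ e * B)) $ n"
    proof cases
      case 4
      define k where "k = n - (e + 1)"
      have n: "n = Suc (e + k)" using 4 by (simp add: k_def)
      show ?thesis using e by (simp add: n B_def fps_X_power_mult_nth add.commute)
    qed (use Q e in \<open>auto simp: fps_X_power_mult_nth\<close>)
  qed
  hence pow: "Q ^ i = fps_X ^ i * (1 + fps_X ^ e * B) ^ i" by (simp add: power_mult_distrib)
  note W = one_plus_power_nth[OF e, of B i]
  show "n < i \<Longrightarrow> (Q ^ i) $ n = 0" unfolding pow by (simp add: fps_X_power_mult_nth)
  show "i \<le> n \<Longrightarrow> n < i + e \<Longrightarrow> (Q ^ i) $ n = (if n = i then 1 else 0)"
    unfolding pow using W by (auto simp: fps_X_power_mult_nth)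
  show "(Q ^ i) $ (i + e) = of_nat i * Q $ (e + 1)"
    unfolding pow using W by (simp add: fps_X_power_mult_nth B_def)
qed

text \<open>With \<open>Q = t + q * t ^ (e + 1) + ...\<close>, the power \<open>Q ^ i\<close> first
  differs from \<open>t ^ i\<close> at the exponent \<open>i + e\<close>, by \<open>i * q\<close>.
  In the composition the exponent \<open>a + e\<close> is thus the first one affected, and only
  through the term \<open>i = a\<close>.\<close>

lemma near_identity_compose_nth:
  fixes A Q :: "complex fps"
  assumes Q: "Q $ 0 = 0" "Q $ 1 = 1" "\<And>j. 1 < j \<Longrightarrow> j \<le> e \<Longrightarrow> Q $ j = 0" and e: "e > 0"
    and A: "\<And>j. j < a \<Longrightarrow> A $ j = 0"
  shows "n < a + e \<Longrightarrow> (A oo Q) $ n = A $ n"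
    and "(A oo Q) $ (a + e) = A $ (a + e) + of_nat a * Q $ (e + 1) * A $ a"
proof -
  note pow = near_identity_power_nth[OF Q e]
  show "(A oo Q) $ n = A $ n" if n: "n < a + e" for n
  proof -
    have "(A oo Q) $ n = (\<Sum>i=0..n. if i = n then A $ n else 0)"
      unfolding fps_compose_nth
    proof (intro sum.cong refl)
      fix i assume "i \<in> {0..n}"
      thus "A $ i * (Q ^ i) $ n = (if i = n then A $ n else 0)"
        using A[of i] pow(2)[of i n] n by (cases "i < a") auto
    qed
    thus ?thesis by simp
  qed
  have "(A oo Q) $ (a + e) = (\<Sum>i=0..a + e. (if i = a then of_nat a * Q $ (e + 1) * A $ a else 0) +
      (if i = a + e then A $ (a + e) else 0))"
    unfolding fps_compose_nth
  proof (intro sum.cong refl)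
    fix i assume i: "i \<in> {0..a + e}"
    consider "i < a" | "i = a" | "a < i" by linarith
    thus "A $ i * (Q ^ i) $ (a + e) = (if i = a then of_nat a * Q $ (e + 1) * A $ a else 0) +
      (if i = a + e then A $ (a + e) else 0)"
    proof cases
      case 2 thus ?thesis using pow(3)[of a] e by simp
    next
      case 3 thus ?thesis using pow(2)[of i "a + e"] i by auto
    qed (use A[of i] in auto)
  qed
  also have "\<dots> = A $ (a + e) + of_nat a * Q $ (e + 1) * A $ a"
    by (simp add: sum.distrib)
  finally show "(A oo Q) $ (a + e) = A $ (a + e) + of_nat a * Q $ (e + 1) * A $ a" .
qed

text \<open>Comparison of coefficients in \<open>U oo Q = fps_X ^ a\<close>. As long as the lower
  coefficients of \<open>Q\<close> vanish, the one at \<open>a + d\<close> equals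
  \<open>U $ (a + d) + of_nat a * Q $ (d + 1)\<close>, so a gap in \<open>U\<close> forces the same
  gap in \<open>Q\<close> and its end fixes the next coefficient.\<close>

lemma reparametrization_shape:
  fixes U Q :: "complex fps"
  assumes Q: "Q $ 0 = 0" "Q $ 1 = 1" and UQ: "U oo Q = fps_X ^ a" and a: "a > 0" and e: "e > 0"
    and U: "\<And>j. j < a \<Longrightarrow> U $ j = 0" "U $ a = 1" "\<And>j. a < j \<Longrightarrow> j < a + e \<Longrightarrow> U $ j = 0"
  shows "\<And>j. 1 < j \<Longrightarrow> j \<le> e \<Longrightarrow> Q $ j = 0" and "of_nat a * Q $ (e + 1) = - U $ (a + e)"
proof -
  have shape: "\<forall>j. 1 < j \<longrightarrow> j \<le> Suc d \<longrightarrow> Q $ j = 0" if "Suc d \<le> e" for d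
    using that
  proof (induction d)
    case (Suc d)
    have IH: "\<And>j. 1 < j \<Longrightarrow> j \<le> Suc d \<Longrightarrow> Q $ j = 0" using Suc by auto
    have "(U oo Q) $ (a + Suc d) = U $ (a + Suc d) + of_nat a * Q $ (Suc d + 1) * U $ a"
      by (rule near_identity_compose_nth(2)[OF Q IH _ U(1)]) auto
    moreover have "U $ (a + Suc d) = 0" using Suc.prems by (intro U(3)) auto
    ultimately have "Q $ (Suc (Suc d)) = 0" unfolding UQ using a U(2) by (simp add: fps_X_power_nth)
    thus ?case using IH by (auto simp: le_Suc_eq)
  qed auto
  obtain d where d: "e = Suc d" using e by (cases e) auto
  show Qe: "Q $ j = 0" if "1 < j" "j \<le> e" for j using shape[of d] that d by auto
  have "(U oo Q) $ (a + e) = U $ (a + e) + of_nat a * Q $ (e + 1) * U $ a"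
    by (rule near_identity_compose_nth(2)[OF Q Qe e U(1)])
  hence "0 = U $ (a + e) + of_nat a * Q $ (e + 1)"
    unfolding UQ using e U(2) by (simp add: fps_X_power_nth)
  thus "of_nat a * Q $ (e + 1) = - U $ (a + e)" by (simp add: eq_neg_iff_add_eq_0 add.commute)
qed

lemma fps_const_mult_compose:
  fixes F P :: "complex fps"
  assumes "P $ 0 = 0"
  shows "(fps_const a * F) oo P = fps_const a * (F oo P)"
  using fps_compose_mult_distrib[OF assms, of "fps_const a" F] by simp

text \<open>
  If \<open>j = \<gamma> + v1 - v0\<close> with \<open>\<gamma>\<close> a value, adding a multiple of an element of
  order \<open>\<gamma>\<close> to the first coordinate and then renormalizing the parameter, so that the first
  coordinate is again \<open>t ^ v0\<close>, changes the coefficient of \<open>t ^ j\<close> in the second coordinate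
  arbitrarily and none of the lower ones.
\<close>

lemma zariski_elimination:
  fixes R :: "complex fps set"
  assumes add: "\<And>F G. F \<in> R \<Longrightarrow> G \<in> R \<Longrightarrow> F + G \<in> R" and diff: "\<And>F G. F \<in> R \<Longrightarrow> G \<in> R \<Longrightarrow> F - G \<in> R"
    and scale: "\<And>a F. F \<in> R \<Longrightarrow> fps_const a * F \<in> R"
    and conv: "\<And>F. F \<in> R \<Longrightarrow> fps_conv_radius F > 0"
    and \<Gamma>: "\<Gamma> = subdegree ` (R - {0})" and v: "v0 \<in> \<Gamma>" "v1 \<in> \<Gamma>" "0 < v0" "v0 < v1"
  shows "\<exists>P X Y. fps_conv_radius P > 0 \<and> P $ 0 = 0 \<and> P $ 1 \<noteq> 0 \<and> X \<in> R \<and> Y \<in> R \<and>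
    X oo P = fps_X ^ v0 \<and> (\<forall>j<v1. (Y oo P) $ j = 0) \<and> (Y oo P) $ v1 = 1 \<and>
    (\<forall>j. v1 < j \<longrightarrow> j < J \<longrightarrow> (j \<in> \<Gamma> \<or> (\<exists>\<gamma>\<in>\<Gamma>. j + v0 = \<gamma> + v1)) \<longrightarrow> (Y oo P) $ j = 0)"
\<comment> \<open>The exponents below \<open>J\<close> are settled. The elements \<open>X\<close>
  and \<open>Y\<close> stay in the original ring and \<open>P\<close> accumulates the changes of
  parameter, so \<Gamma> always refers to the same ring.\<close>
proof (induction J)
  case 0
  obtain X where X: "X \<in> R" "X \<noteq> 0" "subdegree X = v0" using v(1) \<Gamma> by auto
  obtain Y where Y: "Y \<in> R" "Y \<noteq> 0" "subdegree Y = v1" using v(2) \<Gamma> by auto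
  obtain P where P: "fps_conv_radius P > 0" "P $ 0 = 0" "P $ 1 \<noteq> 0" "X oo P = fps_X ^ v0"
    using root_parameter[OF conv[OF X(1)] X(2,3) v(3)] by blast
  have "subdegree P = 1" by (rule subdegreeI) (use P in auto)
  hence sY: "subdegree (Y oo P) = v1" using Y(3) P(2) by simp
  have YP: "Y oo P \<noteq> 0" using sY v by auto
  define a where "a = (Y oo P) $ v1"
  have a: "a \<noteq> 0" using nth_subdegree_nonzero[OF YP] by (simp add: a_def sY)
  have "(fps_const (1 / a) * Y) oo P = fps_const (1 / a) * (Y oo P)" by (rule fps_const_mult_compose[OF P(2)])
  moreover have "(Y oo P) $ j = 0" if "j < v1" for j
    using that nth_less_subdegree_zero[of j "Y oo P"] by (simp add: sY)
  ultimately have "\<forall>j<v1. ((fps_const (1 / a) * Y) oo P) $ j = 0" "((fps_const (1 / a) * Y) oo P) $ v1 = 1"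
    using a by (simp_all add: a_def)
  thus ?case using P X(1) scale[OF Y(1)] by blast
next
  case (Suc J)
  then obtain P X Y where P: "fps_conv_radius P > 0" "P $ 0 = 0" "P $ 1 \<noteq> 0" and XY: "X \<in> R" "Y \<in> R"
    and X: "X oo P = fps_X ^ v0" and Y0: "\<forall>j<v1. (Y oo P) $ j = 0" "(Y oo P) $ v1 = 1"
      "\<forall>j. v1 < j \<longrightarrow> j < J \<longrightarrow> (j \<in> \<Gamma> \<or> (\<exists>\<gamma>\<in>\<Gamma>. j + v0 = \<gamma> + v1)) \<longrightarrow> (Y oo P) $ j = 0"
    by blast
  note Y = Y0(1)[rule_format] Y0(2) and Y' = Y0(3)[rule_format]
  have sP: "subdegree P = 1" by (rule subdegreeI) (use P in auto)
  have pull: "\<exists>Z\<in>R. subdegree (Z oo P) = k \<and> (Z oo P) $ k = 1" if k: "k \<in> \<Gamma>" for k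
  proof -
    obtain Z where Z: "Z \<in> R" "Z \<noteq> 0" "subdegree Z = k" using k \<Gamma> by auto
    have sZ: "subdegree (Z oo P) = k" using Z(3) P(2) sP by simp
    have ZP: "Z oo P \<noteq> 0" using Z(2) fps_compose_eq_0_iff[OF P(2), of Z] P(3) by auto
    define a where "a = (Z oo P) $ k"
    have a: "a \<noteq> 0" using nth_subdegree_nonzero[OF ZP] by (simp add: a_def sZ)
    have eq: "(fps_const (1 / a) * Z) oo P = fps_const (1 / a) * (Z oo P)" by (rule fps_const_mult_compose[OF P(2)])
    have one: "((fps_const (1 / a) * Z) oo P) $ k = 1" unfolding eq using a by (simp add: a_def)
    moreover have "subdegree ((fps_const (1 / a) * Z) oo P) = k"
    proof (rule subdegreeI)
      show "((fps_const (1 / a) * Z) oo P) $ i = 0" if "i < k" for i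
        unfolding eq using that nth_less_subdegree_zero[of i "Z oo P"] by (simp add: sZ)
    qed (use one in simp)
    ultimately show ?thesis using scale[OF Z(1)] by blast
  qed
  show ?case
  proof (cases "v1 < J \<and> (J \<in> \<Gamma> \<or> (\<exists>\<gamma>\<in>\<Gamma>. J + v0 = \<gamma> + v1))")
    case False
    hence "(Y oo P) $ j = 0" if "v1 < j" "j < Suc J" "j \<in> \<Gamma> \<or> (\<exists>\<gamma>\<in>\<Gamma>. j + v0 = \<gamma> + v1)" for j
      using Y'[of j] that by (cases "j = J") auto
    thus ?thesis using P XY X Y by blast
  next
    case True
    hence J: "v1 < J" by simp
    show ?thesis
    proof (cases "J \<in> \<Gamma>")
      case True
      obtain Z where Z: "Z \<in> R" "subdegree (Z oo P) = J" "(Z oo P) $ J = 1" using pull[OF True] by blast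
      define Y2 where "Y2 = Y - fps_const ((Y oo P) $ J) * Z"
      have "Y2 oo P = (Y oo P) - fps_const ((Y oo P) $ J) * (Z oo P)"
        unfolding Y2_def by (simp only: fps_compose_sub_distrib fps_const_mult_compose[OF P(2)])
      moreover have "(Z oo P) $ j = 0" if "j < J" for j
        using that nth_less_subdegree_zero[of j "Z oo P"] by (simp add: Z(2))
      ultimately have low: "\<And>j. j < J \<Longrightarrow> (Y2 oo P) $ j = (Y oo P) $ j" and top: "(Y2 oo P) $ J = 0"
        using Z(3) by simp_all
      have "Y2 \<in> R" unfolding Y2_def by (intro diff scale XY Z)
      moreover have "\<forall>j<v1. (Y2 oo P) $ j = 0" "(Y2 oo P) $ v1 = 1" using low Y J by simp_all
      moreover have "(Y2 oo P) $ j = 0" if "v1 < j" "j < Suc J" "j \<in> \<Gamma> \<or> (\<exists>\<gamma>\<in>\<Gamma>. j + v0 = \<gamma> + v1)" for j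
        using that top low Y' by (cases "j = J") auto
      ultimately show ?thesis using P XY(1) X by blast
    next
      case False
      then obtain \<gamma> where \<gamma>: "\<gamma> \<in> \<Gamma>" "J + v0 = \<gamma> + v1" using True by blast
      \<comment> \<open>The distance by which \<gamma> exceeds \<open>v0\<close> is the one by which
        \<open>J\<close> exceeds \<open>v1\<close>: a perturbation at \<open>v0 + e\<close> in the
        first coordinate acts on the second at \<open>v1 + e\<close>.\<close>
      define e where "e = \<gamma> - v0"
      have e: "e > 0" "\<gamma> = v0 + e" "J = v1 + e" using \<gamma>(2) J v by (auto simp: e_def)
      obtain Z where Z: "Z \<in> R" "subdegree (Z oo P) = \<gamma>" "(Z oo P) $ \<gamma> = 1" using pull[OF \<gamma>(1)] by blast
      have Zlow: "(Z oo P) $ j = 0" if "j < \<gamma>" for j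
        using that nth_less_subdegree_zero[of j "Z oo P"] by (simp add: Z(2))
      \<comment> \<open>The substitution with \<open>Q $ (e + 1) = \<mu>\<close> adds
        \<open>of_nat v1 * \<mu>\<close> to the coefficient at \<open>J\<close>, and this value
        cancels it. The factor \<open>- of_nat v0\<close> in \<open>X2\<close> is what makes the
        renormalization produce exactly \<mu>.\<close>
      define \<mu> where "\<mu> = - (Y oo P) $ J / of_nat v1"
      define X2 where "X2 = X + fps_const (- of_nat v0 * \<mu>) * Z"
      have X2: "X2 \<in> R" unfolding X2_def by (intro add scale XY Z)
      define U where "U = X2 oo P"
      have U: "U = fps_X ^ v0 + fps_const (- of_nat v0 * \<mu>) * (Z oo P)"
        unfolding U_def X2_def by (simp only: fps_compose_add_distrib fps_const_mult_compose[OF P(2)] X)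
      have Unth: "\<And>j. j < v0 \<Longrightarrow> U $ j = 0" "U $ v0 = 1" "\<And>j. v0 < j \<Longrightarrow> j < v0 + e \<Longrightarrow> U $ j = 0"
        "U $ (v0 + e) = - of_nat v0 * \<mu>"
        unfolding U using Zlow Z(3) e by (simp_all add: fps_X_power_nth)
      have sU: "subdegree U = v0" by (rule subdegreeI) (use Unth in auto)
      have "U \<noteq> 0" using Unth(2) by auto
      moreover have "fps_conv_radius U > 0"
        unfolding U_def by (rule fps_compose_convergent[OF conv[OF X2] P(1,2)])
      ultimately obtain Q where Q: "fps_conv_radius Q > 0" "Q $ 0 = 0" "Q $ 1 = 1" "U oo Q = fps_X ^ v0"
        using root_parameter[of U v0] sU v(3) Unth(2) by blast
      have shape: "Q $ j = 0" if "1 < j" "j \<le> e" for j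
        by (rule reparametrization_shape(1)[OF Q(2,3,4) v(3) e(1) Unth(1-3) that])
      have "of_nat v0 * Q $ (e + 1) = - U $ (v0 + e)"
        by (rule reparametrization_shape(2)[OF Q(2,3,4) v(3) e(1) Unth(1-3)])
      hence Qe: "Q $ (e + 1) = \<mu>" using v(3) Unth(4) by simp
      define P2 where "P2 = P oo Q"
      have assoc: "F oo P2 = (F oo P) oo Q" for F
        unfolding P2_def by (rule fps_compose_assoc[OF Q(2) P(2)])
      note comp = near_identity_compose_nth[where A = "Y oo P" and a = v1, OF Q(2,3) shape e(1) Y(1)]
      have low: "(Y oo P2) $ j = (Y oo P) $ j" if "j < J" for j
        unfolding assoc using comp(1)[of j] that e(3) by simp
      have top: "(Y oo P2) $ J = 0"
        unfolding assoc using comp(2) Y(2) Qe v by (simp add: e(3)[symmetric] \<mu>_def)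
      have "fps_conv_radius P2 > 0" "P2 $ 0 = 0"
        unfolding P2_def using fps_compose_convergent[OF P(1) Q(1,2)] P(2) by simp_all
      moreover have "P2 $ 1 \<noteq> 0" unfolding P2_def using P(2,3) Q(3) by (simp add: fps_compose_nth)
      moreover have "X2 oo P2 = fps_X ^ v0" unfolding assoc U_def[symmetric] by (rule Q(4))
      moreover have "\<forall>j<v1. (Y oo P2) $ j = 0" "(Y oo P2) $ v1 = 1" using low Y J by simp_all
      moreover have "(Y oo P2) $ j = 0" if "v1 < j" "j < Suc J" "j \<in> \<Gamma> \<or> (\<exists>\<gamma>\<in>\<Gamma>. j + v0 = \<gamma> + v1)" for j
        using that top low Y' by (cases "j = J") auto
      ultimately show ?thesis using X2 XY(2) by blast
    qed
  qed
qed

text \<open>Cutting \<open>F\<close> off at \<open>c\<close> changes it by a series of order at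
  least \<open>c\<close>, which lies in \<open>R\<close>. As \<open>S\<close> contains all exponents
  from \<open>c\<close> on, the set of exponents in the sum is finite.\<close>

lemma truncated_element:
  assumes R: "conductor_bound c R" "\<And>F G. F \<in> R \<Longrightarrow> G \<in> R \<Longrightarrow> F - G \<in> R" "\<And>F. F \<in> R \<Longrightarrow> fps_conv_radius F > 0"
    and F: "F \<in> R" "\<And>j. j < w \<Longrightarrow> F $ j = 0" "F $ w = 1" "\<And>j. w < j \<Longrightarrow> j \<in> S \<Longrightarrow> j < c \<Longrightarrow> F $ j = 0"
    and S: "\<And>j. c \<le> j \<Longrightarrow> j \<in> S"
  shows "\<exists>E a. (\<lambda>t. t ^ w + (\<Sum>j | j > w \<and> j \<notin> S. a j * t ^ j)) has_fps_expansion E \<and> E \<in> R \<and>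
    E \<noteq> 0 \<and> subdegree E = w"
proof -
  let ?J = "{j. j > w \<and> j \<notin> S}"
  have fin: "finite ?J" by (rule finite_subset[of _ "{..<c}"]) (use S not_less in auto)
  define E where "E = fps_X ^ w + (\<Sum>j\<in>?J. fps_const (F $ j) * fps_X ^ j)"
  have E_nth: "E $ k = (if k = w then 1 else if k \<in> ?J then F $ k else 0)" for k
  proof -
    have "(\<Sum>j\<in>?J. F $ j * (if k = j then 1 else 0)) = (\<Sum>j\<in>?J. if j = k then F $ k else 0)"
      by (intro sum.cong) auto
    also have "\<dots> = (if k \<in> ?J then F $ k else 0)" using fin by (simp add: sum.delta)
    finally show ?thesis by (auto simp: E_def fps_sum_nth fps_X_power_nth)
  qed
  have exp: "(\<lambda>t. t ^ w + (\<Sum>j\<in>?J. F $ j * t ^ j)) has_fps_expansion E"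
    unfolding E_def by (intro fps_expansion_intros)
  have low: "(F - E) $ j = 0" if "j < c" for j
    using F(2)[of j] F(3) F(4)[of j] that by (cases j w rule: linorder_cases) (auto simp: E_nth)
  have "(\<lambda>t. eval_fps F t - (t ^ w + (\<Sum>j\<in>?J. F $ j * t ^ j))) has_fps_expansion F - E"
    by (intro has_fps_expansion_diff exp eval_fps_has_fps_expansion R(3) F(1))
  hence "F - E \<in> R" using R(1) low unfolding conductor_bound_def by (auto simp: has_fps_expansion_def)
  hence "F - (F - E) \<in> R" by (rule R(2)[OF F(1)])
  hence "E \<in> R" by simp
  moreover have "subdegree E = w" by (rule subdegreeI) (auto simp: E_nth)
  moreover have "E \<noteq> 0" using E_nth[of w] by auto
  ultimately show ?thesis using exp by (intro exI[of _ E] exI[of _ "fps_nth F"]) simp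
qed

section \<open>Generators of semigroups of natural numbers\<close>

lemma semigroup_span_mono:
  assumes "A \<subseteq> B" "finite B"
  shows "semigroup_span A \<subseteq> semigroup_span B"
proof
  fix k assume "k \<in> semigroup_span A"
  then obtain c where "k = (\<Sum>v\<in>A. c v * v)" by (auto simp: semigroup_span_def)
  also have "\<dots> = (\<Sum>v\<in>B. (if v \<in> A then c v else 0) * v)"
    using assms by (intro sum.mono_neutral_cong_left) auto
  finally show "k \<in> semigroup_span B" by (auto simp: semigroup_span_def)
qed

lemma semigroup_span_single: "semigroup_span {a} = {k. a dvd k}"
  by (auto simp: semigroup_span_def dvd_def mult.commute intro: exI[of _ "\<lambda>_. _"])

lemma minimal_generators_irredundant:
  assumes min: "minimal_generators V \<Gamma>" and a: "a \<in> V"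
  shows "a \<notin> semigroup_span (V - {a})"
proof
  assume "a \<in> semigroup_span (V - {a})"
  then obtain d where d: "a = (\<Sum>v\<in>V-{a}. d v * v)" by (auto simp: semigroup_span_def)
  have fin: "finite V" using min by (simp add: minimal_generators_def)
  have "semigroup_span V \<subseteq> semigroup_span (V - {a})"
  proof
    fix k assume "k \<in> semigroup_span V"
    then obtain c where "k = (\<Sum>v\<in>V. c v * v)" by (auto simp: semigroup_span_def)
    also have "\<dots> = c a * a + (\<Sum>v\<in>V-{a}. c v * v)" by (rule sum.remove[OF fin a])
    also have "c a * a = (\<Sum>v\<in>V-{a}. c a * d v * v)"
      unfolding mult.assoc sum_distrib_left[symmetric] d[symmetric] ..
    also have "\<dots> + (\<Sum>v\<in>V-{a}. c v * v) = (\<Sum>v\<in>V-{a}. (c a * d v + c v) * v)"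
      by (simp add: sum.distrib distrib_right)
    finally show "k \<in> semigroup_span (V - {a})"
      unfolding semigroup_span_def by (intro CollectI exI[of _ "\<lambda>v. c a * d v + c v"])
  qed
  moreover have "semigroup_span (V - {a}) \<subseteq> semigroup_span V" by (rule semigroup_span_mono) (use fin in auto)
  ultimately have "semigroup_span (V - {a}) = \<Gamma>" using min by (auto simp: minimal_generators_def)
  thus False using min a unfolding minimal_generators_def by blast
qed

lemma semigroup_span_generator:
  assumes "finite V" "a \<in> V"
  shows "a \<in> semigroup_span V"
proof -
  have "a \<in> semigroup_span {a}" by (simp add: semigroup_span_single)
  thus ?thesis using semigroup_span_mono[of "{a}" V] assms by auto
qed

lemma semigroup_span_ge:
  assumes "finite V" "k \<in> semigroup_span V" "k \<noteq> 0"
  shows "\<exists>x\<in>V. x \<le> k"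
proof -
  obtain c where c: "k = (\<Sum>v\<in>V. c v * v)" using assms by (auto simp: semigroup_span_def)
  with assms(3) have "(\<Sum>v\<in>V. c v * v) \<noteq> 0" by simp
  then obtain x where x: "x \<in> V" "c x * x \<noteq> 0" by (rule sum.not_neutral_contains_not_neutral)
  have "x \<le> c x * x" using x(2) by (cases "c x") auto
  also have "\<dots> \<le> k" unfolding c by (rule member_le_sum[OF x(1)]) (use assms(1) in auto)
  finally show ?thesis using x(1) by blast
qed

text \<open>A combination that is not a multiple of \<open>a\<close> has a nonzero contribution from
  the other generators.\<close>

lemma semigroup_span_ge':
  assumes "finite V" "a \<in> V" "k \<in> semigroup_span V" "\<not> a dvd k"
  shows "\<exists>x\<in>V - {a}. x \<le> k"
proof -
  obtain c where "k = (\<Sum>v\<in>V. c v * v)" using assms by (auto simp: semigroup_span_def)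
  hence c: "k = c a * a + (\<Sum>v\<in>V-{a}. c v * v)" using sum.remove[OF assms(1,2), of "\<lambda>v. c v * v"] by simp
  let ?l = "\<Sum>v\<in>V-{a}. c v * v"
  have "?l \<noteq> 0"
  proof
    assume "?l = 0"
    hence "k = c a * a" using c by linarith
    thus False using assms(4) by simp
  qed
  moreover have "?l \<in> semigroup_span (V - {a})" by (auto simp: semigroup_span_def)
  ultimately obtain x where "x \<in> V - {a}" "x \<le> ?l" using semigroup_span_ge[of "V - {a}" ?l] assms(1) by auto
  thus ?thesis using c by (intro bexI[of _ x]) auto
qed

subsection \<open>The normal form\<close>

lemma line_diff_compose:
  assumes f: "line_diff f f'" and g: "line_diff g g'"
  shows "line_diff (\<lambda>t. f (g t)) (\<lambda>t. g' (f' t))"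
proof -
  have comp: "(\<lambda>t. h (k t)) analytic_on {0}" if "h analytic_on {0}" "k analytic_on {0}" "k 0 = 0"
    for h k :: "complex \<Rightarrow> complex"
    using analytic_on_compose[OF that(2), of h] that(1,3) by (simp add: o_def)
  have pull: "\<forall>\<^sub>F t in nhds 0. P (k t)" if "eventually P (nhds 0)" "k analytic_on {0}" "k 0 = 0"
    for P and k :: "complex \<Rightarrow> complex"
    by (rule eventually_nhds_0_compose[OF that(1) analytic_at_imp_isCont[OF that(2)] that(3)])
  note f' = f[unfolded line_diff_def] and g' = g[unfolded line_diff_def]
  have "\<forall>\<^sub>F t in nhds 0. g (g' (f' t)) = f' t \<and> g' (g (f' t)) = f' t"
    by (rule pull[where k = f']) (use f' g' in auto)
  moreover have "\<forall>\<^sub>F t in nhds 0. f (f' (g t)) = g t \<and> f' (f (g t)) = g t"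
    by (rule pull[where k = g]) (use f' g' in auto)
  moreover have "\<forall>\<^sub>F t in nhds 0. f (f' t) = t \<and> f' (f t) = t" "\<forall>\<^sub>F t in nhds 0. g (g' t) = t \<and> g' (g t) = t"
    using f' g' by auto
  ultimately have "\<forall>\<^sub>F t in nhds 0. f (g (g' (f' t))) = t \<and> g' (f' (f (g t))) = t"
    by eventually_elim simp
  thus ?thesis using f' g' comp unfolding line_diff_def by simp
qed

text \<open>The change of parameter is absorbed into the factor \<rho> of the equivalence.\<close>

lemma degenerate_reparametrization:
  assumes "degenerate m (\<lambda>t. \<phi> (r t))" and r: "line_diff h r"
  shows "degenerate m \<phi>"
proof -
  obtain \<chi> \<rho> \<rho>' \<sigma> \<sigma>' where \<chi>: "parametrization m \<chi>" "\<exists>i<m. \<forall>\<^sub>F t in nhds 0. \<chi> t i = 0"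
    and \<rho>: "line_diff \<rho> \<rho>'" and \<sigma>: "space_diff m \<sigma> \<sigma>'"
    and eq: "\<forall>\<^sub>F t in nhds 0. \<forall>i<m. \<chi> t i = \<sigma> (\<phi> (r (\<rho>' t))) i"
    using assms(1) unfolding degenerate_def A_equivalent_def by blast
  have "A_equivalent m \<phi> \<chi>"
    unfolding A_equivalent_def
    using line_diff_compose[OF \<rho> r] \<sigma> eq
    by (intro exI[of _ "\<lambda>t. \<rho> (h t)"] exI[of _ "\<lambda>t. r (\<rho>' t)"] exI[of _ \<sigma>] exI[of _ \<sigma>']) blast
  thus ?thesis using \<chi> unfolding degenerate_def by blast
qed

lemma monomial_in_ring:
  assumes "conductor_bound c R" "c \<le> j"
  shows "fps_X ^ j \<in> R"
proof -
  have "(\<lambda>t. t ^ j) has_fps_expansion (fps_X ^ j :: complex fps)" by (intro fps_expansion_intros)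
  hence "fps_conv_radius (fps_X ^ j :: complex fps) > 0" by (simp add: has_fps_expansion_def)
  thus ?thesis using assms unfolding conductor_bound_def by (auto simp: fps_X_power_nth)
qed

lemma conductor_in_value_set:
  assumes "parametrization m \<phi>" "conductor_bound c (germ_ring m \<phi>)" "c \<le> j"
  shows "j \<in> value_set m \<phi>"
proof -
  have "subdegree (fps_X ^ j :: complex fps) = j" by (simp add: subdegree_power)
  moreover have "(fps_X ^ j :: complex fps) \<noteq> 0" by simp
  ultimately show ?thesis
    using monomial_in_ring[OF assms(2,3)] unfolding value_set_germ_ring[OF assms(1)]
    by (intro image_eqI[of _ subdegree "fps_X ^ j"]) auto
qed

text \<open>Equality of the value sets alone gives approximation to every finite order. The
  conductor bound \<open>d\<close> of \<psi> turns this into equality of the rings: the remainder at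
  order \<open>d\<close> already lies in the smaller one.\<close>

lemma nondegenerate_missing_value:
  assumes \<phi>: "parametrization m \<phi>" and nd: "\<not> degenerate m \<phi>" and c: "conductor_bound c (germ_ring m \<phi>)"
    and \<psi>: "parametrization k \<psi>" and k: "k < m"
    and mem: "\<And>i. i < k \<Longrightarrow> fps_expansion (\<lambda>t. \<psi> t i) 0 \<in> germ_ring m \<phi>"
  shows "\<exists>l\<in>value_set m \<phi>. l \<notin> value_set k \<psi>"
proof (rule ccontr)
  assume "\<not> ?thesis"
  hence all: "j \<in> value_set k \<psi>" if "j \<in> value_set m \<phi>" for j using that by blast
  have sub: "germ_ring k \<psi> \<subseteq> germ_ring m \<phi>" by (rule germ_ring_subset[OF \<psi> \<phi> mem])
  have "primitive k \<psi>"
    by (rule primitive_if_consecutive_values[OF \<psi>, of c])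
       (use conductor_in_value_set[OF \<phi> c] in \<open>auto intro!: all\<close>)
  then obtain d where d: "conductor_bound d (germ_ring k \<psi>)" using primitive_conductor[OF \<psi>] by blast
  have sub': "germ_ring m \<phi> \<subseteq> germ_ring k \<psi>"
  proof
    fix F assume F: "F \<in> germ_ring m \<phi>"
    obtain H where H: "H \<in> germ_ring k \<psi>" "\<forall>j<d. (F - H) $ j = 0"
      using germ_ring_approximation[OF sub \<psi> \<phi> all F] by blast
    have "fps_conv_radius (F - H) > 0"
      using germ_ring_convergent[OF germ_ring_diff[OF F]] H(1) sub by blast
    hence "F - H \<in> germ_ring k \<psi>" using d H(2) unfolding conductor_bound_def by blast
    from germ_ring_add[OF this H(1)] show "F \<in> germ_ring k \<psi>" by simp
  qed
  have "degenerate m \<phi>" by (rule degenerate_if_generated_by_fewer[OF \<phi> \<psi> k mem sub'])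
  thus False using nd by simp
qed

text \<open>Without coordinates only constants are available. This lets \<open>v 0\<close> fit the
  general pattern, as the least value not attained by the preceding coordinates.\<close>

lemma value_set_0_iff: "k \<in> value_set 0 \<psi> \<longleftrightarrow> k = 0"
proof -
  have \<psi>: "parametrization 0 \<psi>" by (simp add: parametrization_def)
  have "subdegree F = 0" if F: "F \<in> germ_ring 0 \<psi>" for F
  proof -
    obtain g where g: "analytic_germ 0 g" "(\<lambda>t. g (\<psi> t)) has_fps_expansion F"
      using F by (auto simp: germ_ring_def)
    have "\<forall>\<^sub>F t in nhds 0. g (\<psi> t) = g (\<lambda>_. 0)"
      using analytic_germ_along_cong[OF g(1) \<psi>, of "\<lambda>_ _. 0"] by simp
    hence "F = fps_const (g (\<lambda>_. 0))"
      by (intro has_fps_expansion_eqI[OF g(2)]) auto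
    thus ?thesis by simp
  qed
  moreover have "(1 :: complex fps) \<in> germ_ring 0 \<psi> - {0}" using germ_ring_const[of 1 0 \<psi>] by simp
  ultimately show ?thesis unfolding value_set_germ_ring[OF \<psi>] by force
qed

text \<open>The ring consists of series in \<open>t ^ a\<close>. So the values missing after the
  coordinate \<open>t ^ v 0\<close> are exactly those outside the span of \<open>v 0\<close>, and
  \<open>v 1\<close> fits the same pattern.\<close>

lemma value_set_1_monomial:
  assumes \<psi>: "parametrization 1 \<psi>" and mon: "\<And>t. \<psi> t 0 = t ^ a"
  shows "value_set 1 \<psi> = {k. a dvd k}"
proof
  have a: "a > 0" using \<psi> mon[of 0] by (cases a) (auto simp: parametrization_def)
  define \<iota> where "\<iota> = (\<lambda>(s :: complex) (i :: nat). s)"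
  have \<iota>: "parametrization 1 \<iota>" by (simp add: parametrization_def \<iota>_def analytic_intros)
  have X: "(\<lambda>t. t ^ a) has_fps_expansion (fps_X ^ a :: complex fps)" by (intro fps_expansion_intros)
  have X0: "(fps_X ^ a :: complex fps) $ 0 = 0" using a by simp
  have "germ_ring 1 \<psi> = germ_ring 1 (\<lambda>t. \<iota> (t ^ a))"
    by (rule germ_ring_cong[OF \<psi> parametrization_compose[OF \<iota> X X0]]) (simp add: mon \<iota>_def)
  also have "\<dots> = (\<lambda>F. F oo fps_X ^ a) ` germ_ring 1 \<iota>" by (rule germ_ring_compose[OF \<iota> X X0])
  finally have ring: "germ_ring 1 \<psi> = (\<lambda>F. F oo fps_X ^ a) ` germ_ring 1 \<iota>" .
  have "subdegree (F oo fps_X ^ a) = subdegree F * a" for F :: "complex fps"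
    using subdegree_fps_compose[OF X0] by (simp add: subdegree_power)
  thus "value_set 1 \<psi> \<subseteq> {k. a dvd k}"
    unfolding value_set_germ_ring[OF \<psi>] ring by auto
  show "{k. a dvd k} \<subseteq> value_set 1 \<psi>"
  proof
    fix k assume "k \<in> {k. a dvd k}"
    then obtain c where k: "k = a * c" by auto
    have "fps_X ^ a \<in> germ_ring 1 \<psi>"
      by (rule germ_ring_coord[of 0 1 \<psi>]) (use X in \<open>simp_all add: mon\<close>)
    hence "(fps_X ^ a) ^ c \<in> germ_ring 1 \<psi>" by (rule germ_ring_power)
    moreover have "subdegree ((fps_X ^ a) ^ c :: complex fps) = k" by (simp add: k subdegree_power mult.commute)
    ultimately show "k \<in> value_set 1 \<psi>" unfolding value_set_germ_ring[OF \<psi>]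
      by (intro image_eqI[of _ subdegree "(fps_X ^ a) ^ c"]) auto
  qed
qed

lemma value_set_mono:
  assumes "parametrization m \<psi>" "k \<le> m"
  shows "value_set k \<psi> \<subseteq> value_set m \<psi>"
proof -
  have \<psi>: "parametrization k \<psi>" by (rule parametrization_mono[OF assms])
  have "germ_ring k \<psi> \<subseteq> germ_ring m \<psi>"
  proof (rule germ_ring_subset[OF \<psi> assms(1)])
    fix i assume "i < k"
    hence i: "i < m" using assms(2) by simp
    show "fps_expansion (\<lambda>t. \<psi> t i) 0 \<in> germ_ring m \<psi>"
      by (rule germ_ring_coord[where \<phi> = \<psi>, OF i parametrization_expansion[OF assms(1) i]])
  qed
  thus ?thesis unfolding value_set_germ_ring[OF \<psi>] value_set_germ_ring[OF assms(1)] by blast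
qed

lemma value_set_cong:
  assumes "parametrization m \<psi>" "\<And>t i. i < m \<Longrightarrow> \<psi> t i = \<psi>' t i"
  shows "value_set m \<psi> = value_set m \<psi>'"
proof -
  have \<psi>': "parametrization m \<psi>'" using assms by (simp add: parametrization_def)
  have "germ_ring m \<psi> = germ_ring m \<psi>'" by (rule germ_ring_cong[OF assms(1) \<psi>']) (simp add: assms(2))
  thus ?thesis unfolding value_set_germ_ring[OF assms(1)] value_set_germ_ring[OF \<psi>'] by simp
qed

lemma parametrization_if_expansions:
  assumes "\<And>i. i < m \<Longrightarrow> \<exists>E. (\<lambda>t. \<psi> t i) has_fps_expansion E \<and> subdegree E > 0"
  shows "parametrization m \<psi>"
  unfolding parametrization_def
proof (intro allI impI)
  fix i assume "i < m"
  then obtain E where E: "(\<lambda>t. \<psi> t i) has_fps_expansion E" "subdegree E > 0" using assms by blast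
  have "E $ 0 = 0" by (rule nth_less_subdegree_zero[OF E(2)])
  thus "(\<lambda>t. \<psi> t i) analytic_on {0} \<and> \<psi> 0 i = 0"
    using has_fps_expansion_imp_analytic_0[OF E(1)] has_fps_expansion_imp_0_eq_fps_nth_0[OF E(1)] by simp
qed

lemma value_set_reparametrization:
  assumes \<phi>: "parametrization m \<phi>" and P: "fps_conv_radius P > 0" "P $ 0 = 0" "P $ 1 \<noteq> 0"
  shows "value_set m (\<lambda>t. \<phi> (eval_fps P t)) = value_set m \<phi>"
proof -
  note P' = eval_fps_has_fps_expansion[OF P(1)]
  have sP: "subdegree P = 1" by (rule subdegreeI) (use P in auto)
  have "F oo P = 0 \<longleftrightarrow> F = 0" for F using fps_compose_eq_0_iff[OF P(2), of F] P(3) by auto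
  hence "(\<lambda>F. F oo P) ` germ_ring m \<phi> - {0} = (\<lambda>F. F oo P) ` (germ_ring m \<phi> - {0})" by auto
  thus ?thesis
    unfolding value_set_germ_ring[OF parametrization_compose[OF \<phi> P' P(2)]] value_set_germ_ring[OF \<phi>]
      germ_ring_compose[OF \<phi> P' P(2)]
    by (simp add: image_image P(2) sP)
qed

text \<open>Substitutions that fix 0 do not lower orders, so pulling \<open>F\<close> back by the
  inverse parameter preserves its vanishing below \<open>c\<close>.\<close>

lemma conductor_reparametrization:
  assumes \<phi>: "parametrization m \<phi>" and P: "fps_conv_radius P > 0" "P $ 0 = 0" "P $ 1 \<noteq> 0"
    and c: "conductor_bound c (germ_ring m \<phi>)"
  shows "conductor_bound c (germ_ring m (\<lambda>t. \<phi> (eval_fps P t)))"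
  unfolding conductor_bound_def
proof (intro allI impI)
  fix F :: "complex fps" assume F: "fps_conv_radius F > 0" "\<forall>j<c. F $ j = 0"
  note P' = eval_fps_has_fps_expansion[OF P(1)]
  obtain h where h: "line_diff (eval_fps P) h" using local_inverse_exists[OF P' P(2,3)] by blast
  hence H: "h has_fps_expansion fps_expansion h 0" (is "_ has_fps_expansion ?H")
    by (intro analytic_at_imp_has_fps_expansion_0) (simp add: line_diff_def)
  note PH = line_diff_expansion[OF h P' H]
  have "fps_conv_radius ?H > 0" using H by (simp add: has_fps_expansion_def)
  hence "F oo ?H \<in> germ_ring m \<phi>"
    using c fps_compose_convergent[OF F(1) _ PH(2)] fps_compose_vanish[OF F(2), of ?H]
    unfolding conductor_bound_def by blast
  moreover have "(F oo ?H) oo P = F"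
    using fps_compose_assoc[OF P(2) PH(2), of F] PH(4) by simp
  ultimately show "F \<in> germ_ring m (\<lambda>t. \<phi> (eval_fps P t))"
    unfolding germ_ring_compose[OF \<phi> P' P(2)] by (metis imageI)
qed

lemma polynomial_of_value:
  assumes \<phi>: "parametrization m \<phi>" and c: "conductor_bound c (germ_ring m \<phi>)" and w: "w \<in> value_set m \<phi>"
  shows "\<exists>E a. (\<lambda>t. t ^ w + (\<Sum>j | j > w \<and> j \<notin> value_set m \<phi>. a j * t ^ j)) has_fps_expansion E \<and>
    E \<in> germ_ring m \<phi> \<and> E \<noteq> 0 \<and> subdegree E = w"
proof -
  let ?R = "germ_ring m \<phi>"
  obtain F0 where F0: "F0 \<in> ?R" "F0 \<noteq> 0" "subdegree F0 = w"
    using w unfolding value_set_germ_ring[OF \<phi>] by blast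
  define F where "F = fps_const (1 / F0 $ w) * F0"
  have F: "F \<in> ?R" unfolding F_def by (intro germ_ring_mult germ_ring_const F0)
  have Fw: "F $ w = 1" using nth_subdegree_nonzero[OF F0(2)] by (simp add: F_def F0(3))
  have Flow: "F $ j = 0" if "j < w" for j
    using nth_less_subdegree_zero[of j F0] that by (simp add: F_def F0(3))
  \<comment> \<open>Elimination is confined to elements of order above \<open>w\<close>, which
    protects the leading coefficient 1 and the zeros below it.\<close>
  define V where "V = {Z \<in> ?R. \<forall>j\<le>w. Z $ j = 0}"
  have "\<exists>H\<in>V. \<forall>j<c. j \<in> subdegree ` (V - {0}) \<longrightarrow> (F - H) $ j = 0"
    by (rule eliminate_values) (auto simp: V_def intro: germ_ring_add germ_ring_mult)
  then obtain H where H: "H \<in> V" "\<forall>j<c. j \<in> subdegree ` (V - {0}) \<longrightarrow> (F - H) $ j = 0"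
    by (rule bexE) (rule that)
  have val: "j \<in> subdegree ` (V - {0})" if j: "w < j" "j \<in> value_set m \<phi>" for j
  proof -
    obtain Z where Z: "Z \<in> ?R" "Z \<noteq> 0" "subdegree Z = j"
      using j(2) unfolding value_set_germ_ring[OF \<phi>] by blast
    have "Z $ i = 0" if "i \<le> w" for i using that j(1) Z(3) by (intro nth_less_subdegree_zero) simp
    hence "Z \<in> V" using Z(1) by (simp add: V_def)
    thus ?thesis using Z by blast
  qed
  show ?thesis
  proof (rule truncated_element[OF c])
    show "F - H \<in> ?R" using F H(1) by (auto simp: V_def intro: germ_ring_diff)
    show "(F - H) $ j = 0" if "j < w" for j using Flow[OF that] H(1) that by (simp add: V_def)
    show "(F - H) $ w = 1" using Fw H(1) by (simp add: V_def)
    show "(F - H) $ j = 0" if "w < j" "j \<in> value_set m \<phi>" "j < c" for j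
      using val[OF that(1,2)] H(2) that(3) by blast
    show "j \<in> value_set m \<phi>" if "c \<le> j" for j by (rule conductor_in_value_set[OF \<phi> c that])
  qed (auto intro: germ_ring_diff germ_ring_convergent)
qed

theorem theorem5p3:
  fixes n g :: nat and v :: "nat \<Rightarrow> nat" and \<Gamma> :: "nat set"
    and \<phi> :: "complex \<Rightarrow> nat \<Rightarrow> complex"
  assumes "n \<ge> 1"
    and "parametrization (n + 1) \<phi>"
    and "primitive (n + 1) \<phi>"
    and "\<not> degenerate (n + 1) \<phi>"
    and "\<Gamma> = value_set (n + 1) \<phi>"
    and "strict_mono_on {..g} v"
    and "minimal_generators (v ` {..g}) \<Gamma>"
  shows "\<exists>(\<psi> :: complex \<Rightarrow> nat \<Rightarrow> complex) (w :: nat \<Rightarrow> nat) (a :: nat \<Rightarrow> nat \<Rightarrow> complex).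
    parametrization (n + 1) \<psi> \<and> A_equivalent (n + 1) \<phi> \<psi> \<and>
    (\<forall>t. \<psi> t 0 = t ^ v 0) \<and>
    (\<forall>t. \<psi> t 1 = t ^ w 1 +
       (\<Sum>j | j > w 1 \<and> j \<notin> \<Gamma> \<union> {\<gamma> + v 1 - v 0 | \<gamma>. \<gamma> \<in> \<Gamma>}. a 1 j * t ^ j)) \<and>
    (\<forall>i\<in>{2..n}. \<forall>t. \<psi> t i = t ^ w i + (\<Sum>j | j > w i \<and> j \<notin> \<Gamma>. a i j * t ^ j)) \<and>
    v 0 < w 1 \<and> strict_mono_on {1..n} w \<and>
    w 1 = v 1 \<and> is_minimum (v 1) (\<Gamma> - semigroup_span {v 0}) \<and>
    (\<forall>i\<in>{2..n}. is_minimum (w i) (\<Gamma> - value_set i \<psi>))"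
proof -
  define N where "N = n + 1"
  note \<phi> = assms(2)[folded N_def] and nd = assms(4)[folded N_def]
  let ?S = "germ_ring N \<phi>"
  have N2: "N \<ge> 2" using assms(1) by (simp add: N_def)
  have \<Gamma>: "\<Gamma> = value_set N \<phi>" "\<Gamma> = subdegree ` (?S - {0})"
    using assms(5) value_set_germ_ring[OF \<phi>] by (simp_all add: N_def)
  obtain c where c: "conductor_bound c ?S"
    using primitive_conductor[OF \<phi>] assms(3) by (auto simp: N_def)
  define V where "V = v ` {..g}"
  note gens = assms(7)[folded V_def]
  have V: "finite V" "semigroup_span V = \<Gamma>" "v 0 \<in> V"
    using gens by (auto simp: V_def minimal_generators_def)
  have v_mono: "v i < v j" if "i < j" "j \<le> g" for i j
    using assms(6) that by (auto simp: strict_mono_on_def)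
  \<comment> \<open>Since 0 is spanned by every set, even the empty one, a generator equal to 0
    would be redundant.\<close>
  have "0 \<in> semigroup_span A" for A unfolding semigroup_span_def by (intro CollectI exI[of _ "\<lambda>_. 0"]) simp
  hence v0: "v 0 > 0" using minimal_generators_irredundant[OF gens V(3)] by (metis gr0I)
  have v0\<Gamma>: "v 0 \<in> \<Gamma>" using semigroup_span_generator[OF V(1,3)] V(2) by simp
  have v0_min: "v 0 \<le> k" if "k \<in> \<Gamma>" "k \<noteq> 0" for k
  proof -
    obtain x where "x \<in> V" "x \<le> k"
      using semigroup_span_ge[OF V(1), of k] \<open>k \<in> \<Gamma>\<close> \<open>k \<noteq> 0\<close> V(2) by blast
    then obtain i where "i \<le> g" "v i \<le> k" by (auto simp: V_def)
    thus ?thesis using v_mono[of 0 i] by (cases "i = 0") auto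
  qed
  have v1_le: "1 \<le> g \<and> v 1 \<le> k" if k: "k \<in> \<Gamma>" "\<not> v 0 dvd k" for k
  proof -
    obtain x where "x \<in> V - {v 0}" "x \<le> k"
      using semigroup_span_ge'[OF V(1,3) _ k(2)] k(1) V(2) by blast
    then obtain i where i: "i \<le> g" "v i \<noteq> v 0" "v i \<le> k" by (auto simp: V_def)
    hence "1 \<le> i" by (cases i) auto
    thus ?thesis using i v_mono[of 1 i] by (cases "i = 1") auto
  qed
  \<comment> \<open>Otherwise the single coordinate \<open>t ^ v 0\<close>, in a suitable parameter,
    would attain all values, which non-degeneracy excludes because \<open>N \<ge> 2\<close>. It
    follows that a generator \<open>v 1\<close> exists.\<close>
  have "\<exists>l\<in>\<Gamma>. \<not> v 0 dvd l"
  proof -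
    obtain X where X': "v 0 = subdegree X" "X \<in> ?S - {0}"
      using v0\<Gamma>[unfolded \<Gamma>(2)] by (rule imageE) (rule that)
    hence X: "X \<in> ?S" "X \<noteq> 0" "subdegree X = v 0" by simp_all
    obtain P where P: "fps_conv_radius P > 0" "P $ 0 = 0" "P $ 1 \<noteq> 0" "X oo P = fps_X ^ v 0"
      using root_parameter[OF germ_ring_convergent[OF X(1)] X(2,3) v0] by blast
    note P' = eval_fps_has_fps_expansion[OF P(1)]
    obtain h where h: "line_diff (eval_fps P) h" using local_inverse_exists[OF P' P(2,3)] by blast
    let ?\<phi> = "\<lambda>t. \<phi> (eval_fps P t)"
    define \<psi> where "\<psi> = (\<lambda>(t :: complex) (i :: nat). t ^ v 0)"
    have exp: "(\<lambda>t. \<psi> t i) has_fps_expansion fps_X ^ v 0" for i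
      unfolding \<psi>_def by (intro fps_expansion_intros)
    have \<psi>: "parametrization 1 \<psi>"
      using v0 by (auto simp: parametrization_def \<psi>_def intro!: analytic_intros)
    have "fps_expansion (\<lambda>t. \<psi> t i) 0 \<in> germ_ring N ?\<phi>" for i
      unfolding fps_expansion_eqI[OF exp] germ_ring_compose[OF \<phi> P' P(2)]
      using X(1) P(4) by (metis imageI)
    hence "\<exists>l\<in>value_set N ?\<phi>. l \<notin> value_set 1 \<psi>"
      using nd degenerate_reparametrization[OF _ line_diff_sym[OF h]] N2
      by (intro nondegenerate_missing_value[OF parametrization_compose[OF \<phi> P' P(2)] _
            conductor_reparametrization[OF \<phi> P(1-3) c] \<psi>]) auto
    thus ?thesis
      unfolding value_set_reparametrization[OF \<phi> P(1-3)] \<Gamma>(1)[symmetric]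
      by (subst (asm) value_set_1_monomial[OF \<psi>]) (auto simp: \<psi>_def)
  qed
  hence g1: "1 \<le> g" using v1_le by blast
  have v1: "v 0 < v 1" "v 1 \<in> V" using v_mono[of 0 1] g1 by (auto simp: V_def)
  have v1\<Gamma>: "v 1 \<in> \<Gamma>" using semigroup_span_generator[OF V(1) v1(2)] V(2) by simp
  have v1_ndvd: "\<not> v 0 dvd v 1"
  proof
    assume "v 0 dvd v 1"
    hence "v 1 \<in> semigroup_span {v 0}" by (simp add: semigroup_span_single)
    also have "\<dots> \<subseteq> semigroup_span (V - {v 1})"
      by (rule semigroup_span_mono) (use V v1 in auto)
    finally show False using minimal_generators_irredundant[OF gens v1(2)] by simp
  qed
  have min1: "is_minimum (v 1) (\<Gamma> - semigroup_span {v 0})"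
    using v1\<Gamma> v1_ndvd v1_le by (auto simp: is_minimum_def semigroup_span_single)
  \<comment> \<open>Clearing exponents below \<open>c\<close> suffices, since from \<open>c\<close>
    on the tail lies in the ring and is cut off afterwards.\<close>
  have "\<exists>P X Y. fps_conv_radius P > 0 \<and> P $ 0 = 0 \<and> P $ 1 \<noteq> 0 \<and> X \<in> ?S \<and> Y \<in> ?S \<and>
    X oo P = fps_X ^ v 0 \<and> (\<forall>j<v 1. (Y oo P) $ j = 0) \<and> (Y oo P) $ v 1 = 1 \<and>
    (\<forall>j. v 1 < j \<longrightarrow> j < c \<longrightarrow> (j \<in> \<Gamma> \<or> (\<exists>\<gamma>\<in>\<Gamma>. j + v 0 = \<gamma> + v 1)) \<longrightarrow> (Y oo P) $ j = 0)"
    by (rule zariski_elimination[OF _ _ _ _ \<Gamma>(2) v0\<Gamma> v1\<Gamma> v0 v1(1)])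
       (auto intro: germ_ring_add germ_ring_diff germ_ring_mult germ_ring_convergent)
  then obtain P X Y where P: "fps_conv_radius P > 0" "P $ 0 = 0" "P $ 1 \<noteq> 0" and XY: "X \<in> ?S" "Y \<in> ?S"
    and X: "X oo P = fps_X ^ v 0" and Y: "\<forall>j<v 1. (Y oo P) $ j = 0" "(Y oo P) $ v 1 = 1"
      "\<forall>j. v 1 < j \<longrightarrow> j < c \<longrightarrow> (j \<in> \<Gamma> \<or> (\<exists>\<gamma>\<in>\<Gamma>. j + v 0 = \<gamma> + v 1)) \<longrightarrow> (Y oo P) $ j = 0"
    by blast
  note P' = eval_fps_has_fps_expansion[OF P(1)]
  obtain h where h: "line_diff (eval_fps P) h" using local_inverse_exists[OF P' P(2,3)] by blast
  define \<phi>' where "\<phi>' = (\<lambda>t. \<phi> (eval_fps P t))"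
  let ?R = "germ_ring N \<phi>'"
  have \<phi>': "parametrization N \<phi>'" unfolding \<phi>'_def by (rule parametrization_compose[OF \<phi> P' P(2)])
  have R: "?R = (\<lambda>F. F oo P) ` ?S" unfolding \<phi>'_def by (rule germ_ring_compose[OF \<phi> P' P(2)])
  have \<Gamma>': "value_set N \<phi>' = \<Gamma>" unfolding \<phi>'_def \<Gamma>(1) by (rule value_set_reparametrization[OF \<phi> P])
  have c': "conductor_bound c ?R" unfolding \<phi>'_def by (rule conductor_reparametrization[OF \<phi> P c])
  have nd': "\<not> degenerate N \<phi>'"
    using nd degenerate_reparametrization[OF _ line_diff_sym[OF h]] unfolding \<phi>'_def by blast
  have cofin: "j \<in> \<Gamma>" if "c \<le> j" for j using conductor_in_value_set[OF \<phi>' c' that] \<Gamma>' by simp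
  let ?B = "\<Gamma> \<union> {\<gamma> + v 1 - v 0 | \<gamma>. \<gamma> \<in> \<Gamma>}"
  have "\<exists>E a. (\<lambda>t. t ^ v 1 + (\<Sum>j | j > v 1 \<and> j \<notin> ?B. a j * t ^ j)) has_fps_expansion E \<and> E \<in> ?R \<and>
    E \<noteq> 0 \<and> subdegree E = v 1"
  proof (rule truncated_element[OF c'])
    show "Y oo P \<in> ?R" unfolding R using XY(2) by blast
    show "(Y oo P) $ j = 0" if "v 1 < j" "j \<in> ?B" "j < c" for j
    proof -
      \<comment> \<open>The subtraction in \<open>\<gamma> + v 1 - v 0\<close> is not truncated,
        because \<open>v 0 < v 1\<close>.\<close>
      have "j \<in> \<Gamma> \<or> (\<exists>\<gamma>\<in>\<Gamma>. j + v 0 = \<gamma> + v 1)" using that(2) v1(1) by auto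
      thus ?thesis using Y(3) that by blast
    qed
  qed (use Y cofin in \<open>auto intro: germ_ring_diff germ_ring_convergent\<close>)
  then obtain E1 a1 where E1: "(\<lambda>t. t ^ v 1 + (\<Sum>j | j > v 1 \<and> j \<notin> ?B. a1 j * t ^ j)) has_fps_expansion E1"
    "E1 \<in> ?R" "E1 \<noteq> 0" "subdegree E1 = v 1" by blast
  \<comment> \<open>The invariant for the coordinates below \<open>k\<close>, meant for
    \<open>k \<ge> 2\<close>. It treats \<open>w 0 = v 0\<close> and \<open>w 1 = v 1\<close> as
    minima like all the others, so that the coordinate change can be justified uniformly. That
    \<psi> is a parametrization follows from the positive orders.\<close>
  define good where "good = (\<lambda>k (\<psi> :: complex \<Rightarrow> nat \<Rightarrow> complex) (w :: nat \<Rightarrow> nat) (a :: nat \<Rightarrow> nat \<Rightarrow> complex).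
    (\<forall>t. \<psi> t 0 = t ^ v 0) \<and>
    (\<forall>t. \<psi> t 1 = t ^ w 1 + (\<Sum>j | j > w 1 \<and> j \<notin> ?B. a 1 j * t ^ j)) \<and>
    (\<forall>i\<in>{2..<k}. \<forall>t. \<psi> t i = t ^ w i + (\<Sum>j | j > w i \<and> j \<notin> \<Gamma>. a i j * t ^ j)) \<and>
    w 0 = v 0 \<and> w 1 = v 1 \<and>
    (\<forall>i<k. \<exists>E\<in>?R. (\<lambda>t. \<psi> t i) has_fps_expansion E \<and> E \<noteq> 0 \<and> subdegree E = w i) \<and>
    (\<forall>i<k. is_minimum (w i) (\<Gamma> - value_set i \<psi>)))"
  have good_pos: "w i > 0" if "good k \<psi> w a" "i < k" for k \<psi> w a i
  proof -
    have "w i \<notin> value_set i \<psi>" using that by (auto simp: good_def is_minimum_def)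
    moreover have "0 \<in> value_set i \<psi>"
    proof -
      have "analytic_germ i (\<lambda>_. 1)" by simp
      moreover have "germ_ord (\<lambda>_. 1) = enat 0"
        using germ_ord_has_fps_expansion[of "\<lambda>_. 1" 1] by auto
      ultimately show ?thesis unfolding value_set_def by (intro CollectI exI[of _ "\<lambda>_. 1"]) simp
    qed
    ultimately show ?thesis by (metis gr0I)
  qed
  have good_param: "parametrization k \<psi>" if "good k \<psi> w a" for k \<psi> w a
    by (rule parametrization_if_expansions) (use that good_pos[OF that] in \<open>fastforce simp: good_def\<close>)
  have good_mem: "fps_expansion (\<lambda>t. \<psi> t i) 0 \<in> ?R \<and> fps_expansion (\<lambda>t. \<psi> t i) 0 \<noteq> 0 \<and>
      subdegree (fps_expansion (\<lambda>t. \<psi> t i) 0) = w i" if "good k \<psi> w a" "i < k" for k \<psi> w a i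
  proof -
    obtain E where "E \<in> ?R" "(\<lambda>t. \<psi> t i) has_fps_expansion E" "E \<noteq> 0" "subdegree E = w i"
      using \<open>good k \<psi> w a\<close> \<open>i < k\<close> unfolding good_def by blast
    thus ?thesis by (simp add: fps_expansion_eqI)
  qed
  have "\<exists>\<psi> w a. good k \<psi> w a" if "2 \<le> k" "k \<le> N" for k
    using that
  proof (induction k rule: dec_induct)
    case base
    define \<psi> where "\<psi> = (\<lambda>t (i :: nat). if i = 0 then t ^ v 0
      else t ^ v 1 + (\<Sum>j | j > v 1 \<and> j \<notin> ?B. a1 j * t ^ j))"
    define w where "w = (\<lambda>i::nat. if i = 0 then v 0 else v 1)"
    have E0: "(\<lambda>t. \<psi> t 0) has_fps_expansion fps_X ^ v 0" unfolding \<psi>_def by (simp add: fps_expansion_intros)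
    have X': "fps_X ^ v 0 \<in> ?R" unfolding R using XY(1) X by (metis imageI)
    have \<psi>1: "parametrization 1 \<psi>"
      by (rule parametrization_if_expansions) (use E0 v0 in \<open>auto simp: subdegree_power intro!: exI[of _ "fps_X ^ v 0"]\<close>)
    have exps: "\<exists>E\<in>?R. (\<lambda>t. \<psi> t i) has_fps_expansion E \<and> E \<noteq> 0 \<and> subdegree E = w i" if "i < 2" for i
    proof (cases "i = 0")
      case True
      thus ?thesis using E0 X' by (intro bexI[of _ "fps_X ^ v 0"]) (auto simp: w_def subdegree_power)
    next
      case False
      thus ?thesis using E1 by (intro bexI[of _ E1]) (auto simp: w_def \<psi>_def)
    qed
    have mins: "is_minimum (w i) (\<Gamma> - value_set i \<psi>)" if "i < 2" for i
    proof (cases "i = 0")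
      case True
      thus ?thesis using v0 v0\<Gamma> v0_min by (auto simp: is_minimum_def w_def value_set_0_iff)
    next
      case False
      hence "i = 1" using that by simp
      moreover have "value_set 1 \<psi> = {k. v 0 dvd k}"
        by (rule value_set_1_monomial[OF \<psi>1]) (simp add: \<psi>_def)
      ultimately show ?thesis using min1 by (simp add: w_def semigroup_span_single)
    qed
    have "good 2 \<psi> w (\<lambda>_. a1)"
      unfolding good_def using exps mins by (simp add: \<psi>_def w_def)
    thus ?case by blast
  next
    case (step k)
    then obtain \<psi> w a where G: "good k \<psi> w a" by auto
    have k: "k < N" "2 \<le> k" using step by auto
    note \<psi> = good_param[OF G]
    have "\<exists>l\<in>value_set N \<phi>'. l \<notin> value_set k \<psi>"
      using good_mem[OF G] by (intro nondegenerate_missing_value[OF \<phi>' nd' c' \<psi> k(1)]) auto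
    hence ex: "\<exists>l. l \<in> \<Gamma> \<and> l \<notin> value_set k \<psi>" using \<Gamma>' by blast
    \<comment> \<open>The least value still missing becomes the order of the next coordinate;
      non-degeneracy has just provided one.\<close>
    define u where "u = (LEAST l. l \<in> \<Gamma> \<and> l \<notin> value_set k \<psi>)"
    have u: "u \<in> \<Gamma>" "u \<notin> value_set k \<psi>" using LeastI_ex[OF ex] by (simp_all add: u_def)
    have u_le: "u \<le> l" if "l \<in> \<Gamma>" "l \<notin> value_set k \<psi>" for l
      unfolding u_def using that by (intro Least_le) simp
    obtain E b where E: "(\<lambda>t. t ^ u + (\<Sum>j | j > u \<and> j \<notin> \<Gamma>. b j * t ^ j)) has_fps_expansion E"
      "E \<in> ?R" "E \<noteq> 0" "subdegree E = u"
      using polynomial_of_value[OF \<phi>' c', of u] u(1) unfolding \<Gamma>' by blast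
    define \<psi>' where "\<psi>' = (\<lambda>t i. if i = k then t ^ u + (\<Sum>j | j > u \<and> j \<notin> \<Gamma>. b j * t ^ j) else \<psi> t i)"
    have old: "\<psi>' t i = \<psi> t i" if "i < k" for t i using that by (simp add: \<psi>'_def)
    \<comment> \<open>The set for \<open>i\<close> involves only the coordinates below
      \<open>i\<close>. Appending a coordinate therefore preserves the earlier minima, although they
      refer to the parametrization still under construction.\<close>
    have vs: "value_set i \<psi>' = value_set i \<psi>" if "i \<le> k" for i
      by (rule value_set_cong[symmetric, OF parametrization_mono[OF \<psi> that]]) (use that in \<open>simp add: old\<close>)
    have "good (Suc k) \<psi>' (w(k := u)) (a(k := b))"
      unfolding good_def
    proof (intro conjI allI impI ballI)
      fix i assume i: "i \<in> {2..<Suc k}"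
      show "\<psi>' t i = t ^ (w(k := u)) i + (\<Sum>j | j > (w(k := u)) i \<and> j \<notin> \<Gamma>. (a(k := b)) i j * t ^ j)" for t
      proof (cases "i = k")
        case False
        thus ?thesis using G i old[of i] by (simp add: good_def)
      qed (simp add: \<psi>'_def)
    next
      fix i assume i: "i < Suc k"
      show "\<exists>E\<in>?R. (\<lambda>t. \<psi>' t i) has_fps_expansion E \<and> E \<noteq> 0 \<and> subdegree E = (w(k := u)) i"
      proof (cases "i = k")
        case True
        thus ?thesis using E by (intro bexI[of _ E]) (simp_all add: \<psi>'_def)
      next
        case False
        hence "i < k" using i by simp
        hence "\<exists>E\<in>?R. (\<lambda>t. \<psi> t i) has_fps_expansion E \<and> E \<noteq> 0 \<and> subdegree E = w i"
          using G unfolding good_def by blast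
        thus ?thesis using False old[OF \<open>i < k\<close>] by simp
      qed
      show "is_minimum ((w(k := u)) i) (\<Gamma> - value_set i \<psi>')"
      proof (cases "i = k")
        case True
        thus ?thesis using u u_le vs by (auto simp: is_minimum_def)
      next
        case False
        thus ?thesis using G i vs[of i] by (simp add: good_def)
      qed
    qed (use G k old in \<open>simp_all add: good_def\<close>)
    thus ?case by blast
  qed
  then obtain \<psi> w a where G: "good N \<psi> w a" using N2 by blast
  note \<psi> = good_param[OF G]
  have w_min: "w i \<in> \<Gamma>" "w i \<notin> value_set i \<psi>" "\<And>l. l \<in> \<Gamma> \<Longrightarrow> l \<notin> value_set i \<psi> \<Longrightarrow> w i \<le> l" if "i < N" for i
    using G that by (auto simp: good_def is_minimum_def)
  \<comment> \<open>The number \<open>w j\<close> is missing for the first \<open>j\<close>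
    coordinates, hence for the first \<open>i\<close>, so \<open>w i \<le> w j\<close>. They differ
    because \<open>w i\<close> is attained by the coordinate \<open>i\<close> itself.\<close>
  have w_mono: "w i < w j" if ij: "i < j" "j < N" for i j
  proof -
    have vs: "value_set k \<psi> \<subseteq> value_set j \<psi>" if "k \<le> j" for k
      by (rule value_set_mono[OF parametrization_mono[OF \<psi>] that]) (use ij in simp)
    have "w i \<in> value_set (Suc i) \<psi>"
    proof -
      have p: "parametrization (Suc i) \<psi>" using parametrization_mono[OF \<psi>] ij by simp
      have "fps_expansion (\<lambda>t. \<psi> t i) 0 \<in> germ_ring (Suc i) \<psi>"
        by (rule germ_ring_coord[where \<phi> = \<psi>, OF lessI parametrization_expansion[OF p lessI]])
      thus ?thesis unfolding value_set_germ_ring[OF p] using good_mem[OF G, of i] ij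
        by (intro image_eqI[of _ subdegree "fps_expansion (\<lambda>t. \<psi> t i) 0"]) auto
    qed
    hence "w i \<in> value_set j \<psi>" using vs[of "Suc i"] ij by auto
    hence "w i \<noteq> w j" using w_min(2)[OF ij(2)] by auto
    moreover have "w i \<le> w j"
      using w_min(3)[of i "w j"] w_min(1,2)[OF ij(2)] vs[of i] ij by auto
    ultimately show ?thesis by simp
  qed
  have "\<exists>\<sigma> \<sigma>'. space_diff N \<sigma> \<sigma>' \<and> (\<forall>\<^sub>F t in nhds 0. \<forall>i<N. \<psi> t i = \<sigma> (\<phi>' t) i)"
  proof (rule minimal_values_coordinate_change[OF \<phi>' \<psi>, where w = w])
    fix i j assume "i < N" "j \<in> value_set N \<phi>'" "j < w i"
    thus "j \<in> value_set i \<psi>" using w_min(3)[of i j] \<Gamma>' by force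
  qed (use good_mem[OF G] w_mono w_min in auto)
  then obtain \<sigma> \<sigma>' where \<sigma>: "space_diff N \<sigma> \<sigma>'" "\<forall>\<^sub>F t in nhds 0. \<forall>i<N. \<psi> t i = \<sigma> (\<phi>' t) i" by blast
  \<comment> \<open>The definition evaluates \<phi> at the inverse change of parameter. Thus
    \<open>eval_fps P\<close> takes the place of \<open>\<rho>'\<close>, and its local inverse
    \<open>h\<close> that of \<open>\<rho>\<close>.\<close>
  have "A_equivalent N \<phi> \<psi>"
    unfolding A_equivalent_def
    using line_diff_sym[OF h] \<sigma>
    by (intro exI[of _ h] exI[of _ "eval_fps P"] exI[of _ \<sigma>] exI[of _ \<sigma>']) (simp add: \<phi>'_def)
  moreover have "strict_mono_on {1..n} w"
    using w_mono by (auto simp: strict_mono_on_def N_def)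
  ultimately show ?thesis
    using G \<psi> v1(1) min1 unfolding good_def N_def
    by (intro exI[of _ \<psi>] exI[of _ w] exI[of _ a]) auto
qed

end
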